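(* Let $d\geq 1$, and let $E\subset \mathbb{R}^d$ and $\Gamma\subset \mathbb{R}^d\times\mathbb{R}_{>0}$ be non-empty Borel sets. Let $\Gamma(E)=\{rx+z: x\in E, (z,r)\in\Gamma\}\subset\mathbb{R}^d$. Then: (i) $\dim_{\mathcal S}\Gamma(E)\geq \dim_{\mathcal H}E+\dim_{\mathcal H}\Gamma-d$. (ii) If $\dim_{\mathcal H}E+\dim_{\mathcal H}\Gamma>2d$, then $\mathcal{L}^d(\Gamma(E))>0$. (iii) For $0<u<d$, if $\dim_{\mathcal H}E+\dim_{\mathcal H}\Gamma>d+u$, then $\dim_{\mathcal H}\Gamma(E)\geq u$.
   Context: $\mathcal{L}^d$ is Lebesgue measure on $\mathbb{R}^d$ and $\dim_{\mathcal H}$ is Hausdorff dimension (for $\Gamma$, with respect to the Euclidean metric of $\mathbb{R}^{d+1}$). For $A\subset\mathbb{R}^d$, $\mathcal{M}(A)$ is the set of non-zero Radon measures on $\mathbb{R}^d$ with compact support contained in $A$. The Fourier transform is $\widehat{\mu}(\xi)=\int e^{-2\pi i\xi\cdot x}\,d\mu(x)$. The Sobolev dimension of $\mu\in\mathcal{M}(\mathbb{R}^d)$ is $\dim_{\mathcal S}\mu=\sup\{s\in\mathbb{R}: \int|\widehat{\mu}(x)|^2(1+|x|)^{s-d}\,dx<\infty\}$, and the Sobolev dimension of a set $A$ is $\dim_{\mathcal S}A=\sup\{\dim_{\mathcal S}\mu:\ \mu\in\mathcal{M}(A)\text{ a probability measure}\}$. *)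

theory Defs
  imports "HOL-Probability.Probability"
begin

text \<open>
  The power \<open>diam(U) ^ s\<close> used in coverings, with the usual conventions \<open>diam(U) ^ 0 = 1\<close> for
  non-empty \<open>U\<close> (whereas \<open>0 powr 0 = 0\<close>) and \<open>diam({}) ^ s = 0\<close>.
  Only meaningful for bounded \<open>U\<close>.
\<close>

definition diam_pow :: "real \<Rightarrow> 'a::metric_space set \<Rightarrow> ennreal" where
  "diam_pow s U =
     (if U = {} then 0 else if s = 0 then 1 else ennreal (diameter U powr s))"

text \<open>
  Boundedness of the covering sets is required explicitly because \<^const>\<open>diameter\<close> is real-valued
  and hence carries no information about unbounded sets.
\<close>

definition hausdorff_premeasure :: "real \<Rightarrow> real \<Rightarrow> 'a::metric_space set \<Rightarrow> ennreal" where
  "hausdorff_premeasure s \<delta> A =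
     (INF U \<in> {U :: nat \<Rightarrow> 'a set. A \<subseteq> (\<Union>i. U i) \<and> (\<forall>i. bounded (U i) \<and> diameter (U i) \<le> \<delta>)}.
        \<Sum>i. diam_pow s (U i))"

definition hausdorff_measure :: "real \<Rightarrow> 'a::metric_space set \<Rightarrow> ennreal" where
  "hausdorff_measure s A = (SUP \<delta> \<in> {0<..}. hausdorff_premeasure s \<delta> A)"

definition hausdorff_dim :: "'a::metric_space set \<Rightarrow> ereal" where
  "hausdorff_dim A = Inf {ereal s | s. 0 \<le> s \<and> hausdorff_measure s A = 0}"

definition radon_measure :: "'a::topological_space measure \<Rightarrow> bool" where
  "radon_measure \<mu> \<longleftrightarrow>
     sets \<mu> = sets borel \<and>
     (\<forall>K. compact K \<longrightarrow> emeasure \<mu> K < \<infinity>) \<and>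
     (\<forall>U. open U \<longrightarrow> emeasure \<mu> U = (SUP K \<in> {K. compact K \<and> K \<subseteq> U}. emeasure \<mu> K)) \<and>
     (\<forall>B \<in> sets borel. emeasure \<mu> B = (INF U \<in> {U. open U \<and> B \<subseteq> U}. emeasure \<mu> U))"

definition measure_support :: "'a::topological_space measure \<Rightarrow> 'a set" where
  "measure_support \<mu> = {x. \<forall>U. open U \<and> x \<in> U \<longrightarrow> emeasure \<mu> U > 0}"

definition radon_measures_on :: "'a::topological_space set \<Rightarrow> 'a measure set" where
  "radon_measures_on A =
     {\<mu>. radon_measure \<mu> \<and> emeasure \<mu> (space \<mu>) \<noteq> 0 \<and>
         compact (measure_support \<mu>) \<and> measure_support \<mu> \<subseteq> A}"

definition fourier_transform :: "'a::euclidean_space measure \<Rightarrow> 'a \<Rightarrow> complex" where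
  "fourier_transform \<mu> \<xi> =
     (\<integral>x. exp (- 2 * complex_of_real pi * \<i> * complex_of_real (\<xi> \<bullet> x)) \<partial>\<mu>)"

definition sobolev_dim_measure :: "'a::euclidean_space measure \<Rightarrow> ereal" where
  "sobolev_dim_measure \<mu> =
     Sup {ereal s | s :: real.
       (\<integral>\<^sup>+x. ennreal ((cmod (fourier_transform \<mu> x))\<^sup>2 * (1 + norm x) powr (s - real DIM('a)))
          \<partial>lborel) < \<infinity>}"

definition sobolev_dim :: "'a::euclidean_space set \<Rightarrow> ereal" where
  "sobolev_dim A =
     Sup {sobolev_dim_measure \<mu> | \<mu>. \<mu> \<in> radon_measures_on A \<and> prob_space \<mu>}"

definition similar_copies_union :: "('a::real_vector \<times> real) set \<Rightarrow> 'a set \<Rightarrow> 'a set" where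
  "similar_copies_union \<Gamma> E = {r *\<^sub>R x + z | x z r. x \<in> E \<and> (z, r) \<in> \<Gamma>}"

end

theory Submission
  imports Defs
begin

text \<open>
  Let \<open>\<mu>\<close> and \<open>\<nu>\<close> be Frostman measures on \<open>E\<close> and \<open>\<Gamma>\<close> with exponents \<open>s\<close> and \<open>t\<close>, and let \<open>\<kappa>\<close> be the
  image of \<open>\<nu> \<times> \<mu>\<close> under \<open>((z, r), x) \<mapsto> r x + z\<close>, so that the Fourier transform of \<open>\<kappa>\<close> at \<open>\<xi>\<close> is the
  integral of \<open>e(\<xi> \<cdot> z) e(r \<xi> \<cdot> x)\<close>. At frequencies \<open>\<bar>\<xi>\<bar> \<sim> R\<close> the variable \<open>r\<close> may be averaged over
  intervals of length \<open>\<sim> 1 / R\<close>: this changes \<open>e(r \<xi> \<cdot> x)\<close> only by a factor depending on \<open>\<xi> \<cdot> x\<close> and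
  bounded away from \<open>0\<close>, which is absorbed into \<open>\<mu>\<close>. By the Cauchy--Schwarz inequality in \<open>r\<close> the square
  of the transform is then at most a product of two integrals over \<open>r\<close>. The first one is
  \<open>\<lesssim> R powr (d - 1 - s)\<close> for every \<open>\<xi>\<close>, because \<open>\<mu>\<close> gives mass \<open>\<lesssim> R powr (d - 1 - s)\<close> to
  slabs of width \<open>1 / R\<close>; the integral of the second one over \<open>\<bar>\<xi>\<bar> \<le> R\<close> is \<open>\<lesssim> R powr (d + 1 - t)\<close>,
  by an almost orthogonality argument with a Gaussian weight and the Frostman condition on \<open>\<nu>\<close>.
  Hence the \<open>L\<^sup>2\<close> mass of the transform on \<open>\<bar>\<xi>\<bar> \<sim> R\<close> is \<open>\<lesssim> R powr (2 d - s - t)\<close>,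
  and \<open>\<kappa>\<close> has Sobolev dimension at least \<open>s + t - d\<close>. The other two claims follow since finite Sobolev
  energy of order \<open>\<sigma> \<le> d\<close> gives \<open>(\<kappa> \<times> \<kappa>) {(x, y). \<bar>x - y\<bar> \<le> r} \<lesssim> r powr \<sigma>\<close>.

  As \<open>E\<close> and \<open>\<Gamma>\<close> are only Borel, Frostman's lemma requires a capacitability argument; the mass
  distribution is built on the dyadic tree from a decreasing sequence of sets of large net content
  whose closures meet inside the given set.
\<close>

subsection \<open>Suslin sets\<close>

text \<open>Averaging in \<open>r\<close> decouples the two measures: under one integral over
  \<open>r\<close> the transform becomes a product of a factor from \<open>\<nu>\<close> and a
  factor from \<open>\<mu>\<close>. Each then pays its exponent at scale 1 / R. A slab of width 1 /
  R needs about R^(d-1) balls of radius 1 / R, each of \<open>\<mu>\<close>-mass at most about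
  R^(-s). Two points of \<Gamma> that interact have centres and ratios within about 1 / R of each
  other, so they share a ball of the (d+1)-dimensional space, of \<open>\<nu>\<close>-mass at most
  about R^(-t); this is where the metric on pairs enters. The first bound holds at each single
  frequency, so only the second has to be averaged over frequencies. Gaussian weights serve because
  their transforms are positive Gaussians: a quadratic form in a Fourier transform is bounded by
  inserting absolute values, with no cancellation to track. The dyadic pieces sum for every \<sigma>
  < s + t - d, and one measure serves all these \<sigma>. It is carried by a compact subset of the
  union of copies, from which admissibility, positive volume and dimension are all read off.\<close>

definition suslin :: "'a::topological_space set \<Rightarrow> bool" where
  "suslin A \<longleftrightarrow> (\<exists>C :: ('a \<times> (nat \<Rightarrow> nat)) set. closed C \<and> A = fst ` C)"

lemma suslin_closed: "closed A \<Longrightarrow> suslin A"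
  unfolding suslin_def by (intro exI[of _ "A \<times> UNIV"]) (auto simp: closed_Times)

text \<open>The witness sequences of the separate sets are merged into one: entry 0 records which
  set is meant, and the shifted tail is a witness for that set. The result stays closed because
  \<open>nat\<close> is discrete, so fixing entry 0 is an open condition.\<close>

lemma suslin_UN:
  fixes A :: "nat \<Rightarrow> 'a::topological_space set"
  assumes "\<And>n. suslin (A n)"
  shows "suslin (\<Union>n. A n)"
proof -
  obtain C :: "nat \<Rightarrow> ('a \<times> (nat \<Rightarrow> nat)) set"
    where C: "\<And>n. closed (C n)" "\<And>n. A n = fst ` C n"
    using assms unfolding suslin_def by metis
  define g :: "'a \<times> (nat \<Rightarrow> nat) \<Rightarrow> 'a \<times> (nat \<Rightarrow> nat)"
    where "g = (\<lambda>p. (fst p, \<lambda>k. snd p (Suc k)))"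
  define D where "D = {p. p \<in> g -` C (snd p 0)}"
  have cg: "continuous_on UNIV g"
    unfolding g_def
    by (intro continuous_intros continuous_on_coordinatewise_then_product
        continuous_on_compose2[OF continuous_on_product_coordinates continuous_on_snd[OF continuous_on_id]]) auto
  have c0: "continuous_on UNIV (\<lambda>p :: 'a \<times> (nat \<Rightarrow> nat). snd p 0)"
    by (intro continuous_on_compose2[OF continuous_on_product_coordinates continuous_on_snd[OF continuous_on_id]]) auto
  have eq: "- D = (\<Union>n. ((\<lambda>p. snd p 0) -` {n}) \<inter> g -` (- C n))"
    unfolding D_def by auto
  have o0: "open {n}" for n :: nat by (rule discrete_topology_class.open_discrete)
  have "open (- D)"
    unfolding eq
    using C(1) by (intro open_UN ballI open_Int open_vimage[OF _ c0] open_vimage[OF _ cg] open_Compl o0)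
  then have "closed D" by (simp add: closed_def)
  moreover have "(\<Union>n. A n) = fst ` D"
  proof safe
    fix x n assume "x \<in> A n"
    then obtain s where "(x, s) \<in> C n" by (auto simp: C)
    then have "(x, case_nat n s) \<in> D" by (auto simp: D_def g_def)
    then show "x \<in> fst ` D" by force
  next
    fix x s assume "(x, s) \<in> D"
    then have "x \<in> A (s 0)" unfolding D_def g_def C by force
    then show "fst (x, s) \<in> (\<Union>n. A n)" by auto
  qed
  ultimately show ?thesis unfolding suslin_def by blast
qed

text \<open>A point of the intersection needs witnesses for all the sets at once;
  \<open>prod_encode\<close> stores them as the rows of a single sequence.\<close>

lemma suslin_INT:
  fixes A :: "nat \<Rightarrow> 'a::topological_space set"
  assumes "\<And>n. suslin (A n)"
  shows "suslin (\<Inter>n. A n)"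
proof -
  obtain C :: "nat \<Rightarrow> ('a \<times> (nat \<Rightarrow> nat)) set"
    where C: "\<And>n. closed (C n)" "\<And>n. A n = fst ` C n"
    using assms unfolding suslin_def by metis
  define g :: "nat \<Rightarrow> 'a \<times> (nat \<Rightarrow> nat) \<Rightarrow> 'a \<times> (nat \<Rightarrow> nat)"
    where "g = (\<lambda>n p. (fst p, \<lambda>k. snd p (prod_encode (n, k))))"
  define D where "D = (\<Inter>n. g n -` C n)"
  have cg: "continuous_on UNIV (g n)" for n
    unfolding g_def
    by (intro continuous_intros continuous_on_coordinatewise_then_product
        continuous_on_compose2[OF continuous_on_product_coordinates continuous_on_snd[OF continuous_on_id]]) auto
  have "closed D"
    unfolding D_def by (intro closed_INT ballI closed_vimage C cg)
  moreover have "(\<Inter>n. A n) = fst ` D"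
  proof safe
    fix x assume "x \<in> (\<Inter>n. A n)"
    then have "\<forall>n. \<exists>s. (x, s) \<in> C n" by (force simp: C)
    then obtain s where s: "\<And>n. (x, s n) \<in> C n" by metis
    have "(x, \<lambda>j. s (fst (prod_decode j)) (snd (prod_decode j))) \<in> D"
      using s by (auto simp: D_def g_def)
    then show "x \<in> fst ` D" by force
  next
    fix x s n assume "(x, s) \<in> D"
    then show "fst (x, s) \<in> A n" unfolding D_def g_def C by force
  qed
  ultimately show ?thesis unfolding suslin_def by blast
qed

lemma suslin_open:
  fixes A :: "'a::euclidean_space set"
  assumes "open A"
  shows "suslin A"
proof -
  obtain D where D: "D \<subseteq> Pow A" "countable D" "\<And>X. X \<in> D \<Longrightarrow> \<exists>a b. X = cbox a b" "\<Union>D = A"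
    using open_countable_Union_open_cbox[OF assms] by metis
  show ?thesis
  proof (cases "D = {}")
    case True
    then show ?thesis using D suslin_closed[of "{}"] by auto
  next
    case False
    have "suslin (from_nat_into D n)" for n
      using D(3)[OF from_nat_into[OF False]] suslin_closed closed_cbox by metis
    then have "suslin (\<Union>n. from_nat_into D n)" by (rule suslin_UN)
    then show ?thesis using D False range_from_nat_into by metis
  qed
qed

text \<open>Suslin sets are not closed under complements in general, so the induction over the
  sigma-algebra carries each set together with its complement.\<close>

lemma suslin_borel:
  fixes A :: "'a::euclidean_space set"
  assumes "A \<in> sets borel"
  shows "suslin A"
proof -
  have "A \<in> sigma_sets UNIV {S. open S}"
    using assms by (simp add: borel_def)
  then have "suslin A \<and> suslin (- A)"
  proof induction
    case (Basic a)
    then show ?case by (auto intro: suslin_open suslin_closed)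
  next
    case Empty
    then show ?case by (auto intro: suslin_closed)
  next
    case (Compl a)
    then show ?case by (simp add: Compl_eq_Diff_UNIV[symmetric])
  next
    case (Union a)
    then show ?case using suslin_UN[of a] suslin_INT[of "\<lambda>n. - a n"] by (simp add: Compl_UN)
  qed
  then show ?thesis ..
qed

text \<open>Tychonoff for finite factors. This compactness is what makes bounded witness sequences
  converge along a subsequence in the selection below.\<close>

lemma compact_bounded_sequences: "compact {\<sigma> :: nat \<Rightarrow> nat. \<forall>i. \<sigma> i \<le> m i}"
proof -
  have "{\<sigma> :: nat \<Rightarrow> nat. \<forall>i. \<sigma> i \<le> m i} = PiE UNIV (\<lambda>i. {..m i})" by auto
  moreover have "compactin (product_topology (\<lambda>i. euclidean) UNIV) (PiE UNIV (\<lambda>i. {..m i}))"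
    by (simp add: compactin_PiE finite_imp_compact)
  ultimately show ?thesis
    by (simp add: euclidean_product_topology[symmetric] flip: compactin_euclidean_iff)
qed

text \<open>
  This replaces Choquet's capacitability theorem: no outer regularity of \<open>cap\<close> is needed,
  since only the sets \<open>S k\<close>, not the compact set \<open>\<Inter>k. closure (S k)\<close>, are measured by \<open>cap\<close>.
\<close>

lemma suslin_capacity_selection:
  fixes cap :: "'a::metric_space set \<Rightarrow> 'b::complete_linorder"
  assumes "suslin A"
    and cont: "\<And>B :: nat \<Rightarrow> 'a set. incseq B \<Longrightarrow> (\<Union>n. B n) \<subseteq> A \<Longrightarrow> cap (\<Union>n. B n) = (SUP n. cap (B n))"
    and c: "c < cap A"
  obtains S where "decseq S" "\<And>k. S k \<subseteq> A" "\<And>k. c < cap (S k)" "(\<Inter>k. closure (S k)) \<subseteq> A"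
proof -
  obtain C :: "('a \<times> (nat \<Rightarrow> nat)) set" where C: "closed C" "A = fst ` C"
    using assms(1) unfolding suslin_def by blast
  \<comment> \<open>Only the first \<open>k\<close> witness entries are bounded. Releasing the bound
    on the next entry exhausts \<open>T k n\<close> by an increasing union, so continuity from below
    yields a finite bound at which \<open>cap\<close> still exceeds \<open>c\<close>.\<close>
  define T where "T = (\<lambda>k n. {x. \<exists>s. (x, s) \<in> C \<and> (\<forall>i<k. s i \<le> n i)})"
  have T_sub: "T k n \<subseteq> A" for k n unfolding T_def C by force
  have T0: "T 0 n = A" for n unfolding T_def C by force
  have T_cong: "T k n = T k n'" if "\<And>i. i < k \<Longrightarrow> n i = n' i" for k n n'
    unfolding T_def using that by auto
  have step: "\<exists>j. c < cap (T (Suc k) (n(k := j)))" if "c < cap (T k n)" for k n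
  proof -
    have inc: "incseq (\<lambda>j. T (Suc k) (n(k := j)))"
      unfolding incseq_def T_def by (fastforce simp: less_Suc_eq)
    have U: "(\<Union>j. T (Suc k) (n(k := j))) = T k n"
    proof safe
      fix x j assume "x \<in> T (Suc k) (n(k := j))"
      then show "x \<in> T k n" unfolding T_def by (simp add: less_Suc_eq) metis
    next
      fix x assume "x \<in> T k n"
      then obtain s where "(x, s) \<in> C" "\<forall>i<k. s i \<le> n i" unfolding T_def by auto
      then have "x \<in> T (Suc k) (n(k := s k))" unfolding T_def by (auto simp: less_Suc_eq)
      then show "x \<in> (\<Union>j. T (Suc k) (n(k := j)))" by blast
    qed
    have "c < (SUP j. cap (T (Suc k) (n(k := j))))"
      using cont[OF inc] that T_sub[of k n] unfolding U by simp
    then show ?thesis by (auto simp: less_SUP_iff)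
  qed
  define J where "J = (\<lambda>k n. SOME j. c < cap (T (Suc k) (n(k := j))))"
  \<comment> \<open>The bounds are chosen one entry at a time, and stage \<open>k\<close> alters
    only entry \<open>k\<close>; hence the stages stabilise entrywise to the single sequence
    \<open>n\<close> below.\<close>
  define N where "N = rec_nat (\<lambda>_. 0) (\<lambda>k n. n(k := J k n))"
  have N: "c < cap (T k (N k))" for k
  proof (induction k)
    case 0
    then show ?case using c by (simp add: T0)
  next
    case (Suc k)
    then have "c < cap (T (Suc k) ((N k)(k := J k (N k))))"
      unfolding J_def by (rule someI_ex[OF step])
    then show ?case by (simp add: N_def fun_upd_def)
  qed
  define n where "n = (\<lambda>k. N (Suc k) k)"
  have Nn: "i < k \<Longrightarrow> N k i = n i" for i k
  proof (induction k)
    case (Suc k)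
    then show ?case by (cases "i = k") (auto simp: n_def N_def)
  qed simp
  define S where "S = (\<lambda>k. T k n)"
  have "S k = T k (N k)" for k unfolding S_def using Nn by (intro T_cong) auto
  then have capS: "c < cap (S k)" for k using N by simp
  have decS: "decseq S" unfolding S_def T_def decseq_def by fastforce
  have "(\<Inter>k. closure (S k)) \<subseteq> A"
  proof
    fix x assume x: "x \<in> (\<Inter>k. closure (S k))"
    have "\<exists>y\<in>S k. dist y x < 1 / real (Suc k)" for k
    proof -
      have "x \<in> closure (S k)" using x by blast
      moreover have "0 < 1 / real (Suc k)" by simp
      ultimately show ?thesis unfolding closure_approachable by blast
    qed
    then obtain y where y: "\<And>k. y k \<in> S k" "\<And>k. dist (y k) x < 1 / real (Suc k)" by metis
    from y(1) obtain s where s: "\<And>k. (y k, s k) \<in> C" "\<And>k i. i < k \<Longrightarrow> s k i \<le> n i"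
      unfolding S_def T_def by simp metis
    \<comment> \<open>For \<open>i < k\<close> the entry \<open>s k i\<close> is at most
      \<open>n i\<close>; the finitely many remaining \<open>k \<le> i\<close> are covered by the
      maximum. So one compact set contains all witnesses \<open>s k\<close>.\<close>
    define m where "m = (\<lambda>i. max (n i) (Max ((\<lambda>k. s k i) ` {..i})))"
    have "s k i \<le> m i" for k i
    proof (cases "i < k")
      case True
      then show ?thesis using s(2)[OF True] by (simp add: m_def)
    next
      case False
      then have "s k i \<le> Max ((\<lambda>k. s k i) ` {..i})" by (intro Max_ge) auto
      then show ?thesis by (simp add: m_def)
    qed
    then have "\<forall>k. s k \<in> {\<sigma>. \<forall>i. \<sigma> i \<le> m i}" by auto
    moreover have "seq_compact {\<sigma>. \<forall>i. \<sigma> i \<le> m i}"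
      by (intro compact_imp_seq_compact compact_bounded_sequences)
    ultimately obtain l r where r: "strict_mono r" "(s \<circ> r) \<longlonglongrightarrow> l"
      using seq_compactE by blast
    have "y \<longlonglongrightarrow> x"
    proof (rule metric_LIMSEQ_I)
      fix e :: real assume "e > 0"
      then obtain k0 where "1 / real (Suc k0) < e" using nat_approx_posE by blast
      then have "dist (y k) x < e" if "k \<ge> k0" for k
        using y(2)[of k] that by (smt (verit) frac_le of_nat_0_less_iff of_nat_le_iff Suc_le_mono zero_less_Suc)
      then show "\<exists>k0. \<forall>k\<ge>k0. dist (y k) x < e" by blast
    qed
    then have "(y \<circ> r) \<longlonglongrightarrow> x" using r(1) by (rule LIMSEQ_subseq_LIMSEQ)
    then have "(\<lambda>k. ((y \<circ> r) k, (s \<circ> r) k)) \<longlonglongrightarrow> (x, l)" using r(2) by (rule tendsto_Pair)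
    then have "(x, l) \<in> C"
      by (intro closed_sequentially[OF C(1) _ \<open>_ \<longlonglongrightarrow> (x, l)\<close>]) (simp add: s)
    then show "x \<in> A" unfolding C by force
  qed
  with that decS capS T_sub show thesis unfolding S_def by blast
qed

subsection \<open>Dyadic net content\<close>

text \<open>The lower corner of the half-open dyadic cube of side 2^(-k) around \<open>x\<close>. It
  serves as the name of that cube: the cubes of level \<open>k\<close> are the fibres of
  \<open>corner k\<close>, and a cube is handled as a pair of level and corner.\<close>

definition corner :: "nat \<Rightarrow> 'a::euclidean_space \<Rightarrow> 'a" where
  "corner k x = (\<Sum>b\<in>Basis. (of_int \<lfloor>2 ^ k * (x \<bullet> b)\<rfloor> / 2 ^ k) *\<^sub>R b)"

lemma corner_inner: "b \<in> Basis \<Longrightarrow> corner k x \<bullet> b = of_int \<lfloor>2 ^ k * (x \<bullet> b)\<rfloor> / 2 ^ k"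
  unfolding corner_def by simp

text \<open>Dyadic cubes are nested: dividing by a power of 2 and rounding down gives the same
  integer whether or not the number was rounded down before.\<close>

lemma corner_corner:
  assumes "j \<le> k"
  shows "corner j (corner k x) = corner j x"
proof (rule euclidean_eqI)
  fix b :: 'a assume b: "b \<in> Basis"
  define y where "y = 2 ^ k * (x \<bullet> b)"
  have pw: "real_of_int (2 ^ (k - j)) = 2 ^ k / 2 ^ j"
    by (metis assms of_int_numeral of_int_power power_diff zero_neq_numeral)
  have "\<lfloor>(2::real) ^ j * (corner k x \<bullet> b)\<rfloor> = \<lfloor>real_of_int \<lfloor>y\<rfloor> / real_of_int (2 ^ (k - j))\<rfloor>"
    unfolding pw by (simp add: corner_inner[OF b] y_def mult.commute)
  also have "\<dots> = \<lfloor>y\<rfloor> div 2 ^ (k - j)"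
    by (rule floor_divide_of_int_eq)
  also have "\<dots> = \<lfloor>y / real_of_int (2 ^ (k - j))\<rfloor>"
    by (rule floor_divide_real_eq_div[symmetric]) simp
  also have "y / real_of_int (2 ^ (k - j)) = 2 ^ j * (x \<bullet> b)"
    unfolding pw by (simp add: y_def)
  finally show "corner j (corner k x) \<bullet> b = corner j x \<bullet> b"
    by (simp add: corner_inner[OF b])
qed

lemma dist_corner_le: "dist x (corner k x) \<le> real DIM('a) / 2 ^ k"
  for x :: "'a::euclidean_space"
proof -
  have "\<bar>(x - corner k x) \<bullet> b\<bar> \<le> 1 / 2 ^ k" if b: "b \<in> Basis" for b
  proof -
    define y where "y = 2 ^ k * (x \<bullet> b)"
    have "(x - corner k x) \<bullet> b = (y - of_int \<lfloor>y\<rfloor>) / 2 ^ k"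
      by (simp add: inner_diff_left corner_inner[OF b] y_def diff_divide_distrib)
    moreover have "0 \<le> y - of_int \<lfloor>y\<rfloor>" "y - of_int \<lfloor>y\<rfloor> \<le> 1" by linarith+
    ultimately show ?thesis by (simp add: abs_of_nonneg divide_right_mono)
  qed
  then have "(\<Sum>b\<in>Basis. \<bar>(x - corner k x) \<bullet> b\<bar>) \<le> (\<Sum>b\<in>(Basis::'a set). 1 / 2 ^ k)"
    by (rule sum_mono)
  then show ?thesis
    unfolding dist_norm using norm_le_l1[of "x - corner k x"] by simp
qed

lemma floor_diff_mem:
  fixes u v :: real
  assumes "\<bar>u - v\<bar> \<le> real N"
  shows "\<lfloor>u\<rfloor> - \<lfloor>v\<rfloor> \<in> {- int N..int N}"
proof -
  have "\<lfloor>u\<rfloor> \<le> \<lfloor>v\<rfloor> + int N"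
    using assms real_of_int_floor_add_one_gt[of v]
    by (simp only: floor_le_iff of_int_add of_int_of_nat_eq)
  moreover have "\<lfloor>v\<rfloor> \<le> \<lfloor>u\<rfloor> + int N"
    using assms real_of_int_floor_add_one_gt[of u]
    by (simp only: floor_le_iff of_int_add of_int_of_nat_eq)
  ultimately show ?thesis by simp
qed

lemma corner_image_cball:
  fixes x :: "'a::euclidean_space"
  shows "finite (corner k ` cball x (real N / 2 ^ k))"
    and "card (corner k ` cball x (real N / 2 ^ k)) \<le> (2 * N + 1) ^ DIM('a)"
proof -
  define P where "P = PiE (Basis::'a set) (\<lambda>_. {- int N..int N})"
  define g :: "('a \<Rightarrow> int) \<Rightarrow> 'a" where
    "g = (\<lambda>j. \<Sum>b\<in>Basis. (of_int (\<lfloor>2 ^ k * (x \<bullet> b)\<rfloor> + j b) / 2 ^ k) *\<^sub>R b)"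
  have P: "finite P" "card P = (2 * N + 1) ^ DIM('a)"
    by (auto simp: P_def card_PiE nat_add_distrib nat_mult_distrib intro!: finite_PiE)
  have "corner k ` cball x (real N / 2 ^ k) \<subseteq> g ` P"
  proof
    fix q assume "q \<in> corner k ` cball x (real N / 2 ^ k)"
    then obtain y where y: "dist x y \<le> real N / 2 ^ k" "q = corner k y" by auto
    define v where "v = (\<lambda>b. \<lfloor>2 ^ k * (y \<bullet> b)\<rfloor> - \<lfloor>2 ^ k * (x \<bullet> b)\<rfloor>)"
    define j where "j = restrict v (Basis::'a set)"
    have jv: "j b = v b" if "b \<in> Basis" for b using that by (simp add: j_def)
    have "j b \<in> {- int N..int N}" if b: "b \<in> Basis" for b
    proof -
      have "\<bar>y \<bullet> b - x \<bullet> b\<bar> \<le> real N / 2 ^ k"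
        using Basis_le_norm[OF b, of "y - x"] y(1) by (simp add: inner_diff_left dist_norm norm_minus_commute)
      then have "2 ^ k * \<bar>y \<bullet> b - x \<bullet> b\<bar> \<le> real N"
        by (simp add: pos_le_divide_eq mult.commute)
      moreover have "2 ^ k * \<bar>y \<bullet> b - x \<bullet> b\<bar> = \<bar>2 ^ k * (y \<bullet> b) - 2 ^ k * (x \<bullet> b)\<bar>"
        by (simp add: abs_mult flip: right_diff_distrib)
      ultimately have "\<bar>2 ^ k * (y \<bullet> b) - 2 ^ k * (x \<bullet> b)\<bar> \<le> real N" by simp
      from floor_diff_mem[OF this] show ?thesis unfolding jv[OF b] v_def .
    qed
    moreover have "j \<in> extensional Basis" by (simp add: j_def)
    ultimately have "j \<in> P" unfolding P_def PiE_iff by blast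
    moreover have "q = g j" 
      unfolding y(2) corner_def g_def by (intro sum.cong) (simp_all add: jv v_def)
    ultimately show "q \<in> g ` P" by blast
  qed
  note sub = this
  show "finite (corner k ` cball x (real N / 2 ^ k))"
    using finite_subset[OF sub] P(1) by simp
  have "card (corner k ` cball x (real N / 2 ^ k)) \<le> card (g ` P)"
    using sub P(1) by (intro card_mono) auto
  also have "\<dots> \<le> card P" by (rule card_image_le[OF P(1)])
  finally show "card (corner k ` cball x (real N / 2 ^ k)) \<le> (2 * N + 1) ^ DIM('a)"
    using P(2) by simp
qed

lemma finite_corner_image:
  fixes S :: "'a::euclidean_space set"
  assumes "bounded S"
  shows "finite (corner k ` S)"
proof -
  obtain M where M: "S \<subseteq> ball 0 M" using bounded_subset_ballD[OF assms] by blast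
  obtain N where N: "2 ^ k * M \<le> real N" using real_arch_simple by blast
  have "M \<le> real N / 2 ^ k" using N by (simp add: pos_le_divide_eq mult.commute)
  then have "S \<subseteq> cball 0 (real N / 2 ^ k)" using M by auto
  then show ?thesis using corner_image_cball(1) finite_subset image_mono by metis
qed

lemma countable_range_corner: "countable (range (corner k :: 'a::euclidean_space \<Rightarrow> 'a))"
proof -
  have "range (corner k :: 'a \<Rightarrow> 'a) = (\<Union>N. corner k ` cball 0 (real N))"
  proof -
    have "\<exists>N. x \<in> cball 0 (real N)" for x :: 'a using real_arch_simple[of "norm x"] by auto
    then show ?thesis by blast
  qed
  then show ?thesis
    by (simp add: countable_finite finite_corner_image)
qed

text \<open>The sum of the s-th powers of the side lengths, written as an integral against counting
  measure, so that modularity and continuity along increasing families are inherited from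
  integration. No countability of \<open>W\<close> is imposed; pairs that name no cube are counted
  but cover nothing.\<close>

definition weight :: "real \<Rightarrow> (nat \<times> 'a) set \<Rightarrow> ennreal" where
  "weight s W = (\<integral>\<^sup>+w. ennreal (2 powr (- (s * real (fst w)))) * indicator W w \<partial>count_space UNIV)"

definition covers :: "(nat \<times> 'a::euclidean_space) set \<Rightarrow> 'a set \<Rightarrow> bool" where
  "covers W A \<longleftrightarrow> (\<forall>x\<in>A. \<exists>k. (k, corner k x) \<in> W)"

text \<open>A content, with covering cubes of any side up to 1 and no limit of small scales. Hence
  it is finite on each cube, and it is continuous along arbitrary increasing sequences, which is
  what the selection lemma asks for.\<close>

definition net_content :: "real \<Rightarrow> 'a::euclidean_space set \<Rightarrow> ennreal" where
  "net_content s A = (INF W\<in>{W. covers W A}. weight s W)"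

definition maximal_cubes :: "(nat \<times> 'a::euclidean_space) set \<Rightarrow> (nat \<times> 'a) set" where
  "maximal_cubes W = {w \<in> W. \<forall>j<fst w. (j, corner j (snd w)) \<notin> W}"

lemma weight_mono: "W \<subseteq> W' \<Longrightarrow> weight s W \<le> weight s W'"
  unfolding weight_def by (intro nn_integral_mono mult_left_mono) (auto simp: indicator_def)

lemma weight_Un_Int: "weight s V + weight s W = weight s (V \<union> W) + weight s (V \<inter> W)"
  unfolding weight_def
  by (subst (1 2) nn_integral_add[symmetric])
    (auto intro!: nn_integral_cong simp: indicator_def)

lemma weight_Un_le: "weight s (V \<union> W) \<le> weight s V + weight s W"
  using weight_Un_Int[of s V W] by simp

lemma weight_empty: "weight s {} = 0"
  by (simp add: weight_def)

lemma weight_singleton: "weight s {w} = ennreal (2 powr (- (s * real (fst w))))"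
  unfolding weight_def
  by (subst nn_integral_count_space_indicator[symmetric])
    (auto simp: nn_integral_count_space_finite)

lemma weight_UN_incseq:
  fixes W :: "nat \<Rightarrow> (nat \<times> 'a) set"
  assumes "incseq W"
  shows "weight s (\<Union>n. W n) = (SUP n. weight s (W n))"
proof -
  define D where "D = density (count_space UNIV) (\<lambda>w :: nat \<times> 'a. ennreal (2 powr (- (s * real (fst w)))))"
  have "weight s X = emeasure D X" for X
    unfolding weight_def D_def by (simp add: emeasure_density)
  then show ?thesis
    using SUP_emeasure_incseq[of W D] assms by (simp add: D_def)
qed

text \<open>Levels are natural numbers, so among the cubes of \<open>W\<close> around a point there
  is a coarsest one, and by nesting it is maximal.\<close>

lemma covers_maximal_cubes:
  assumes "covers W A"
  shows "covers (maximal_cubes W) A"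
  unfolding covers_def
proof
  fix x assume "x \<in> A"
  then have ex: "\<exists>k. (k, corner k x) \<in> W" using assms by (auto simp: covers_def)
  define k where "k = (LEAST k. (k, corner k x) \<in> W)"
  have "(k, corner k x) \<in> W" unfolding k_def by (rule LeastI_ex[OF ex])
  moreover have "(j, corner j (corner k x)) \<notin> W" if "j < k" for j
    using not_less_Least[OF that[unfolded k_def]] corner_corner[of j k x] that by simp
  ultimately show "\<exists>k. (k, corner k x) \<in> maximal_cubes W"
    unfolding maximal_cubes_def by auto
qed

lemma net_content_le: "covers W A \<Longrightarrow> net_content s A \<le> weight s W"
  unfolding net_content_def by (rule INF_lower) simp

lemma net_content_mono: "A \<subseteq> B \<Longrightarrow> net_content s A \<le> net_content s B"
  unfolding net_content_def by (rule INF_superset_mono) (auto simp: covers_def)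

lemma net_content_cover_approx:
  assumes "net_content s A < \<infinity>" "0 < e"
  obtains W where "covers W A" "weight s W \<le> net_content s A + ennreal e"
proof -
  have "net_content s A < net_content s A + ennreal e"
    using assms by (cases "net_content s A") (auto simp: ennreal_less_iff simp flip: ennreal_plus)
  then show thesis using that unfolding net_content_def INF_less_iff by (auto intro: less_imp_le)
qed

lemma net_content_empty: "net_content s {} = 0"
  using net_content_le[of "{}" "{}" s] by (simp add: covers_def weight_empty)

lemma net_content_cell_le: "net_content s {x \<in> A. corner k x = q} \<le> ennreal (2 powr (- (s * real k)))"
  using net_content_le[of "{(k, q)}" "{x \<in> A. corner k x = q}" s] weight_singleton[of s "(k, q)"]
  by (auto simp: covers_def)

lemma net_content_Un: "net_content s (A \<union> B) \<le> net_content s A + net_content s B"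
proof (cases "net_content s A < \<infinity> \<and> net_content s B < \<infinity>")
  case True
  show ?thesis
  proof (rule ennreal_le_epsilon)
    fix e :: real assume e: "0 < e"
    obtain V W where V: "covers V A" "weight s V \<le> net_content s A + ennreal (e / 2)"
      and W: "covers W B" "weight s W \<le> net_content s B + ennreal (e / 2)"
      using net_content_cover_approx[of s A "e / 2"] net_content_cover_approx[of s B "e / 2"] True e by (metis half_gt_zero)
    have "covers (V \<union> W) (A \<union> B)" using V W unfolding covers_def by blast
    then have "net_content s (A \<union> B) \<le> weight s V + weight s W"
      using net_content_le weight_Un_le order_trans by metis
    also have "\<dots> \<le> (net_content s A + ennreal (e / 2)) + (net_content s B + ennreal (e / 2))"
      by (intro add_mono V W)
    also have "\<dots> = net_content s A + net_content s B + ennreal e"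
      using e by (simp add: ac_simps flip: ennreal_plus)
    finally show "net_content s (A \<union> B) \<le> net_content s A + net_content s B + ennreal e" .
  qed
next
  case False
  then show ?thesis by (auto simp: not_less top_unique)
qed

lemma net_content_UN:
  assumes "finite I"
  shows "net_content s (\<Union>i\<in>I. A i) \<le> (\<Sum>i\<in>I. net_content s (A i))"
  using assms
proof induction
  case (insert i I)
  have "net_content s (\<Union>i\<in>insert i I. A i) \<le> net_content s (A i) + net_content s (\<Union>i\<in>I. A i)"
    using net_content_Un[of s "A i" "\<Union>i\<in>I. A i"] by simp
  also have "\<dots> \<le> net_content s (A i) + (\<Sum>i\<in>I. net_content s (A i))"
    by (intro add_left_mono insert.IH)
  finally show ?case using insert by simp
qed (simp add: net_content_empty)

text \<open>
  Replacing two families of cubes by the maximal cubes of their union leaves over enough cubes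
  to cover every set covered by both: the net content is strongly subadditive.
\<close>

lemma weight_maximal_cubes_Un:
  assumes "covers V A" "covers W A"
  shows "weight s (maximal_cubes (V \<union> W)) + net_content s A \<le> weight s V + weight s W"
proof -
  define U where "U = V \<union> W"
  \<comment> \<open>These are the cubes paid for in \<open>weight s V + weight s W\<close> but
    absent from the maximal family: the non-maximal ones and the second copies of the common ones. A
    point of \<open>A\<close> lies in a cube of \<open>V\<close> and in one of \<open>W\<close>; if
    they differ, the finer is non-maximal, and if they agree, the cube is common.\<close>
  define R where "R = (U - maximal_cubes U) \<union> (V \<inter> W)"
  have "covers R A"
    unfolding covers_def
  proof
    fix x assume "x \<in> A"
    then obtain j k where jk: "(j, corner j x) \<in> V" "(k, corner k x) \<in> W"
      using assms unfolding covers_def by blast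
    have *: "(m, corner m x) \<in> R" if "l < m" "(l, corner l x) \<in> U" "(m, corner m x) \<in> U" for l m
      using that corner_corner[of l m x] unfolding R_def maximal_cubes_def by auto
    consider "j < k" | "k < j" | "j = k" by linarith
    then show "\<exists>k. (k, corner k x) \<in> R"
    proof cases
      case 1
      then show ?thesis using *[of j k] jk by (auto simp: U_def)
    next
      case 2
      then show ?thesis using *[of k j] jk by (auto simp: U_def)
    next
      case 3
      then show ?thesis using jk by (auto simp: R_def)
    qed
  qed
  then have "weight s (maximal_cubes U) + net_content s A
      \<le> weight s (maximal_cubes U) + (weight s (U - maximal_cubes U) + weight s (V \<inter> W))"
    unfolding R_def by (intro add_left_mono order_trans[OF net_content_le weight_Un_le])
  also have "\<dots> = (weight s (maximal_cubes U) + weight s (U - maximal_cubes U)) + weight s (V \<inter> W)"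
    by (simp add: ac_simps)
  also have "weight s (maximal_cubes U) + weight s (U - maximal_cubes U) = weight s U"
  proof -
    have "maximal_cubes U \<union> (U - maximal_cubes U) = U" "maximal_cubes U \<inter> (U - maximal_cubes U) = {}"
      by (auto simp: maximal_cubes_def)
    then show ?thesis
      using weight_Un_Int[of s "maximal_cubes U" "U - maximal_cubes U"] by (simp add: weight_empty)
  qed
  also have "weight s U + weight s (V \<inter> W) = weight s V + weight s W"
    unfolding U_def weight_Un_Int[of s V W] ..
  finally show ?thesis unfolding U_def .
qed

text \<open>Nearly optimal covers of the sets \<open>A n\<close> are merged one after another.
  Strong subadditivity makes only the errors accumulate, not the contents, and the errors are chosen
  summable. No measurability of the sets is involved.\<close>

lemma net_content_incseq:
  fixes A :: "nat \<Rightarrow> 'a::euclidean_space set"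
  assumes "incseq A"
  shows "net_content s (\<Union>n. A n) = (SUP n. net_content s (A n))"
proof (rule antisym)
  show "(SUP n. net_content s (A n)) \<le> net_content s (\<Union>n. A n)"
    by (intro SUP_least net_content_mono) auto
  show "net_content s (\<Union>n. A n) \<le> (SUP n. net_content s (A n))"
  proof (cases "(SUP n. net_content s (A n)) < \<infinity>")
    case False
    then have "(SUP n. net_content s (A n)) = \<top>" by (simp only: not_less infinity_ennreal_def top_unique)
    then show ?thesis by (simp only: top_greatest)
  next
    case True
    then have fin: "net_content s (A n) < \<infinity>" for n
      using SUP_upper[of n UNIV "\<lambda>n. net_content s (A n)"] by (metis UNIV_I order_le_less_trans)
    show ?thesis
    proof (rule ennreal_le_epsilon)
      fix e :: real assume e: "0 < e"
      define d where "d = (\<lambda>n::nat. e * (1 / 2) ^ Suc n)"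
      have d: "0 < d n" for n using e by (simp add: d_def)
      have "\<exists>W. covers W (A n) \<and> weight s W \<le> net_content s (A n) + ennreal (d n)" for n
        using net_content_cover_approx[OF fin d] by metis
      then obtain Q where Q: "\<And>n. covers (Q n) (A n)" "\<And>n. weight s (Q n) \<le> net_content s (A n) + ennreal (d n)"
        by metis
      define V where "V = rec_nat (Q 0) (\<lambda>n v. maximal_cubes (v \<union> Q (Suc n)))"
      have V0: "V 0 = Q 0" and VS: "\<And>n. V (Suc n) = maximal_cubes (V n \<union> Q (Suc n))"
        by (simp_all add: V_def)
      have Vcov: "covers (V n) (A n)" for n
      proof (cases n)
        case 0
        then show ?thesis using Q by (simp add: V0)
      next
        case (Suc m)
        then show ?thesis unfolding Suc VS using Q(1)[of "Suc m"]
          by (intro covers_maximal_cubes) (auto simp: covers_def)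
      qed
      \<comment> \<open>Merging \<open>V n\<close> with the next cover leaves over enough cubes to
        cover \<open>A n\<close>. The content of \<open>A n\<close> therefore appears on both sides
        and cancels, being finite.\<close>
      have Vw: "weight s (V n) \<le> net_content s (A n) + (\<Sum>i\<le>n. ennreal (d i))" for n
      proof (induction n)
        case 0
        then show ?case using Q(2)[of 0] by (simp add: V0)
      next
        case (Suc n)
        have "covers (Q (Suc n)) (A n)"
          using Q(1)[of "Suc n"] incseq_SucD[OF assms, of n] by (auto simp: covers_def)
        then have "weight s (V (Suc n)) + net_content s (A n) \<le> weight s (V n) + weight s (Q (Suc n))"
          unfolding VS by (intro weight_maximal_cubes_Un Vcov)
        also have "\<dots> \<le> (net_content s (A n) + (\<Sum>i\<le>n. ennreal (d i))) + (net_content s (A (Suc n)) + ennreal (d (Suc n)))"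
          by (intro add_mono Suc Q)
        also have "\<dots> = (net_content s (A (Suc n)) + (\<Sum>i\<le>Suc n. ennreal (d i))) + net_content s (A n)"
          by (simp add: ac_simps)
        finally show ?case using fin[of n] by (auto simp: ennreal_add_left_cancel_le add.commute[of _ "net_content s (A n)"])
      qed
      define W where "W = maximal_cubes (\<Union>n. Q n)"
      have Vsub: "V n \<subseteq> (\<Union>n. Q n)" for n
        by (induction n) (auto simp: V0 VS maximal_cubes_def)
      \<comment> \<open>A cube that is maximal among all the covers survives every merge after it
        enters, because each \<open>V n\<close> consists only of cubes from these covers. So the
        finite stages of \<open>W\<close> inherit the bound for \<open>V n\<close>.\<close>
      have WV: "W \<inter> (\<Union>i\<le>n. Q i) \<subseteq> V n" for n
      proof (induction n)
        case (Suc n)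
        show ?case
        proof
          fix w assume w: "w \<in> W \<inter> (\<Union>i\<le>Suc n. Q i)"
          then have "w \<in> W \<inter> (\<Union>i\<le>n. Q i) \<or> w \<in> Q (Suc n)" by (auto simp: le_Suc_eq)
          then have "w \<in> V n \<union> Q (Suc n)" using Suc by blast
          moreover have "(j, corner j (snd w)) \<notin> V n \<union> Q (Suc n)" if "j < fst w" for j
            using w that Vsub[of n] unfolding W_def maximal_cubes_def by blast
          ultimately show "w \<in> V (Suc n)" unfolding VS maximal_cubes_def by blast
        qed
      qed (auto simp: V0)
      have "covers (\<Union>n. Q n) (\<Union>n. A n)" using Q(1) unfolding covers_def by blast
      then have "net_content s (\<Union>n. A n) \<le> weight s W"
        unfolding W_def by (intro net_content_le covers_maximal_cubes)
      also have "W = (\<Union>n. W \<inter> (\<Union>i\<le>n. Q i))" unfolding W_def maximal_cubes_def by blast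
      also have "weight s \<dots> = (SUP n. weight s (W \<inter> (\<Union>i\<le>n. Q i)))"
        by (intro weight_UN_incseq) (fastforce simp: incseq_def)
      also have "\<dots> \<le> (SUP n. net_content s (A n)) + ennreal e"
      proof (rule SUP_least)
        fix n
        have "weight s (W \<inter> (\<Union>i\<le>n. Q i)) \<le> net_content s (A n) + (\<Sum>i\<le>n. ennreal (d i))"
          using weight_mono[OF WV] Vw order_trans by blast
        also have "(\<Sum>i\<le>n. ennreal (d i)) = ennreal (\<Sum>i\<le>n. d i)"
          using d by (intro sum_ennreal) (auto intro: less_imp_le)
        also have "(\<Sum>i\<le>n. d i) = e * (1 - (1 / 2) ^ Suc n)"
          by (induction n) (auto simp: d_def field_simps)
        also have "ennreal \<dots> \<le> ennreal e" using e by (intro ennreal_leI) (simp add: mult_le_cancel_left1)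
        finally show "weight s (W \<inter> (\<Union>i\<le>n. Q i)) \<le> (SUP n. net_content s (A n)) + ennreal e"
          by (meson SUP_upper UNIV_I add_mono order_trans order_refl)
      qed
      finally show "net_content s (\<Union>n. A n) \<le> (SUP n. net_content s (A n)) + ennreal e" .
    qed
  qed
qed

subsection \<open>Frostman's lemma\<close>

text \<open>The masses are laid end to end in the order of \<open>\<iota>\<close>, so
  \<open>S q\<close> is the left end of the interval of \<open>q\<close>. The tree below uses this
  to cut the interval of a node into intervals for its children.\<close>

lemma interval_partition:
  fixes \<iota> :: "'b \<Rightarrow> nat" and m :: "'b \<Rightarrow> real"
  assumes fin: "finite F" and inj: "inj_on \<iota> F" and m: "\<And>q. q \<in> F \<Longrightarrow> 0 \<le> m q"
  defines "S \<equiv> \<lambda>q. \<Sum>q'\<in>{q'\<in>F. \<iota> q' < \<iota> q}. m q'"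
  shows interval_partition_ex: "\<lbrakk>0 \<le> t; t < sum m F\<rbrakk> \<Longrightarrow> \<exists>q\<in>F. S q \<le> t \<and> t < S q + m q"
    and interval_partition_disjoint: "\<lbrakk>q \<in> F; q' \<in> F; \<iota> q < \<iota> q'\<rbrakk> \<Longrightarrow> S q + m q \<le> S q'"
    and interval_partition_le: "q \<in> F \<Longrightarrow> S q + m q \<le> sum m F"
proof -
  have ins: "S q + m q = sum m (insert q {q'\<in>F. \<iota> q' < \<iota> q})" for q
    using fin by (simp add: S_def)
  show "S q + m q \<le> S q'" if "q \<in> F" "q' \<in> F" "\<iota> q < \<iota> q'"
    unfolding ins unfolding S_def using that fin m by (intro sum_mono2) auto
  show "S q + m q \<le> sum m F" if "q \<in> F"
    unfolding ins using that fin m by (intro sum_mono2) auto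
  show "\<exists>q\<in>F. S q \<le> t \<and> t < S q + m q" if t: "0 \<le> t" "t < sum m F"
  proof -
    define c where "c = (\<lambda>n. sum m {q\<in>F. \<iota> q < n})"
    have "{q\<in>F. \<iota> q < Suc (Max (\<iota> ` F))} = F"
      using fin by (auto simp: less_Suc_eq_le)
    then have ex: "\<exists>n. t < c n" using t by (metis c_def)
    then obtain N where "t < c N" by blast
    moreover have "\<not> t < c 0" using t by (simp add: c_def)
    ultimately obtain n where n: "\<not> t < c n" "t < c (Suc n)"
      using ex_least_nat_less[of "\<lambda>n. t < c n" N] by auto
    have "\<exists>q\<in>F. \<iota> q = n"
    proof (rule ccontr)
      assume "\<not> ?thesis"
      then have "{q\<in>F. \<iota> q < Suc n} = {q\<in>F. \<iota> q < n}" using less_Suc_eq by auto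
      then show False using n by (simp add: c_def)
    qed
    then obtain q where q: "q \<in> F" "\<iota> q = n" by blast
    have "{q'\<in>F. \<iota> q' < Suc n} = insert q {q'\<in>F. \<iota> q' < \<iota> q}"
      using q inj less_Suc_eq by (auto dest: inj_onD)
    then have "c (Suc n) = S q + m q" unfolding ins c_def by (rule arg_cong)
    moreover have "c n = S q" by (simp add: c_def S_def q)
    ultimately show ?thesis using q n by (intro bexI[of _ q]) auto
  qed
qed

text \<open>
  The mass \<open>p 0 r\<close> of the root is distributed downwards in proportion to \<open>p\<close>; the mass \<open>m\<close>
  received by a node is the length of an interval contained in the interval of its parent,
  so that every point of \<open>[0, p 0 r)\<close> selects an infinite branch.
\<close>

lemma mass_tree_branches:
  fixes L :: "nat \<Rightarrow> 'b set" and par :: "nat \<Rightarrow> 'b \<Rightarrow> 'b" and p :: "nat \<Rightarrow> 'b \<Rightarrow> real"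
  assumes finL: "\<And>k. finite (L k)" and root: "L 0 = {r}"
    and par: "\<And>k q. q \<in> L (Suc k) \<Longrightarrow> par k q \<in> L k"
    and p0: "\<And>k q. 0 \<le> p k q"
    and sub: "\<And>k q. q \<in> L k \<Longrightarrow> p k q \<le> (\<Sum>q'\<in>{q'\<in>L (Suc k). par k q' = q}. p (Suc k) q')"
  shows "\<exists>w. (\<forall>t\<in>{0..<p 0 r}. \<forall>k. w k t \<in> L k \<and> par k (w (Suc k) t) = w k t \<and> 0 < p k (w k t))
      \<and> (\<forall>k q. {t \<in> {0..<p 0 r}. w k t = q} \<in> sets borel
          \<and> emeasure lborel {t \<in> {0..<p 0 r}. w k t = q} \<le> ennreal (p k q))"
proof -
  have "\<exists>\<iota> :: 'b \<Rightarrow> nat. inj_on \<iota> (L k)" for k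
    using finite_imp_inj_to_nat_seg[OF finL] by blast
  then obtain \<iota> :: "nat \<Rightarrow> 'b \<Rightarrow> nat" where \<iota>: "\<And>k. inj_on (\<iota> k) (L k)" by metis
  define ch where "ch = (\<lambda>k q. {q'\<in>L (Suc k). par k q' = q})"
  \<comment> \<open>If all children of a node have \<open>p\<close> equal to 0, the quotient is 0 by
    the convention for division. No mass is lost then: the mass of the node is at most its
    \<open>p\<close>, hence at most the vanishing sum over its children.\<close>
  define m where "m = rec_nat (\<lambda>_. p 0 r)
    (\<lambda>k mk q. mk (par k q) * (p (Suc k) q / (\<Sum>q'\<in>ch k (par k q). p (Suc k) q')))"
  have m0: "m 0 q = p 0 r" for q by (simp add: m_def)
  have mS: "m (Suc k) q = m k (par k q) * (p (Suc k) q / (\<Sum>q'\<in>ch k (par k q). p (Suc k) q'))" for k q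
    by (simp add: m_def)
  have chL: "ch k q \<subseteq> L (Suc k)" for k q by (auto simp: ch_def)
  have fin_ch: "finite (ch k q)" for k q using finite_subset[OF chL finL] .
  have m_bounds: "q \<in> L k \<Longrightarrow> 0 \<le> m k q \<and> m k q \<le> p k q" for k q
  proof (induction k arbitrary: q)
    case 0
    then show ?case using root p0 by (auto simp: m0)
  next
    case (Suc k)
    define \<Sigma> where "\<Sigma> = (\<Sum>q'\<in>ch k (par k q). p (Suc k) q')"
    have mk: "0 \<le> m k (par k q)" "m k (par k q) \<le> p k (par k q)" using Suc.IH[OF par[OF Suc.prems]] by auto
    have le: "m k (par k q) \<le> \<Sigma>" using mk sub[OF par[OF Suc.prems]] by (simp add: \<Sigma>_def ch_def)
    have \<Sigma>0: "0 \<le> \<Sigma>" using mk le by linarith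
    have eq: "m (Suc k) q = m k (par k q) * (p (Suc k) q / \<Sigma>)" by (simp add: mS \<Sigma>_def)
    show ?case
    proof (cases "\<Sigma> = 0")
      case True
      then show ?thesis using p0 eq by simp
    next
      case False
      then have pos: "0 < \<Sigma>" using \<Sigma>0 by simp
      have "m k (par k q) * (p (Suc k) q / \<Sigma>) \<le> \<Sigma> * (p (Suc k) q / \<Sigma>)"
        using le pos p0 by (intro mult_right_mono) auto
      then show ?thesis using eq mk pos p0 by simp
    qed
  qed
  have m_sum: "(\<Sum>q'\<in>ch k q. m (Suc k) q') = m k q" if q: "q \<in> L k" for k q
  proof -
    define \<Sigma> where "\<Sigma> = (\<Sum>q'\<in>ch k q. p (Suc k) q')"
    have "(\<Sum>q'\<in>ch k q. m (Suc k) q') = (\<Sum>q'\<in>ch k q. m k q * (p (Suc k) q' / \<Sigma>))"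
      by (intro sum.cong) (auto simp: mS \<Sigma>_def ch_def)
    also have "\<dots> = m k q * (\<Sigma> / \<Sigma>)"
      by (simp only: \<Sigma>_def sum_distrib_left[symmetric] sum_divide_distrib[symmetric])
    also have "\<dots> = m k q"
    proof (cases "\<Sigma> = 0")
      case True
      then have "m k q = 0" using m_bounds[OF q] sub[OF q] by (simp add: \<Sigma>_def ch_def)
      then show ?thesis by simp
    qed simp
    finally show ?thesis .
  qed
  define S where "S = (\<lambda>k q. \<Sum>q'\<in>{q'\<in>ch k (par k q). \<iota> (Suc k) q' < \<iota> (Suc k) q}. m (Suc k) q')"
  define a where "a = rec_nat (\<lambda>_. 0) (\<lambda>k ak q. ak (par k q) + S k q)"
  have a0: "a 0 q = 0" for q by (simp add: a_def)
  have aS: "a (Suc k) q = a k (par k q) + S k q" for k q by (simp add: a_def)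
  define I where "I = (\<lambda>k q. {a k q..<a k q + m k q})"
  have inj_ch: "inj_on (\<iota> (Suc k)) (ch k q)" for k q by (rule inj_on_subset[OF \<iota> chL])
  have m_ch: "q' \<in> ch k q \<Longrightarrow> 0 \<le> m (Suc k) q'" for k q q'
    using m_bounds[OF subsetD[OF chL]] by blast
  have S_eq: "S k q' = (\<Sum>q''\<in>{q''\<in>ch k q. \<iota> (Suc k) q'' < \<iota> (Suc k) q'}. m (Suc k) q'')"
    if "q' \<in> ch k q" for k q q'
  proof -
    have "par k q' = q" using that by (simp add: ch_def)
    then show ?thesis by (simp add: S_def)
  qed
  have child_ex: "\<exists>q'\<in>ch k q. t \<in> I (Suc k) q'" if q: "q \<in> L k" and t: "t \<in> I k q" for k q t
  proof -
    have "0 \<le> t - a k q" "t - a k q < (\<Sum>q'\<in>ch k q. m (Suc k) q')"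
      using t m_sum[OF q] by (auto simp: I_def)
    from interval_partition_ex[where m = "m (Suc k)" and \<iota> = "\<iota> (Suc k)", OF fin_ch inj_ch m_ch this]
    obtain q' where q': "q' \<in> ch k q" "S k q' \<le> t - a k q" "t - a k q < S k q' + m (Suc k) q'"
      using S_eq by force
    then have "par k q' = q" by (simp add: ch_def)
    then have "t \<in> I (Suc k) q'" using q' by (simp add: I_def aS)
    then show ?thesis using q' by blast
  qed
  have child_sub: "I (Suc k) q \<subseteq> I k (par k q)" if q: "q \<in> L (Suc k)" for k q
  proof -
    have qc: "q \<in> ch k (par k q)" using q by (simp add: ch_def)
    have "0 \<le> S k q" unfolding S_def using m_ch by (intro sum_nonneg) auto
    moreover have "S k q + m (Suc k) q \<le> m k (par k q)"
      using interval_partition_le[where m = "m (Suc k)" and \<iota> = "\<iota> (Suc k)", OF fin_ch inj_ch m_ch qc] m_sum[OF par[OF q]] S_eq[OF qc] by simp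
    ultimately show ?thesis by (auto simp: I_def aS)
  qed
  have sib: "q = q'" if "q \<in> ch k u" "q' \<in> ch k u" "t \<in> I (Suc k) q" "t \<in> I (Suc k) q'" for k u q q' t
  proof (rule ccontr)
    assume ne: "q \<noteq> q'"
    have *: False if "q1 \<in> ch k u" "q2 \<in> ch k u" "t \<in> I (Suc k) q1" "t \<in> I (Suc k) q2" "\<iota> (Suc k) q1 < \<iota> (Suc k) q2" for q1 q2
    proof -
      have "S k q1 + m (Suc k) q1 \<le> S k q2"
        using interval_partition_disjoint[where m = "m (Suc k)" and \<iota> = "\<iota> (Suc k)", OF fin_ch inj_ch m_ch that(1,2,5)] S_eq that(1,2) by simp
      moreover have "par k q1 = u" "par k q2 = u" using that by (auto simp: ch_def)
      ultimately show False using that by (auto simp: I_def aS)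
    qed
    have "\<iota> (Suc k) q \<noteq> \<iota> (Suc k) q'" using ne that inj_ch by (meson inj_onD)
    then show False using * that by (meson linorder_neqE_nat)
  qed
  define w where "w = (\<lambda>k t. rec_nat r (\<lambda>k q. SOME q'. q' \<in> ch k q \<and> t \<in> I (Suc k) q') k)"
  have w0: "w 0 t = r" for t by (simp add: w_def)
  have wS: "w (Suc k) t = (SOME q'. q' \<in> ch k (w k t) \<and> t \<in> I (Suc k) q')" for k t by (simp add: w_def)
  have inv: "w k t \<in> L k \<and> t \<in> I k (w k t)" if t: "t \<in> {0..<p 0 r}" for k t
  proof (induction k)
    case 0
    then show ?case using t root by (simp add: w0 I_def a0 m0)
  next
    case (Suc k)
    have "\<exists>q'. q' \<in> ch k (w k t) \<and> t \<in> I (Suc k) q'" using child_ex Suc by blast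
    then have "w (Suc k) t \<in> ch k (w k t) \<and> t \<in> I (Suc k) (w (Suc k) t)" unfolding wS by (rule someI_ex)
    then show ?case using chL by blast
  qed
  have par_w: "par k (w (Suc k) t) = w k t" if t: "t \<in> {0..<p 0 r}" for k t
  proof -
    have "\<exists>q'. q' \<in> ch k (w k t) \<and> t \<in> I (Suc k) q'" using child_ex inv[OF t] by blast
    then have "w (Suc k) t \<in> ch k (w k t) \<and> t \<in> I (Suc k) (w (Suc k) t)" unfolding wS by (rule someI_ex)
    then show ?thesis by (simp add: ch_def)
  qed
  \<comment> \<open>The intervals of one level are disjoint, so the branch chosen by
    \<open>SOME\<close> is the only possible one. Its fibres are therefore intervals, which gives
    measurability and the mass bound together.\<close>
  have uniq: "q \<in> L k \<Longrightarrow> t \<in> I k q \<Longrightarrow> q = w k t" if t: "t \<in> {0..<p 0 r}" for k q t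
  proof (induction k arbitrary: q)
    case 0
    then show ?case using root by (simp add: w0)
  next
    case (Suc k)
    have "par k q = w k t" using Suc.IH[OF par[OF Suc.prems(1)]] child_sub[OF Suc.prems(1)] Suc.prems(2) by blast
    then have "q \<in> ch k (w k t)" "w (Suc k) t \<in> ch k (w k t)"
      using Suc.prems(1) inv[OF t, of "Suc k"] par_w[OF t] by (auto simp: ch_def)
    then show ?case using sib Suc.prems(2) inv[OF t, of "Suc k"] by blast
  qed
  have fib: "{t \<in> {0..<p 0 r}. w k t = q} = (if q \<in> L k then I k q \<inter> {0..<p 0 r} else {})" for k q
    using inv uniq by auto
  show ?thesis
  proof (intro exI[of _ w] conjI ballI allI)
    fix k and t :: real assume t: "t \<in> {0..<p 0 r}"
    show "w k t \<in> L k" using inv[OF t] ..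
    show "par k (w (Suc k) t) = w k t" by (rule par_w[OF t])
    \<comment> \<open>The intervals are half-open, so one that contains \<open>t\<close> has
      positive length; branches thus avoid the nodes with \<open>p\<close> equal to 0.\<close>
    have "0 < m k (w k t)" using inv[OF t, of k] by (auto simp: I_def)
    then show "0 < p k (w k t)" using m_bounds[of "w k t" k] inv[OF t, of k] by linarith
  next
    fix k q
    show "{t \<in> {0..<p 0 r}. w k t = q} \<in> sets borel" unfolding fib by (simp add: I_def)
    show "emeasure lborel {t \<in> {0..<p 0 r}. w k t = q} \<le> ennreal (p k q)"
    proof (cases "q \<in> L k")
      case True
      have "emeasure lborel (I k q \<inter> {0..<p 0 r}) \<le> emeasure lborel (I k q)"
        by (intro emeasure_mono) (auto simp: I_def)
      also have "\<dots> = ennreal (m k q)" using m_bounds[OF True] by (simp add: I_def)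
      also have "\<dots> \<le> ennreal (p k q)" using m_bounds[OF True] by (intro ennreal_leI) simp
      finally show ?thesis unfolding fib using True by simp
    next
      case False
      then show ?thesis unfolding fib by simp
    qed
  qed
qed

lemma geometric_Cauchy_limit:
  fixes u :: "nat \<Rightarrow> 'a::complete_space"
  assumes "\<And>k. dist (u (Suc k)) (u k) \<le> B / 2 ^ k"
  obtains l where "u \<longlonglongrightarrow> l" "\<And>k. dist l (u k) \<le> 2 * B / 2 ^ k"
proof -
  have B: "0 \<le> B" using order_trans[OF zero_le_dist assms[of 0]] by simp
  have *: "dist (u (k + i)) (u k) \<le> 2 * B / 2 ^ k * (1 - 1 / 2 ^ i)" for k i
  proof (induction i)
    case (Suc i)
    have "dist (u (k + Suc i)) (u k) \<le> dist (u (Suc (k + i))) (u (k + i)) + dist (u (k + i)) (u k)"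
      using dist_triangle by simp
    also have "\<dots> \<le> B / 2 ^ (k + i) + 2 * B / 2 ^ k * (1 - 1 / 2 ^ i)"
      by (intro add_mono Suc assms)
    also have "\<dots> = 2 * B / 2 ^ k * (1 - 1 / 2 ^ Suc i)"
      by (simp add: power_add field_simps)
    finally show ?case .
  qed simp
  have le: "dist (u n) (u k) \<le> 2 * B / 2 ^ k" if "k \<le> n" for k n
  proof -
    have "dist (u n) (u k) \<le> 2 * B / 2 ^ k * (1 - 1 / 2 ^ (n - k))" using *[of k "n - k"] that by simp
    also have "\<dots> \<le> 2 * B / 2 ^ k * 1" using B by (intro mult_left_mono) auto
    finally show ?thesis by simp
  qed
  have lim0: "(\<lambda>k. 2 * B / 2 ^ k) \<longlonglongrightarrow> 0"
    by (rule LIMSEQ_divide_realpow_zero) simp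
  have "Cauchy u"
  proof (rule metric_CauchyI)
    fix e :: real assume "0 < e"
    then obtain k where k: "2 * B / 2 ^ k < e / 2"
      using order_tendstoD(2)[OF lim0, of "e / 2"] by (auto simp: eventually_sequentially)
    have "dist (u m) (u n) < e" if "m \<ge> k" "n \<ge> k" for m n
      using dist_triangle2[of "u m" "u n" "u k"] le[OF that(1)] le[OF that(2)] k by linarith
    then show "\<exists>M. \<forall>m\<ge>M. \<forall>n\<ge>M. dist (u m) (u n) < e" by blast
  qed
  then obtain l where l: "u \<longlonglongrightarrow> l" using Cauchy_convergent convergent_def by blast
  have "dist l (u k) \<le> 2 * B / 2 ^ k" for k
  proof (rule Lim_bounded)
    show "(\<lambda>n. dist (u n) (u k)) \<longlonglongrightarrow> dist l (u k)" by (intro tendsto_intros l)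
    show "\<forall>n\<ge>k. dist (u n) (u k) \<le> 2 * B / 2 ^ k" using le by blast
  qed
  with l that show thesis by blast
qed

text \<open>
  In \<open>emeasure \<mu> (\<Inter>j. closure (S j)) = 1\<close> the sets \<open>S j\<close> need not be measurable: each branch of
  the mass tree meets every \<open>S j\<close>, hence its limit point lies in the intersection of the closures.
\<close>

lemma frostman_decseq:
  fixes S :: "nat \<Rightarrow> 'a::euclidean_space set"
  assumes decS: "decseq S" and cell: "\<And>x. x \<in> S 0 \<Longrightarrow> corner 0 x = q0"
    and c: "0 < c" "\<And>j. ennreal c \<le> net_content s (S j)" and s: "0 \<le> s"
  obtains \<mu> :: "'a measure" and C where "prob_space \<mu>" "sets \<mu> = sets borel" "emeasure \<mu> (\<Inter>j. closure (S j)) = 1"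
    "\<And>x r. 0 < r \<Longrightarrow> measure \<mu> (cball x r) \<le> C * r powr s"
proof -
  define n where "n = DIM('a)"
  define Q0 where "Q0 = {x::'a. corner 0 x = q0}"
  have SQ: "S j \<subseteq> Q0" for j using cell decseqD[OF decS, of 0 j] by (auto simp: Q0_def)
  have bQ0: "bounded Q0"
  proof (rule bounded_subset[OF bounded_cball[of q0 "real n"]])
    show "Q0 \<subseteq> cball q0 (real n)"
      using dist_corner_le[of _ 0] by (auto simp: Q0_def n_def dist_commute)
  qed
  have S0: "S 0 \<noteq> {}"
  proof
    assume "S 0 = {}"
    then have "ennreal c \<le> 0" using c(2)[of 0] net_content_empty[where 'a = 'a, of s] by simp
    then show False using c(1) by (simp add: ennreal_eq_0_iff)
  qed
  define L where "L = (\<lambda>k. corner k ` Q0)"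
  \<comment> \<open>Taking the infimum over \<open>j\<close> gives one tree for all the sets: a cube
    of positive \<open>p\<close> meets every \<open>S j\<close>. Subadditivity over the finitely
    many child cubes survives because the contents decrease to \<open>P\<close> and finite sums pass
    to the limit.\<close>
  define P where "P = (\<lambda>k q. INF j. net_content s {x \<in> S j. corner k x = q})"
  define p where "p = (\<lambda>k q. enn2real (P k q))"
  have P_le: "P k q \<le> ennreal (2 powr (- (s * real k)))" for k q
    unfolding P_def by (rule INF_lower2[of 0]) (auto intro: net_content_cell_le)
  have ep: "ennreal (p k q) = P k q" for k q
    unfolding p_def using P_le[of k q] by (intro ennreal_enn2real) (metis ennreal_less_top order_le_less_trans)
  have p_le: "p k q \<le> 2 powr (- (s * real k))" for k q
    using P_le[of k q] unfolding ep[symmetric] by simp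
  have decP: "decseq (\<lambda>j. net_content s {x \<in> S j. corner k x = q})" for k q
    using decS by (auto simp: decseq_def intro!: net_content_mono)
  have limP: "(\<lambda>j. net_content s {x \<in> S j. corner k x = q}) \<longlonglongrightarrow> P k q" for k q
    unfolding P_def by (rule LIMSEQ_INF[OF decP])
  have finL: "finite (L k)" for k unfolding L_def by (rule finite_corner_image[OF bQ0])
  have root: "L 0 = {q0}" using S0 SQ[of 0] unfolding L_def Q0_def by auto
  have par: "corner k q \<in> L k" if "q \<in> L (Suc k)" for k q
    using that corner_corner[of k "Suc k"] by (auto simp: L_def)
  have sub: "p k q \<le> (\<Sum>q'\<in>{q' \<in> L (Suc k). corner k q' = q}. p (Suc k) q')" for k q
  proof -
    define ch where "ch = {q' \<in> L (Suc k). corner k q' = q}"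
    have finch: "finite ch" unfolding ch_def using finL by simp
    have "P k q \<le> (\<Sum>q'\<in>ch. P (Suc k) q')"
    proof (rule LIMSEQ_le[OF limP])
      show "(\<lambda>j. \<Sum>q'\<in>ch. net_content s {x \<in> S j. corner (Suc k) x = q'}) \<longlonglongrightarrow> (\<Sum>q'\<in>ch. P (Suc k) q')"
        by (intro tendsto_sum limP)
      have "net_content s {x \<in> S j. corner k x = q} \<le> (\<Sum>q'\<in>ch. net_content s {x \<in> S j. corner (Suc k) x = q'})" for j
      proof -
        have "{x \<in> S j. corner k x = q} \<subseteq> (\<Union>q'\<in>ch. {x \<in> S j. corner (Suc k) x = q'})"
          using SQ[of j] corner_corner[of k "Suc k"] by (auto simp: ch_def L_def)
        then show ?thesis using net_content_mono net_content_UN[OF finch] order_trans by blast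
      qed
      then show "\<exists>N. \<forall>j\<ge>N. net_content s {x \<in> S j. corner k x = q}
          \<le> (\<Sum>q'\<in>ch. net_content s {x \<in> S j. corner (Suc k) x = q'})" by blast
    qed
    then have "ennreal (p k q) \<le> ennreal (\<Sum>q'\<in>ch. p (Suc k) q')"
      unfolding ep[symmetric] by (subst sum_ennreal[symmetric]) (auto simp: p_def)
    then show ?thesis
      unfolding ch_def by (subst (asm) ennreal_le_iff) (auto simp: p_def intro!: sum_nonneg)
  qed
  have p0: "0 \<le> p k q" for k q by (simp add: p_def)
  define p1 where "p1 = p 0 q0"
  have "ennreal c \<le> P 0 q0"
    unfolding P_def
  proof (rule INF_greatest)
    fix j
    have "{x \<in> S j. corner 0 x = q0} = S j" using SQ[of j] by (auto simp: Q0_def)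
    then show "ennreal c \<le> net_content s {x \<in> S j. corner 0 x = q0}" using c(2) by simp
  qed
  then have "c \<le> p1" unfolding ep[symmetric] p1_def using p0 by (simp add: ennreal_le_iff)
  then have p1: "0 < p1" using c by simp
  have "\<exists>w. (\<forall>t\<in>{0..<p1}. \<forall>k. w k t \<in> L k \<and> corner k (w (Suc k) t) = w k t \<and> 0 < p k (w k t))
      \<and> (\<forall>k q. {t \<in> {0..<p1}. w k t = q} \<in> sets borel
          \<and> emeasure lborel {t \<in> {0..<p1}. w k t = q} \<le> ennreal (p k q))"
    unfolding p1_def
    by (rule mass_tree_branches[where L = L and r = q0 and par = corner and p = p, OF finL root par p0 sub])
  then obtain w where w_all: "(\<forall>t\<in>{0..<p1}. \<forall>k. w k t \<in> L k \<and> corner k (w (Suc k) t) = w k t \<and> 0 < p k (w k t))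
      \<and> (\<forall>k q. {t \<in> {0..<p1}. w k t = q} \<in> sets borel
          \<and> emeasure lborel {t \<in> {0..<p1}. w k t = q} \<le> ennreal (p k q))" ..
  have w: "\<And>k t. t \<in> {0..<p1} \<Longrightarrow> w k t \<in> L k"
    "\<And>k t. t \<in> {0..<p1} \<Longrightarrow> corner k (w (Suc k) t) = w k t"
    "\<And>k t. t \<in> {0..<p1} \<Longrightarrow> 0 < p k (w k t)"
    "\<And>k q. {t \<in> {0..<p1}. w k t = q} \<in> sets borel"
    "\<And>k q. emeasure lborel {t \<in> {0..<p1}. w k t = q} \<le> ennreal (p k q)"
    using w_all by blast+
  have "\<exists>x. x \<in> S k \<and> corner k x = q" if "0 < p k q" for k q
  proof (rule ccontr)
    assume "\<not> ?thesis"
    then have "{x \<in> S k. corner k x = q} = {}" by blast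
    then have "net_content s {x \<in> S k. corner k x = q} = 0" by (simp only: net_content_empty)
    moreover have "P k q \<le> net_content s {x \<in> S k. corner k x = q}" unfolding P_def by (rule INF_lower) simp
    ultimately show False using that by (simp add: p_def)
  qed
  then obtain X where X: "\<And>k q. 0 < p k q \<Longrightarrow> X k q \<in> S k" "\<And>k q. 0 < p k q \<Longrightarrow> corner k (X k q) = q"
    by metis
  have "\<exists>l. (\<lambda>k. w k t) \<longlonglongrightarrow> l \<and> (\<forall>k. dist l (w k t) \<le> 2 * real n / 2 ^ k)" if t: "t \<in> {0..<p1}" for t
  proof -
    have "dist (w (Suc k) t) (w k t) \<le> real n / 2 ^ k" for k
      using dist_corner_le[of "w (Suc k) t" k] w(2)[OF t] by (simp add: n_def)
    then show ?thesis using geometric_Cauchy_limit[of "\<lambda>k. w k t" "real n"] by metis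
  qed
  then obtain f0 where f0: "\<And>t. t \<in> {0..<p1} \<Longrightarrow> (\<lambda>k. w k t) \<longlonglongrightarrow> f0 t"
    "\<And>t k. t \<in> {0..<p1} \<Longrightarrow> dist (f0 t) (w k t) \<le> 2 * real n / 2 ^ k" by metis
  define f where "f = (\<lambda>t. if t \<in> {0..<p1} then f0 t else 0)"
  have f_meas: "f \<in> borel_measurable borel"
  proof (rule borel_measurable_LIMSEQ_metric)
    define F where "F = (\<lambda>k t. \<Sum>q\<in>L k. indicator {t \<in> {0..<p1}. w k t = q} t *\<^sub>R q)"
    show "F k \<in> borel_measurable borel" for k
      unfolding F_def using w(4) by (intro borel_measurable_sum borel_measurable_scaleR borel_measurable_indicator) auto
    fix t :: real
    have "F k t = (if t \<in> {0..<p1} then w k t else 0)" for k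
    proof (cases "t \<in> {0..<p1}")
      case True
      have "F k t = (\<Sum>q\<in>L k. if q = w k t then q else 0)"
        unfolding F_def using True by (intro sum.cong) (auto simp: indicator_def)
      then show ?thesis using True w(1) finL by (simp add: sum.delta)
    next
      case False
      then show ?thesis by (auto simp: F_def indicator_def)
    qed
    then show "(\<lambda>k. F k t) \<longlonglongrightarrow> f t"
      using f0(1)[of t] by (cases "t \<in> {0..<p1}") (simp_all only: f_def if_True if_False tendsto_const)
  qed
  \<comment> \<open>The 3 is 2 for the tail of the geometric series of corners plus 1 for the
    distance from \<open>X k (w k t)\<close> to its own corner.\<close>
  have near: "dist (f t) (X k (w k t)) \<le> 3 * real n / 2 ^ k" if t: "t \<in> {0..<p1}" for t k
  proof -
    have "dist (f t) (X k (w k t)) \<le> dist (f t) (w k t) + dist (X k (w k t)) (w k t)"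
      by (rule dist_triangle2)
    also have "\<dots> \<le> 2 * real n / 2 ^ k + real n / 2 ^ k"
      using f0(2)[OF t, of k] dist_corner_le[of "X k (w k t)" k] X(2)[OF w(3)[OF t]] t
      by (intro add_mono) (auto simp: f_def n_def)
    finally show ?thesis by (simp add: field_simps)
  qed
  have f_in: "f t \<in> (\<Inter>j. closure (S j))" if t: "t \<in> {0..<p1}" for t
  proof
    fix j
    show "f t \<in> closure (S j)"
      unfolding closure_approachable
    proof (intro allI impI)
      fix e :: real assume e: "0 < e"
      have "(\<lambda>k. 3 * real n / 2 ^ k) \<longlonglongrightarrow> 0" by (rule LIMSEQ_divide_realpow_zero) simp
      then have "\<forall>\<^sub>F k in sequentially. 3 * real n / 2 ^ k < e" using e by (rule order_tendstoD(2))
      then obtain K where K: "\<And>k. k \<ge> K \<Longrightarrow> 3 * real n / 2 ^ k < e" by (auto simp: eventually_sequentially)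
      define k where "k = max j K"
      have "X k (w k t) \<in> S k" using X(1) w(3)[OF t] by blast
      then have "X k (w k t) \<in> S j" using decseqD[OF decS, of j k] by (auto simp: k_def)
      moreover have "dist (X k (w k t)) (f t) < e"
        using near[OF t, of k] K[of k] by (simp add: k_def dist_commute)
      ultimately show "\<exists>y\<in>S j. dist y (f t) < e" by blast
    qed
  qed
  \<comment> \<open>Lebesgue measure on the root interval, normalised and pushed forward by the
    limit map \<open>f\<close>; the level-k mass of a cube is then at most its \<open>p\<close>
    divided by \<open>p1\<close>.\<close>
  define N where "N = uniform_measure lborel {0..<p1}"
  have eT: "emeasure lborel {0..<p1} = ennreal p1" using p1 by simp
  have "prob_space N" unfolding N_def by (rule prob_space_uniform_measure) (use p1 eT in auto)
  have sN: "sets N = sets borel" "space N = UNIV" by (simp_all add: N_def)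
  have fN: "f \<in> measurable N borel" using f_meas by (simp add: N_def cong: measurable_cong_sets)
  define \<mu> where "\<mu> = distr N borel f"
  have em: "emeasure \<mu> B = emeasure lborel {t \<in> {0..<p1}. f t \<in> B} / ennreal p1" if B: "B \<in> sets borel" for B
  proof -
    have m: "f -` B \<in> sets borel" using measurable_sets[OF f_meas B] by simp
    have "emeasure \<mu> B = emeasure N (f -` B)"
      unfolding \<mu>_def using B by (subst emeasure_distr[OF fN]) (auto simp: sN)
    also have "\<dots> = emeasure lborel ({0..<p1} \<inter> f -` B) / ennreal p1"
      unfolding N_def using m by (subst emeasure_uniform_measure) (auto simp: eT)
    also have "{0..<p1} \<inter> f -` B = {t \<in> {0..<p1}. f t \<in> B}" by auto
    finally show ?thesis .
  qed
  show thesis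
  proof
    interpret N: prob_space N by fact
    show pm: "prob_space \<mu>" unfolding \<mu>_def by (rule N.prob_space_distr[OF fN])
    interpret M: prob_space \<mu> by fact
    show "sets \<mu> = sets borel" by (simp add: \<mu>_def)
    have "{t \<in> {0..<p1}. f t \<in> (\<Inter>j. closure (S j))} = {0..<p1}" using f_in by blast
    then show "emeasure \<mu> (\<Inter>j. closure (S j)) = 1"
      using p1 by (subst em) (auto simp: eT intro!: ennreal_divide_self)
    \<comment> \<open>The first factor counts the level-k cubes that can send mass into a ball of
      radius comparable with 2^(-k), and 2^s is the loss in passing from 2^(-k) to \<open>r\<close>.
      The summand 1 settles radii \<open>1 \<le> r\<close>, where total mass 1 suffices.\<close>
    define C where "C = (real (2 * (3 * n + 1) + 1) ^ n * 2 powr s) / p1 + 1"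
    have C: "0 \<le> (real (2 * (3 * n + 1) + 1) ^ n * 2 powr s) / p1" using p1 by simp
    show "measure \<mu> (cball x r) \<le> C * r powr s" if r: "0 < r" for x r
    proof (cases "1 \<le> r")
      case True
      have "measure \<mu> (cball x r) \<le> 1 * 1" by simp
      also have "\<dots> \<le> C * r powr s" using True s C by (intro mult_mono) (auto simp: C_def ge_one_powr_ge_zero)
      finally show ?thesis .
    next
      case False
      have "\<exists>k. (1/2) ^ Suc k < r"
      proof -
        obtain k where "(1/2) ^ k < r" using real_arch_pow_inv[OF r, of "1/2"] by auto
        then have "(1/2) ^ Suc k < r" using power_Suc_le_self[of "1/2::real" k] by (simp add: field_simps)
        then show ?thesis by blast
      qed
      define k where "k = (LEAST k. (1/2) ^ Suc k < r)"
      have k1: "(1/2) ^ Suc k < r" unfolding k_def by (rule LeastI_ex) fact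
      have k2: "r \<le> (1/2) ^ k"
      proof (cases k)
        case 0
        then show ?thesis using False by simp
      next
        case (Suc k')
        then have "k' < k" by simp
        then have "\<not> (1/2) ^ Suc k' < r" unfolding k_def by (rule not_less_Least)
        then show ?thesis unfolding Suc by simp
      qed
      \<comment> \<open>With \<open>r \<le> (1/2) ^ k\<close> and the error
        \<open>3 * real n / 2 ^ k\<close> from \<open>near\<close>, every branch ending in the ball
        has its point \<open>X k (w k t)\<close> within \<open>3 * n + 1\<close> cube sides of
        \<open>x\<close>.\<close>
      define Q where "Q = corner k ` cball x (real (3 * n + 1) / 2 ^ k)"
      have Q: "finite Q" "card Q \<le> (2 * (3 * n + 1) + 1) ^ n"
        unfolding Q_def n_def by (rule corner_image_cball)+
      have inQ: "w k t \<in> Q" if t: "t \<in> {0..<p1}" "f t \<in> cball x r" for t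
      proof -
        have "dist x (X k (w k t)) \<le> dist x (f t) + dist (f t) (X k (w k t))" by (rule dist_triangle)
        also have "\<dots> \<le> (1/2) ^ k + 3 * real n / 2 ^ k"
          using t k2 near[OF t(1), of k] by (intro add_mono) auto
        also have "\<dots> = real (3 * n + 1) / 2 ^ k" by (simp add: field_simps)
        finally have "X k (w k t) \<in> cball x (real (3 * n + 1) / 2 ^ k)" by simp
        then show ?thesis unfolding Q_def using X(2)[OF w(3)[OF t(1)]] by (metis imageI)
      qed
      have "emeasure lborel {t \<in> {0..<p1}. f t \<in> cball x r} \<le> emeasure lborel (\<Union>q\<in>Q. {t \<in> {0..<p1}. w k t = q})"
        using inQ w(4) Q(1) by (intro emeasure_mono sets.finite_UN) auto
      also have "\<dots> \<le> (\<Sum>q\<in>Q. emeasure lborel {t \<in> {0..<p1}. w k t = q})"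
        using w(4) Q(1) by (intro emeasure_subadditive_finite) auto
      also have "\<dots> \<le> (\<Sum>q\<in>Q. ennreal (2 powr (- (s * real k))))"
        using w(5) p_le by (intro sum_mono) (meson ennreal_leI order_trans)
      also have "\<dots> = ennreal (real (card Q) * 2 powr (- (s * real k)))"
        by (simp add: ennreal_mult ennreal_of_nat_eq_real_of_nat)
      also have "\<dots> \<le> ennreal (real (2 * (3 * n + 1) + 1) ^ n * (2 powr s * r powr s))"
      proof (intro ennreal_leI mult_mono)
        show "real (card Q) \<le> real (2 * (3 * n + 1) + 1) ^ n"
          using Q(2) by (metis of_nat_le_iff of_nat_power)
        have "2 powr (- (s * real k)) = ((1/2) ^ k) powr s"
          by (simp add: powr_minus powr_powr mult.commute powr_divide powr_one_eq_one inverse_eq_divide flip: powr_realpow)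
        also have "\<dots> \<le> (2 * r) powr s" using k1 r s by (intro powr_mono2) auto
        finally show "2 powr (- (s * real k)) \<le> 2 powr s * r powr s" using r by (simp add: powr_mult)
      qed auto
      finally have le: "emeasure lborel {t \<in> {0..<p1}. f t \<in> cball x r}
          \<le> ennreal (real (2 * (3 * n + 1) + 1) ^ n * (2 powr s * r powr s))" .
      have "emeasure \<mu> (cball x r) \<le> ennreal (real (2 * (3 * n + 1) + 1) ^ n * (2 powr s * r powr s)) / ennreal p1"
        using divide_right_mono_ennreal[OF le] by (simp add: em)
      also have "\<dots> = ennreal (real (2 * (3 * n + 1) + 1) ^ n * (2 powr s * r powr s) / p1)"
        using p1 by (intro divide_ennreal) auto
      also have "\<dots> \<le> ennreal (C * r powr s)"
        using p1 r by (intro ennreal_leI) (simp add: C_def field_simps)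
      finally show ?thesis
        unfolding M.emeasure_eq_measure using C r by (subst (asm) ennreal_le_iff) (auto simp: C_def)
    qed
  qed
qed

section \<open>From Hausdorff measure to net content, and Frostman's lemma for Borel sets\<close>

lemma bounded_cell: "bounded {x :: 'a::euclidean_space. corner k x = q}"
  by (rule bounded_subset[OF bounded_cball[of q "real DIM('a) / 2 ^ k"]])
    (use dist_corner_le[of _ k] in \<open>auto simp: dist_commute\<close>)

lemma diameter_cell_le:
  "diameter {x :: 'a::euclidean_space. corner k x = q} \<le> 2 * real DIM('a) / 2 ^ k"
proof (rule diameter_le)
  fix x y :: 'a
  assume "x \<in> {x. corner k x = q}" "y \<in> {x. corner k x = q}"
  then have "dist x q \<le> real DIM('a) / 2 ^ k" "dist y q \<le> real DIM('a) / 2 ^ k"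
    using dist_corner_le[of x k] dist_corner_le[of y k] by auto
  then show "norm (x - y) \<le> 2 * real DIM('a) / 2 ^ k"
    using dist_triangle2[of x y q] by (simp add: dist_norm)
qed simp

lemma corner_measurable [measurable]: "corner k \<in> borel_measurable borel"
  unfolding corner_def[abs_def] by measurable

text \<open>A cover of small total weight consists of small cubes, because each cube alone weighs no
  more than the total. Thus vanishing content already yields covers at every scale
  \<open>\<delta>\<close>; positivity of \<open>s\<close> is what turns small weight into small
  side.\<close>

lemma hausdorff_measure_eq_0_of_net_content:
  fixes A :: "'a::euclidean_space set"
  assumes s: "0 < s" and A: "net_content s A = 0"
  shows "hausdorff_measure s A = 0"
proof -
  define n where "n = real DIM('a)"
  have n: "0 < n" by (simp add: n_def)
  have "hausdorff_premeasure s \<delta> A = 0" if \<delta>: "0 < \<delta>" for \<delta>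
  proof -
    have "hausdorff_premeasure s \<delta> A \<le> 0 + ennreal \<epsilon>" if \<epsilon>: "0 < \<epsilon>" for \<epsilon>
    proof -
      \<comment> \<open>The first entry of the minimum forces cell diameters below
        \<open>\<delta>\<close>, the second makes the total of the s-th powers of the diameters at
        most \<open>\<epsilon>\<close>.\<close>
      define e where "e = min ((\<delta> / (2 * n)) powr s) (\<epsilon> / (2 * n) powr s)"
      have e: "0 < e" using \<delta> \<epsilon> n by (simp add: e_def)
      obtain W where W: "covers W A" "weight s W \<le> ennreal e"
        using net_content_cover_approx[of s A e] A e by auto
      \<comment> \<open>Discarding pairs that name no cube leaves a countable family, which can be
        enumerated as the Hausdorff premeasure requires; gaps in the enumeration are filled with
        empty sets, of \<open>diam_pow\<close> equal to 0.\<close>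
      define V where "V = W \<inter> (SIGMA k:UNIV. range (corner k))"
      have cV: "countable V"
        unfolding V_def by (intro countable_Int2 countable_SIGMA countable_range_corner) auto
      have covV: "covers V A" using W(1) unfolding covers_def V_def by auto
      have wV: "weight s V \<le> ennreal e"
        using weight_mono[of V W s] W(2) unfolding V_def by auto
      define cell where "cell = (\<lambda>w :: nat \<times> 'a. {x. corner (fst w) x = snd w})"
      define g where "g = to_nat_on V"
      define U where "U = (\<lambda>i. if i \<in> g ` V then cell (from_nat_into V i) else {})"
      have Ug: "U (g w) = cell w" if "w \<in> V" for w
        using that cV by (auto simp: U_def g_def)
      have small: "2 powr (- (s * real (fst w))) \<le> e" if "w \<in> V" for w
      proof -
        have "weight s {w} \<le> ennreal e" using weight_mono[of "{w}" V s] that wV by auto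
        then show ?thesis unfolding weight_singleton using e by simp
      qed
      have dw: "diameter (cell w) \<le> 2 * n * 2 powr (- real (fst w))" for w
        using diameter_cell_le[of "fst w" "snd w"]
        by (simp add: cell_def n_def powr_minus powr_realpow divide_inverse)
      have "diam_pow s (cell w) \<le> ennreal ((2 * n) powr s) * ennreal (2 powr (- (s * real (fst w))))" for w
      proof (cases "cell w = {}")
        case False
        have "diameter (cell w) powr s \<le> (2 * n * 2 powr (- real (fst w))) powr s"
          using s dw diameter_ge_0[OF bounded_cell] by (intro powr_mono2) (auto simp: cell_def)
        also have "\<dots> = (2 * n) powr s * 2 powr (- (s * real (fst w)))"
          using n by (simp add: powr_mult powr_powr mult.commute)
        finally show ?thesis using False s by (simp add: diam_pow_def ennreal_leI flip: ennreal_mult)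
      qed (simp add: diam_pow_def)
      note diam_le = this
      have "hausdorff_premeasure s \<delta> A \<le> (\<Sum>i. diam_pow s (U i))"
        unfolding hausdorff_premeasure_def
      proof (rule INF_lower, intro CollectI conjI allI)
        show "A \<subseteq> (\<Union>i. U i)"
        proof
          fix x assume "x \<in> A"
          then obtain k where k: "(k, corner k x) \<in> V" using covV by (auto simp: covers_def)
          then have "x \<in> U (g (k, corner k x))" using Ug by (simp add: cell_def)
          then show "x \<in> (\<Union>i. U i)" by blast
        qed
        fix i
        show "bounded (U i)" by (auto simp: U_def cell_def bounded_cell)
        show "diameter (U i) \<le> \<delta>"
        proof (cases "i \<in> g ` V")
          case True
          then obtain w where w: "w \<in> V" "i = g w" by blast
          have "2 powr (- real (fst w)) = (2 powr (- (s * real (fst w)))) powr (1 / s)"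
            using s by (simp add: powr_powr)
          also have "\<dots> \<le> ((\<delta> / (2 * n)) powr s) powr (1 / s)"
            using small[OF w(1)] s by (intro powr_mono2) (auto simp: e_def)
          also have "\<dots> = \<delta> / (2 * n)" using s \<delta> n by (simp add: powr_powr)
          finally have "2 * n * 2 powr (- real (fst w)) \<le> \<delta>" using n by (simp add: field_simps)
          then show ?thesis using dw[of w] Ug[OF w(1)] w(2) by simp
        next
          case False
          then show ?thesis using \<delta> by (simp add: U_def)
        qed
      qed
      also have "\<dots> = (\<integral>\<^sup>+i. diam_pow s (U i) \<partial>count_space UNIV)"
        by (rule nn_integral_count_space_nat[symmetric])
      also have "\<dots> = (\<integral>\<^sup>+i. diam_pow s (U i) * indicator (g ` V) i \<partial>count_space UNIV)"
        by (intro nn_integral_cong) (auto simp: U_def diam_pow_def indicator_def)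
      also have "\<dots> = (\<integral>\<^sup>+i. diam_pow s (U i) \<partial>count_space (g ` V))"
        by (subst nn_integral_count_space_indicator) auto
      also have "\<dots> = (\<integral>\<^sup>+w. diam_pow s (U (g w)) \<partial>count_space V)"
        unfolding g_def
        by (intro nn_integral_bij_count_space[symmetric] bij_betw_imageI[OF inj_on_to_nat_on[OF cV] refl])
      also have "\<dots> \<le> (\<integral>\<^sup>+w. ennreal ((2 * n) powr s) * ennreal (2 powr (- (s * real (fst w)))) \<partial>count_space V)"
        using Ug diam_le by (intro nn_integral_mono) simp
      also have "\<dots> = ennreal ((2 * n) powr s) * weight s V"
        unfolding weight_def by (subst nn_integral_cmult) (auto simp: nn_integral_count_space_indicator)
      also have "\<dots> \<le> ennreal ((2 * n) powr s) * ennreal e" by (intro mult_left_mono wV) simp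
      also have "\<dots> = ennreal ((2 * n) powr s * e)" using e by (simp add: ennreal_mult)
      also have "\<dots> \<le> ennreal \<epsilon>"
      proof (intro ennreal_leI)
        have "(2 * n) powr s * e \<le> (2 * n) powr s * (\<epsilon> / (2 * n) powr s)"
          by (intro mult_left_mono) (auto simp: e_def)
        then show "(2 * n) powr s * e \<le> \<epsilon>" using n by simp
      qed
      finally show ?thesis by simp
    qed
    note * = this
    have "hausdorff_premeasure s \<delta> A \<le> 0" by (rule ennreal_le_epsilon) (rule *)
    then show ?thesis by simp
  qed
  then show ?thesis unfolding hausdorff_measure_def by simp
qed

text \<open>Countable subadditivity over the unit cubes, obtained from finite subadditivity and
  continuity along increasing unions. It lets Frostman's lemma work inside one cube.\<close>

lemma net_content_unit_cells:
  fixes A :: "'a::euclidean_space set"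
  assumes "\<And>q. net_content s {x \<in> A. corner 0 x = q} = 0"
  shows "net_content s A = 0"
proof -
  define e where "e = from_nat_into (range (corner 0 :: 'a \<Rightarrow> 'a))"
  have re: "range e = range (corner 0)"
    unfolding e_def by (rule range_from_nat_into) (auto simp: countable_range_corner)
  define B where "B = (\<lambda>N. \<Union>i<N. {x \<in> A. corner 0 x = e i})"
  have "x \<in> (\<Union>N. B N)" if "x \<in> A" for x
  proof -
    obtain i where "corner 0 x = e i" using re by (metis imageE rangeI)
    then have "x \<in> B (Suc i)" using that by (auto simp: B_def)
    then show ?thesis by blast
  qed
  then have "A = (\<Union>N. B N)" by (auto simp: B_def)
  moreover have "incseq B" by (fastforce simp: B_def incseq_def)
  ultimately have "net_content s A = (SUP N. net_content s (B N))" using net_content_incseq by metis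
  moreover have "net_content s (B N) = 0" for N
    using net_content_UN[of "{..<N}" s "\<lambda>i. {x \<in> A. corner 0 x = e i}"] assms by (simp add: B_def)
  ultimately show ?thesis by simp
qed

theorem frostman:
  fixes A :: "'a::euclidean_space set"
  assumes A: "A \<in> sets borel" "A \<noteq> {}" and s: "s = 0 \<or> (0 < s \<and> hausdorff_measure s A \<noteq> 0)"
  obtains \<mu> :: "'a measure" and K C where "prob_space \<mu>" "sets \<mu> = sets borel" "compact K" "K \<subseteq> A" "emeasure \<mu> K = 1"
    "\<And>x r. 0 < r \<Longrightarrow> measure \<mu> (cball x r) \<le> C * r powr s"
proof (cases "s = 0")
  \<comment> \<open>For exponent 0 the ball condition only asks for total mass 1, since
    \<open>r powr 0 = 1\<close> for positive \<open>r\<close>, and a point mass does.\<close>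
  case True
  obtain a where a: "a \<in> A" using A by blast
  interpret prob_space "return borel a" by (rule prob_space_return) simp
  show thesis
  proof
    show "prob_space (return borel a)" by (rule prob_space_return) simp
    show "compact {a}" "{a} \<subseteq> A" "emeasure (return borel a) {a} = 1" using a by auto
    show "measure (return borel a) (cball x r) \<le> 1 * r powr s" if "0 < r" for x r
      using that True by simp
  qed simp
next
  case False
  then have s: "0 < s" "hausdorff_measure s A \<noteq> 0" using s by auto
  then have "net_content s A \<noteq> 0" using hausdorff_measure_eq_0_of_net_content by blast
  then obtain q where q: "net_content s {x \<in> A. corner 0 x = q} \<noteq> 0" using net_content_unit_cells by blast
  \<comment> \<open>One unit cube gives the tree a single root, and it makes the intersection of
    closures bounded, hence compact.\<close>
  define B where "B = {x \<in> A. corner 0 x = q}"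
  have "B = A \<inter> corner 0 -` {q}" by (auto simp: B_def)
  moreover have "corner 0 -` {q} \<in> sets (borel :: 'a measure)"
    using measurable_sets[OF corner_measurable[of 0], of "{q}"] by simp
  ultimately have "B \<in> sets borel" using A by auto
  then have susB: "suslin B" by (rule suslin_borel)
  have "0 < net_content s B" using q by (simp add: B_def zero_less_iff_neq_zero)
  then obtain c' where c': "0 < c'" "c' < net_content s B" using dense by blast
  then obtain c where c: "c' = ennreal c" "0 < c"
    by (cases c') auto
  obtain S where S: "decseq S" "\<And>k. S k \<subseteq> B" "\<And>k. c' < net_content s (S k)" "(\<Inter>k. closure (S k)) \<subseteq> B"
    using suslin_capacity_selection[OF susB net_content_incseq c'(2)] by metis
  have "corner 0 x = q" if "x \<in> S 0" for x using S(2)[of 0] that by (auto simp: B_def)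
  moreover have "ennreal c \<le> net_content s (S j)" for j using S(3)[of j] c by simp
  ultimately obtain \<mu> C where \<mu>: "prob_space \<mu>" "sets \<mu> = sets borel" "emeasure \<mu> (\<Inter>j. closure (S j)) = 1"
    "\<And>x r. 0 < r \<Longrightarrow> measure \<mu> (cball x r) \<le> C * r powr s"
    using frostman_decseq[OF S(1) _ c(2), of q s] s(1) by (metis less_imp_le)
  have "bounded (\<Inter>k. closure (S k))"
    using bounded_subset[OF bounded_cell[of 0 q], of "\<Inter>k. closure (S k)"] S(4) by (auto simp: B_def)
  then have "compact (\<Inter>k. closure (S k))" by (simp add: compact_eq_bounded_closed closed_INT)
  moreover have "(\<Inter>k. closure (S k)) \<subseteq> A" using S(4) by (auto simp: B_def)
  ultimately show thesis using that \<mu> by blast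
qed

subsection \<open>Gaussians and quadratic forms in the Fourier transform\<close>

definition phase :: "real \<Rightarrow> complex" where
  "phase \<theta> = cis (- (2 * pi * \<theta>))"

text \<open>Normalised so that \<open>gauss 1\<close> is its own Fourier transform; the transform of
  \<open>gauss R\<close> in dimension d is R^d times \<open>gauss 1\<close> dilated by
  \<open>R\<close>.\<close>

definition gauss :: "real \<Rightarrow> 'a::real_normed_vector \<Rightarrow> real" where
  "gauss R x = exp (- (pi * (norm x / R)\<^sup>2))"

lemma norm_phase [simp]: "norm (phase \<theta>) = 1"
  by (simp add: phase_def)

lemma phase_add: "phase (a + b) = phase a * phase b"
  by (simp add: phase_def cis_mult distrib_left)

lemma phase_diff: "phase (a - b) = phase a * phase (- b)"
  using phase_add[of a "- b"] by simp

lemma cnj_phase: "cnj (phase a) = phase (- a)"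
  by (simp add: phase_def cis_cnj)

lemma phase_0: "phase 0 = 1"
  by (simp add: phase_def)

lemma phase_sum: "finite I \<Longrightarrow> phase (\<Sum>i\<in>I. f i) = (\<Prod>i\<in>I. phase (f i))"
  by (induction I rule: finite_induct) (auto simp: phase_add phase_0)

lemma phase_measurable [measurable]: "phase \<in> borel_measurable borel"
  unfolding phase_def[abs_def]
  by (intro borel_measurable_continuous_onI continuous_intros)

lemma gauss_measurable [measurable]: "gauss R \<in> borel_measurable borel"
  unfolding gauss_def[abs_def] by measurable

lemma gauss_pos: "0 < gauss R x" and gauss_nonneg [simp]: "0 \<le> gauss R x" and gauss_le_1: "gauss R x \<le> 1"
  by (auto simp: gauss_def)

lemma cnj_measurable [measurable]: "cnj \<in> borel_measurable borel"
  by (intro borel_measurable_continuous_onI continuous_intros)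

lemma gauss_ge:
  assumes "norm x \<le> R" "0 < R"
  shows "exp (- pi) \<le> gauss R x"
proof -
  have "(norm x / R)\<^sup>2 \<le> 1\<^sup>2" using assms by (intro power_mono) auto
  then show ?thesis by (simp add: gauss_def)
qed

lemma fourier_transform_phase: "fourier_transform \<mu> \<xi> = (\<integral>x. phase (\<xi> \<bullet> x) \<partial>\<mu>)"
  unfolding fourier_transform_def phase_def cis_conv_exp by (simp add: mult_ac)

text \<open>The substitution by \<open>c\<close> turns the Gaussian into the standard normal
  density, whose characteristic function is known; \<open>s\<close> is the frequency that
  corresponds to \<open>z\<close> after this change of variable.\<close>

lemma gauss_fourier_real:
  fixes R z :: real
  assumes R: "0 < R"
  shows "integrable lborel (\<lambda>t::real. complex_of_real (gauss R t) * phase (t * z))"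
    and "(\<integral>t. complex_of_real (gauss R t) * phase (t * z) \<partial>lborel) = complex_of_real (R * gauss 1 (R * z))"
proof -
  define c where "c = sqrt (2 * pi) / R"
  have c: "0 < c" using R by (simp add: c_def)
  define s where "s = - (sqrt (2 * pi) * z * R)"
  define g where "g = (\<lambda>x. complex_of_real (std_normal_density x) * cis (s * x))"
  have gc: "g (0 + c * u) = complex_of_real (1 / sqrt (2 * pi)) * (complex_of_real (gauss R u) * phase (u * z))" for u
  proof -
    have "- (c * u)\<^sup>2 / 2 = - (pi * (norm u / R)\<^sup>2)"
      by (simp add: c_def power_mult_distrib power_divide)
    then have 1: "std_normal_density (c * u) = 1 / sqrt (2 * pi) * gauss R u"
      by (simp add: std_normal_density_def gauss_def)
    have "s * (c * u) = - ((sqrt (2 * pi) * sqrt (2 * pi)) * (u * z))"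
      using R by (simp add: s_def c_def)
    then have 2: "cis (s * (c * u)) = phase (u * z)" by (simp add: phase_def mult_ac)
    show ?thesis unfolding g_def using 1 2 by simp
  qed
  have ig: "integrable lborel g"
    unfolding g_def
    by (rule Bochner_Integration.integrable_bound[OF integrable_normal_density[of 1 0]])
      (auto simp: norm_mult cis_conv_exp)
  have "integrable lborel (\<lambda>u. g (0 + c * u))" 
    using c by (intro lborel_integrable_real_affine[OF ig]) simp
  then have "integrable lborel (\<lambda>u. complex_of_real (sqrt (2 * pi)) * g (0 + c * u))"
    by (intro integrable_mult_right)
  moreover have "complex_of_real (sqrt (2 * pi)) * g (0 + c * u) = complex_of_real (gauss R u) * phase (u * z)" for u
    unfolding gc by simp
  ultimately show "integrable lborel (\<lambda>t::real. complex_of_real (gauss R t) * phase (t * z))" by simp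
  have "integral\<^sup>L lborel g = complex_of_real (exp (- s\<^sup>2 / 2))"
  proof -
    have "char std_normal_distribution s = (\<integral>x. std_normal_density x *\<^sub>R iexp (s * x) \<partial>lborel)"
      unfolding char_def by (subst integral_density) (auto simp: normal_density_nonneg)
    then show ?thesis
      unfolding g_def char_std_normal_distribution by (simp add: scaleR_conv_of_real cis_conv_exp)
  qed
  moreover have "integral\<^sup>L lborel g = \<bar>c\<bar> *\<^sub>R (\<integral>u. g (0 + c * u) \<partial>lborel)"
    using c by (intro lborel_integral_real_affine) simp
  moreover have "(\<integral>u. g (0 + c * u) \<partial>lborel) = complex_of_real (1 / sqrt (2 * pi)) * (\<integral>t. complex_of_real (gauss R t) * phase (t * z) \<partial>lborel)"
    unfolding gc by (rule integral_mult_right_zero)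
  moreover have "exp (- s\<^sup>2 / 2) = gauss 1 (R * z)"
    by (simp add: s_def gauss_def power_mult_distrib mult_ac)
  ultimately have "complex_of_real (gauss 1 (R * z)) =
      complex_of_real (c / sqrt (2 * pi)) * (\<integral>t. complex_of_real (gauss R t) * phase (t * z) \<partial>lborel)"
    using c by (simp add: scaleR_conv_of_real)
  moreover have "c / sqrt (2 * pi) = 1 / R" by (simp add: c_def)
  ultimately show "(\<integral>t. complex_of_real (gauss R t) * phase (t * z) \<partial>lborel) = complex_of_real (R * gauss 1 (R * z))"
    using R by simp
qed

lemma gauss_prod:
  fixes f :: "'a::euclidean_space \<Rightarrow> real"
  shows "gauss R (\<Sum>b\<in>Basis. f b *\<^sub>R b :: 'a) = (\<Prod>b\<in>Basis. gauss R (f b))"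
proof -
  define x :: 'a where "x = (\<Sum>b\<in>Basis. f b *\<^sub>R b)"
  have "(norm x)\<^sup>2 = (\<Sum>b\<in>Basis. (x \<bullet> b)\<^sup>2)"
    unfolding power2_norm_eq_inner euclidean_inner[of x x] by (simp add: power2_eq_square)
  also have "\<dots> = (\<Sum>b\<in>Basis. (f b)\<^sup>2)" by (simp add: x_def)
  finally show ?thesis
    unfolding x_def[symmetric]
    by (simp add: gauss_def exp_sum[symmetric] power_divide sum_distrib_left sum_divide_distrib sum_negf)
qed

lemma gauss_prod_inner: "gauss R x = (\<Prod>b\<in>Basis. gauss R (x \<bullet> b))"
  using gauss_prod[of R "\<lambda>b. x \<bullet> b"] by (simp add: euclidean_representation)

lemma gauss_fourier:
  fixes z :: "'a::euclidean_space"
  assumes R: "0 < R"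
  shows "integrable lborel (\<lambda>\<xi>::'a. complex_of_real (gauss R \<xi>) * phase (\<xi> \<bullet> z))"
    and "(\<integral>\<xi>. complex_of_real (gauss R \<xi>) * phase (\<xi> \<bullet> z) \<partial>lborel)
      = complex_of_real (R ^ DIM('a) * gauss 1 (R *\<^sub>R z))"
proof -
  define h where "h = (\<lambda>(b::'a) t. complex_of_real (gauss R t) * phase (t * (z \<bullet> b)))"
  define G where "G = (\<lambda>\<xi>::'a. complex_of_real (gauss R \<xi>) * phase (\<xi> \<bullet> z))"
  interpret product_sigma_finite "\<lambda>_::'a. lborel :: real measure" ..
  have hG: "G (\<Sum>b\<in>Basis. f b *\<^sub>R b) = (\<Prod>b\<in>Basis. h b (f b))" for f
  proof -
    have "(\<Sum>b\<in>Basis. f b *\<^sub>R b) \<bullet> z = (\<Sum>b\<in>Basis. f b * (z \<bullet> b))"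
      by (subst inner_commute) (simp add: inner_sum_right)
    then show ?thesis
      unfolding G_def h_def gauss_prod by (simp add: phase_sum prod.distrib)
  qed
  have mG: "G \<in> borel_measurable borel" unfolding G_def by measurable
  have ih: "integrable lborel (h b)" for b unfolding h_def by (rule gauss_fourier_real(1)[OF R])
  have mf: "(\<lambda>f. \<Sum>b\<in>Basis. f b *\<^sub>R b) \<in> measurable (\<Pi>\<^sub>M b\<in>Basis. lborel) (borel :: 'a measure)" by measurable
  show "integrable lborel (\<lambda>\<xi>::'a. complex_of_real (gauss R \<xi>) * phase (\<xi> \<bullet> z))"
    unfolding G_def[symmetric] lborel_eq[where 'a = 'a] integrable_distr_eq[OF mf mG] hG
    by (intro product_integrable_prod ih) simp
  have "(\<integral>\<xi>. G \<xi> \<partial>lborel) = (\<integral>f. (\<Prod>b\<in>Basis. h b (f b)) \<partial>(\<Pi>\<^sub>M b\<in>(Basis::'a set). lborel))"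
    unfolding lborel_eq[where 'a = 'a] integral_distr[OF mf mG] hG ..
  also have "\<dots> = (\<Prod>b\<in>Basis. integral\<^sup>L lborel (h b))"
    by (intro product_integral_prod ih) simp
  also have "\<dots> = (\<Prod>b\<in>(Basis::'a set). complex_of_real (R * gauss 1 (R * (z \<bullet> b))))"
    unfolding h_def by (intro prod.cong refl gauss_fourier_real(2) R)
  also have "\<dots> = complex_of_real (R ^ DIM('a) * (\<Prod>b\<in>Basis. gauss 1 ((R *\<^sub>R z) \<bullet> b)))"
    by (simp add: prod.distrib)
  finally show "(\<integral>\<xi>. complex_of_real (gauss R \<xi>) * phase (\<xi> \<bullet> z) \<partial>lborel)
      = complex_of_real (R ^ DIM('a) * gauss 1 (R *\<^sub>R z))"
    unfolding gauss_prod_inner[of 1 "R *\<^sub>R z"] G_def .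
qed

lemma integrable_gauss:
  assumes "0 < R"
  shows "integrable lborel (gauss R :: 'a::euclidean_space \<Rightarrow> real)"
  using gauss_fourier(1)[OF assms, of "0::'a"] by (simp add: phase_def complex_of_real_integrable_eq)

lemma (in pair_sigma_finite) integral_times:
  fixes f :: "'a \<Rightarrow> complex" and g :: "'b \<Rightarrow> complex"
  assumes "integrable (M1 \<Otimes>\<^sub>M M2) (\<lambda>p. f (fst p) * g (snd p))"
  shows "(\<integral>p. f (fst p) * g (snd p) \<partial>(M1 \<Otimes>\<^sub>M M2)) = integral\<^sup>L M1 f * integral\<^sup>L M2 g"
  using integral_fst'[OF assms] by simp

text \<open>The squared modulus is expanded into a double integral over \<open>\<rho>\<close>, and
  the frequency integral is carried out first; the Gaussian makes Fubini's theorem applicable. The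
  map \<open>\<phi>\<close> is left free because the identity is needed in dimension 1 for
  \<open>\<mu>\<close> and in dimension d for \<open>\<nu>\<close> and
  \<open>\<kappa>\<close>.\<close>

lemma gauss_form:
  fixes \<phi> :: "'b \<Rightarrow> 'a::euclidean_space" and \<eta> :: "'b \<Rightarrow> complex"
  assumes \<rho>: "finite_measure \<rho>" and R: "0 < R"
    and [measurable]: "\<phi> \<in> borel_measurable \<rho>" "\<eta> \<in> borel_measurable \<rho>"
    and B: "\<And>\<omega>. norm (\<eta> \<omega>) \<le> B"
  defines "T \<equiv> \<lambda>\<xi>. \<integral>\<omega>. \<eta> \<omega> * phase (\<xi> \<bullet> \<phi> \<omega>) \<partial>\<rho>"
  shows gauss_form_integrable: "integrable lborel (\<lambda>\<xi>. gauss R \<xi> * (norm (T \<xi>))\<^sup>2)"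
    and gauss_form_eq: "complex_of_real (\<integral>\<xi>. gauss R \<xi> * (norm (T \<xi>))\<^sup>2 \<partial>lborel) =
      (\<integral>p. \<eta> (fst p) * cnj (\<eta> (snd p)) * complex_of_real (R ^ DIM('a) * gauss 1 (R *\<^sub>R (\<phi> (fst p) - \<phi> (snd p)))) \<partial>(\<rho> \<Otimes>\<^sub>M \<rho>))"
proof -
  interpret finite_measure \<rho> by fact
  interpret \<rho>\<rho>: finite_measure "\<rho> \<Otimes>\<^sub>M \<rho>" by (rule finite_measure_pair_measure) fact+
  interpret P: pair_sigma_finite \<rho> \<rho> ..
  interpret Q: pair_sigma_finite lborel "\<rho> \<Otimes>\<^sub>M \<rho>" ..
  have B0: "0 \<le> B" using order_trans[OF norm_ge_zero B] .
  have mT [measurable]: "T \<in> borel_measurable borel"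
    unfolding T_def by measurable
  define F where "F = (\<lambda>\<xi> p. complex_of_real (gauss R \<xi>) * (\<eta> (fst p) * cnj (\<eta> (snd p)) * phase (\<xi> \<bullet> (\<phi> (fst p) - \<phi> (snd p)))))"
  have mF [measurable]: "(\<lambda>(\<xi>, p). F \<xi> p) \<in> borel_measurable (lborel \<Otimes>\<^sub>M (\<rho> \<Otimes>\<^sub>M \<rho>))"
    
    unfolding F_def split_beta' by measurable
  have nF: "norm (F \<xi> p) = gauss R \<xi> * (norm (\<eta> (fst p)) * norm (\<eta> (snd p)))" for \<xi> p
    using less_imp_le[OF gauss_pos[of R \<xi>]] by (simp add: F_def norm_mult)
  have bnd: "norm (\<eta> (fst p)) * norm (\<eta> (snd p)) \<le> B * B" for p
    by (intro mult_mono B B0) simp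
  have i\<eta>: "integrable (\<rho> \<Otimes>\<^sub>M \<rho>) (\<lambda>p. norm (\<eta> (fst p)) * norm (\<eta> (snd p)))"
    by (rule \<rho>\<rho>.integrable_const_bound[where B = "B * B"]) (auto simp: bnd abs_mult)
  have iF: "integrable (lborel \<Otimes>\<^sub>M (\<rho> \<Otimes>\<^sub>M \<rho>)) (\<lambda>(\<xi>, p). F \<xi> p)"
  proof (rule Q.Fubini_integrable[OF mF])
    show "integrable lborel (\<lambda>\<xi>. \<integral>p. norm (case (\<xi>, p) of (\<xi>, p) \<Rightarrow> F \<xi> p) \<partial>(\<rho> \<Otimes>\<^sub>M \<rho>))"
      unfolding prod.case nF by (simp add: integrable_gauss[OF R])
    show "AE \<xi> in lborel. integrable (\<rho> \<Otimes>\<^sub>M \<rho>) (\<lambda>p. case (\<xi>, p) of (\<xi>, p) \<Rightarrow> F \<xi> p)"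
    proof (intro AE_I2)
      fix \<xi> :: 'a
      have "integrable (\<rho> \<Otimes>\<^sub>M \<rho>) (\<lambda>p. gauss R \<xi> * (norm (\<eta> (fst p)) * norm (\<eta> (snd p))))"
        using i\<eta> by simp
      then have "integrable (\<rho> \<Otimes>\<^sub>M \<rho>) (\<lambda>p. norm (F \<xi> p))" unfolding nF .
      then show "integrable (\<rho> \<Otimes>\<^sub>M \<rho>) (\<lambda>p. case (\<xi>, p) of (\<xi>, p) \<Rightarrow> F \<xi> p)"
        unfolding prod.case by (subst (asm) integrable_norm_iff) (auto simp: F_def)
    qed
  qed
  have TT: "(\<integral>p. F \<xi> p \<partial>(\<rho> \<Otimes>\<^sub>M \<rho>)) = complex_of_real (gauss R \<xi> * (norm (T \<xi>))\<^sup>2)" for \<xi>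
  proof -
    define f where "f = (\<lambda>\<omega>. \<eta> \<omega> * phase (\<xi> \<bullet> \<phi> \<omega>))"
    define g where "g = (\<lambda>\<omega>. cnj (f \<omega>))"
    have mfg [measurable]: "f \<in> borel_measurable \<rho>" "g \<in> borel_measurable \<rho>"
      unfolding f_def g_def by measurable
    have nf: "norm (f \<omega>) = norm (\<eta> \<omega>)" "norm (g \<omega>) = norm (\<eta> \<omega>)" for \<omega> by (simp_all add: f_def g_def norm_mult)
    have "F \<xi> p = complex_of_real (gauss R \<xi>) * (f (fst p) * g (snd p))" for p
      by (simp add: F_def f_def g_def cnj_phase inner_diff_right phase_diff)
    then have "(\<integral>p. F \<xi> p \<partial>(\<rho> \<Otimes>\<^sub>M \<rho>)) = complex_of_real (gauss R \<xi>) * (\<integral>p. f (fst p) * g (snd p) \<partial>(\<rho> \<Otimes>\<^sub>M \<rho>))"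
      by simp
    also have "(\<integral>p. f (fst p) * g (snd p) \<partial>(\<rho> \<Otimes>\<^sub>M \<rho>)) = integral\<^sup>L \<rho> f * integral\<^sup>L \<rho> g"
      by (rule P.integral_times, rule \<rho>\<rho>.integrable_const_bound[where B = "B * B"])
        (auto simp: norm_mult nf bnd)
    also have "integral\<^sup>L \<rho> g = cnj (integral\<^sup>L \<rho> f)" 
      unfolding g_def by simp
    also have "integral\<^sup>L \<rho> f = T \<xi>" by (simp add: f_def T_def)
    finally show ?thesis by (simp only: of_real_mult complex_norm_square)
  qed
  have iT: "integrable lborel (\<lambda>\<xi>. complex_of_real (gauss R \<xi> * (norm (T \<xi>))\<^sup>2))"
    using Q.integrable_fst'[OF iF] unfolding prod.case TT .
  then show "integrable lborel (\<lambda>\<xi>. gauss R \<xi> * (norm (T \<xi>))\<^sup>2)"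
    by (simp only: complex_of_real_integrable_eq)
  have "complex_of_real (\<integral>\<xi>. gauss R \<xi> * (norm (T \<xi>))\<^sup>2 \<partial>lborel) = (\<integral>\<xi>. (\<integral>p. F \<xi> p \<partial>(\<rho> \<Otimes>\<^sub>M \<rho>)) \<partial>lborel)"
    unfolding TT by (rule integral_complex_of_real[symmetric])
  also have "\<dots> = (\<integral>p. (\<integral>\<xi>. F \<xi> p \<partial>lborel) \<partial>(\<rho> \<Otimes>\<^sub>M \<rho>))"
    by (rule Q.Fubini_integral[OF iF, symmetric])
  also have "\<dots> = (\<integral>p. \<eta> (fst p) * cnj (\<eta> (snd p)) * complex_of_real (R ^ DIM('a) * gauss 1 (R *\<^sub>R (\<phi> (fst p) - \<phi> (snd p)))) \<partial>(\<rho> \<Otimes>\<^sub>M \<rho>))"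
  proof (rule Bochner_Integration.integral_cong[OF refl])
    fix p
    have "(\<integral>\<xi>. F \<xi> p \<partial>lborel) = (\<integral>\<xi>. \<eta> (fst p) * cnj (\<eta> (snd p)) * (complex_of_real (gauss R \<xi>) * phase (\<xi> \<bullet> (\<phi> (fst p) - \<phi> (snd p)))) \<partial>lborel)"
      unfolding F_def by (simp add: mult_ac)
    then show "(\<integral>\<xi>. F \<xi> p \<partial>lborel) = \<eta> (fst p) * cnj (\<eta> (snd p)) * complex_of_real (R ^ DIM('a) * gauss 1 (R *\<^sub>R (\<phi> (fst p) - \<phi> (snd p))))"
      unfolding gauss_fourier(2)[OF R, symmetric] by simp
  qed
  finally show "complex_of_real (\<integral>\<xi>. gauss R \<xi> * (norm (T \<xi>))\<^sup>2 \<partial>lborel) =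
      (\<integral>p. \<eta> (fst p) * cnj (\<eta> (snd p)) * complex_of_real (R ^ DIM('a) * gauss 1 (R *\<^sub>R (\<phi> (fst p) - \<phi> (snd p)))) \<partial>(\<rho> \<Otimes>\<^sub>M \<rho>))" .
qed

text \<open>The kernel of the quadratic form is a non-negative Gaussian, so the weights may be
  replaced by their absolute values. What remains is a count of pairs at distance about 1 / R under
  \<open>\<phi>\<close>.\<close>

lemma nn_gauss_form_le:
  fixes \<phi> :: "'b \<Rightarrow> 'a::euclidean_space" and \<eta> :: "'b \<Rightarrow> complex"
  assumes \<rho>: "finite_measure \<rho>" and R: "0 < R"
    and m [measurable]: "\<phi> \<in> borel_measurable \<rho>" "\<eta> \<in> borel_measurable \<rho>"
    and B: "\<And>\<omega>. norm (\<eta> \<omega>) \<le> B"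
  shows "(\<integral>\<^sup>+\<xi>. ennreal (gauss R \<xi> * (norm (\<integral>\<omega>. \<eta> \<omega> * phase (\<xi> \<bullet> \<phi> \<omega>) \<partial>\<rho>))\<^sup>2) \<partial>lborel)
    \<le> (\<integral>\<^sup>+\<omega>. (\<integral>\<^sup>+\<omega>'. ennreal (norm (\<eta> \<omega>) * norm (\<eta> \<omega>') * (R ^ DIM('a) * gauss 1 (R *\<^sub>R (\<phi> \<omega> - \<phi> \<omega>')))) \<partial>\<rho>) \<partial>\<rho>)"
    (is "?L \<le> ?R")
proof -
  interpret finite_measure \<rho> by fact
  interpret \<rho>\<rho>: finite_measure "\<rho> \<Otimes>\<^sub>M \<rho>" by (rule finite_measure_pair_measure) fact+
  interpret P: pair_sigma_finite \<rho> \<rho> ..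
  have B0: "0 \<le> B" using order_trans[OF norm_ge_zero B] .
  define I where "I = (\<integral>\<xi>. gauss R \<xi> * (norm (\<integral>\<omega>. \<eta> \<omega> * phase (\<xi> \<bullet> \<phi> \<omega>) \<partial>\<rho>))\<^sup>2 \<partial>lborel)"
  define K where "K = (\<lambda>p. norm (\<eta> (fst p)) * norm (\<eta> (snd p)) * (R ^ DIM('a) * gauss 1 (R *\<^sub>R (\<phi> (fst p) - \<phi> (snd p)))))"
  have K0: "0 \<le> K p" for p unfolding K_def using R gauss_pos less_imp_le by (intro mult_nonneg_nonneg) auto
  have mK [measurable]: "K \<in> borel_measurable (\<rho> \<Otimes>\<^sub>M \<rho>)" unfolding K_def by measurable
  have iK: "integrable (\<rho> \<Otimes>\<^sub>M \<rho>) K"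
  proof (rule \<rho>\<rho>.integrable_const_bound[where B = "B * B * (R ^ DIM('a) * 1)"])
    have "K p \<le> B * B * (R ^ DIM('a) * 1)" for p
      unfolding K_def using R B B0
      by (intro mult_mono mult_nonneg_nonneg gauss_le_1) auto
    then show "AE p in \<rho> \<Otimes>\<^sub>M \<rho>. norm (K p) \<le> B * B * (R ^ DIM('a) * 1)" using K0 by simp
  qed simp
  have "?L = ennreal I"
    unfolding I_def using gauss_form_integrable[OF \<rho> R m B] gauss_pos less_imp_le
    by (intro nn_integral_eq_integral) (auto intro!: AE_I2 mult_nonneg_nonneg)
  also have "I \<le> integral\<^sup>L (\<rho> \<Otimes>\<^sub>M \<rho>) K"
  proof -
    have "I \<le> norm (complex_of_real I)" by simp
    also have "\<dots> \<le> (\<integral>p. norm (\<eta> (fst p) * cnj (\<eta> (snd p)) * complex_of_real (R ^ DIM('a) * gauss 1 (R *\<^sub>R (\<phi> (fst p) - \<phi> (snd p))))) \<partial>(\<rho> \<Otimes>\<^sub>M \<rho>))"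
      unfolding I_def gauss_form_eq[OF \<rho> R m B] by (rule integral_norm_bound)
    also have "\<dots> = integral\<^sup>L (\<rho> \<Otimes>\<^sub>M \<rho>) K"
      using R gauss_pos[THEN less_imp_le] by (intro Bochner_Integration.integral_cong) (auto simp: K_def norm_mult norm_power abs_mult)
    finally show ?thesis .
  qed
  then have "ennreal I \<le> ennreal (integral\<^sup>L (\<rho> \<Otimes>\<^sub>M \<rho>) K)" by (rule ennreal_leI)
  also have "\<dots> = (\<integral>\<^sup>+p. ennreal (K p) \<partial>(\<rho> \<Otimes>\<^sub>M \<rho>))"
    using iK K0 by (intro nn_integral_eq_integral[symmetric]) auto
  also have "\<dots> = ?R"
    by (subst nn_integral_fst[symmetric]) (auto simp: K_def)
  finally show ?thesis .
qed

text \<open>With constant weight the quadratic form is an exact identity between mass near the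
  diagonal and a Gaussian average of the transform. It carries Sobolev energy back to physical
  space.\<close>

lemma gauss_form_prob:
  fixes \<kappa> :: "'a::euclidean_space measure"
  assumes "prob_space \<kappa>" "sets \<kappa> = sets borel" and R: "0 < R"
  shows "(\<integral>\<^sup>+x. (\<integral>\<^sup>+y. ennreal (gauss 1 (R *\<^sub>R (x - y))) \<partial>\<kappa>) \<partial>\<kappa>)
    = ennreal (1 / R ^ DIM('a)) * (\<integral>\<^sup>+\<xi>. ennreal (gauss R \<xi> * (norm (fourier_transform \<kappa> \<xi>))\<^sup>2) \<partial>lborel)"
proof -
  interpret prob_space \<kappa> by fact
  interpret \<rho>\<rho>: finite_measure "\<kappa> \<Otimes>\<^sub>M \<kappa>" 
    by (intro finite_measure_pair_measure finite_measure_axioms)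
  have [measurable_cong]: "sets \<kappa> = sets borel" by fact
  have FT: "fourier_transform \<kappa> \<xi> = (\<integral>x. 1 * phase (\<xi> \<bullet> x) \<partial>\<kappa>)" for \<xi>
    by (simp add: fourier_transform_phase)
  define I where "I = (\<integral>\<xi>. gauss R \<xi> * (norm (fourier_transform \<kappa> \<xi>))\<^sup>2 \<partial>lborel)"
  define K where "K = (\<lambda>p :: 'a \<times> 'a. gauss 1 (R *\<^sub>R (fst p - snd p)))"
  have fin: "finite_measure \<kappa>" by (rule finite_measure_axioms)
  have m: "(\<lambda>x. x) \<in> borel_measurable \<kappa>" "(\<lambda>x. 1 :: complex) \<in> borel_measurable \<kappa>" by measurable
  note form = gauss_form_integrable[OF fin R m, of 1] gauss_form_eq[OF fin R m, of 1]
  have mK [measurable]: "K \<in> borel_measurable (\<kappa> \<Otimes>\<^sub>M \<kappa>)" unfolding K_def by measurable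
  have iK: "integrable (\<kappa> \<Otimes>\<^sub>M \<kappa>) K"
    by (rule \<rho>\<rho>.integrable_const_bound[where B = 1])
      (auto simp: K_def gauss_le_1 less_imp_le[OF gauss_pos])
  have "complex_of_real I = complex_of_real (R ^ DIM('a) * integral\<^sup>L (\<kappa> \<Otimes>\<^sub>M \<kappa>) K)"
    using form(2) unfolding I_def FT K_def by simp
  then have I: "I = R ^ DIM('a) * integral\<^sup>L (\<kappa> \<Otimes>\<^sub>M \<kappa>) K" by (simp only: of_real_eq_iff)
  have "(\<integral>\<^sup>+\<xi>. ennreal (gauss R \<xi> * (norm (fourier_transform \<kappa> \<xi>))\<^sup>2) \<partial>lborel) = ennreal I"
    unfolding I_def using form(1) unfolding FT
    by (intro nn_integral_eq_integral) (auto intro!: AE_I2 mult_nonneg_nonneg less_imp_le[OF gauss_pos])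
  moreover have "(\<integral>\<^sup>+x. (\<integral>\<^sup>+y. ennreal (gauss 1 (R *\<^sub>R (x - y))) \<partial>\<kappa>) \<partial>\<kappa>) = ennreal (integral\<^sup>L (\<kappa> \<Otimes>\<^sub>M \<kappa>) K)"
  proof -
    have "(\<integral>\<^sup>+p. ennreal (K p) \<partial>(\<kappa> \<Otimes>\<^sub>M \<kappa>)) = ennreal (integral\<^sup>L (\<kappa> \<Otimes>\<^sub>M \<kappa>) K)"
      using iK by (intro nn_integral_eq_integral) (auto simp: K_def less_imp_le[OF gauss_pos])
    then show ?thesis by (subst (asm) nn_integral_fst[symmetric]) (auto simp: K_def)
  qed
  ultimately show ?thesis
    using R by (simp add: I flip: ennreal_mult')
qed

section \<open>Gaussian integrals by layers, and the mass of slabs\<close>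

definition gauss_moment :: "nat \<Rightarrow> real" where
  "gauss_moment q = (\<Sum>j. (real j + 1) ^ q * exp (- (pi * (real j)\<^sup>2)))"

text \<open>Since (j + 1)^q is at most q! exp (j + 1) and pi j^2 is at least 3 j, the terms are
  dominated by a geometric series of ratio exp (- 2).\<close>

lemma gauss_moment_summable: "summable (\<lambda>j. (real j + 1) ^ q * exp (- (pi * (real j)\<^sup>2)))"
proof (rule summable_comparison_test')
  show "summable (\<lambda>j. (fact q * exp 1) * (exp (- 2) :: real) ^ j)"
    by (intro summable_mult summable_geometric) simp
  fix j :: nat
  have "(real j + 1) ^ q / fact q = (\<Sum>n\<in>{q}. (real j + 1) ^ n /\<^sub>R fact n)" by (simp add: divide_inverse mult.commute)
  also have "\<dots> \<le> (\<Sum>n. (real j + 1) ^ n /\<^sub>R fact n)"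
    by (intro sum_le_suminf summable_exp_generic) auto
  also have "\<dots> = exp (real j + 1)" by (simp add: exp_def)
  finally have 1: "(real j + 1) ^ q \<le> fact q * exp (real j + 1)" by (simp add: field_simps)
  have "3 * real j \<le> pi * (real j)\<^sup>2"
  proof -
    have "real j \<le> (real j)\<^sup>2" by (cases j) (simp_all add: power2_eq_square)
    moreover have "3 * (real j)\<^sup>2 \<le> pi * (real j)\<^sup>2" using pi_gt3 by (intro mult_right_mono) auto
    ultimately show ?thesis by linarith
  qed
  then have 2: "exp (- (pi * (real j)\<^sup>2)) \<le> exp (- 3 * real j)" by simp
  have "(real j + 1) ^ q * exp (- (pi * (real j)\<^sup>2)) \<le> (fact q * exp (real j + 1)) * exp (- 3 * real j)"
    by (rule mult_mono[OF 1 2]) auto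
  also have "\<dots> = fact q * exp 1 * exp (- 2) ^ j"
    by (simp add: exp_add[symmetric] exp_of_nat_mult[symmetric] mult.assoc)
  finally show "norm ((real j + 1) ^ q * exp (- (pi * (real j)\<^sup>2))) \<le> fact q * exp 1 * exp (- 2) ^ j"
    by simp
qed

lemma gauss_moment_nonneg: "0 \<le> gauss_moment q"
  unfolding gauss_moment_def by (rule suminf_nonneg[OF gauss_moment_summable]) (intro mult_nonneg_nonneg zero_le_power; simp)

text \<open>On the layer where \<open>u\<close> has integer part \<open>j\<close> the Gaussian is at
  most exp (- pi j^2). Replacing the layer by the larger sublevel set
  \<open>u x \<le> real j + 1\<close> costs nothing that matters, since its mass grows only
  polynomially in \<open>j\<close>.\<close>

lemma nn_integral_gauss_layers:
  assumes u [measurable]: "u \<in> borel_measurable M" and X [measurable]: "X \<in> sets M"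
    and u0: "\<And>x. 0 \<le> u x" and A: "0 \<le> A"
    and le: "\<And>j::nat. emeasure M {x \<in> space M. x \<in> X \<and> u x \<le> real j + 1} \<le> ennreal (A * (real j + 1) ^ q)"
  shows "(\<integral>\<^sup>+x. ennreal (exp (- (pi * (u x)\<^sup>2))) * indicator X x \<partial>M) \<le> ennreal (A * gauss_moment q)"
proof -
  define Y where "Y = (\<lambda>j::nat. {x \<in> space M. x \<in> X \<and> u x \<le> real j + 1})"
  have Y [measurable]: "Y j \<in> sets M" for j unfolding Y_def by measurable
  have "(\<integral>\<^sup>+x. ennreal (exp (- (pi * (u x)\<^sup>2))) * indicator X x \<partial>M)
      \<le> (\<integral>\<^sup>+x. (\<Sum>j. ennreal (exp (- (pi * (real j)\<^sup>2))) * indicator (Y j) x) \<partial>M)"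
  proof (rule nn_integral_mono)
    fix x assume x: "x \<in> space M"
    show "ennreal (exp (- (pi * (u x)\<^sup>2))) * indicator X x
        \<le> (\<Sum>j. ennreal (exp (- (pi * (real j)\<^sup>2))) * indicator (Y j) x)"
    proof (cases "x \<in> X")
      case True
      define j where "j = nat \<lfloor>u x\<rfloor>"
      have j: "real j \<le> u x" "u x \<le> real j + 1"
        using u0[of x] real_of_int_floor_add_one_ge[of "u x"] by (auto simp: j_def)
      have "(real j)\<^sup>2 \<le> (u x)\<^sup>2" using j by (intro power_mono) auto
      then have "ennreal (exp (- (pi * (u x)\<^sup>2))) \<le> ennreal (exp (- (pi * (real j)\<^sup>2)))"
        by (intro ennreal_leI) simp
      also have "\<dots> = (\<Sum>i\<in>{j}. ennreal (exp (- (pi * (real i)\<^sup>2))) * indicator (Y i) x)"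
        using True j x by (simp add: Y_def)
      also have "\<dots> \<le> (\<Sum>j. ennreal (exp (- (pi * (real j)\<^sup>2))) * indicator (Y j) x)"
        by (rule sum_le_suminf) auto
      finally show ?thesis using True by simp
    qed simp
  qed
  also have "\<dots> = (\<Sum>j. ennreal (exp (- (pi * (real j)\<^sup>2))) * emeasure M (Y j))"
    by (subst nn_integral_suminf) (auto simp: nn_integral_cmult)
  also have "\<dots> \<le> (\<Sum>j. ennreal (A * ((real j + 1) ^ q * exp (- (pi * (real j)\<^sup>2)))))"
  proof (intro suminf_le)
    fix j
    have "ennreal (exp (- (pi * (real j)\<^sup>2))) * emeasure M (Y j)
        \<le> ennreal (exp (- (pi * (real j)\<^sup>2))) * ennreal (A * (real j + 1) ^ q)"
      unfolding Y_def by (intro mult_left_mono le) simp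
    also have "\<dots> = ennreal (A * ((real j + 1) ^ q * exp (- (pi * (real j)\<^sup>2))))"
      using A by (subst ennreal_mult'[symmetric]) (auto simp: mult_ac)
    finally show "ennreal (exp (- (pi * (real j)\<^sup>2))) * emeasure M (Y j)
        \<le> ennreal (A * ((real j + 1) ^ q * exp (- (pi * (real j)\<^sup>2))))" .
  qed auto
  also have "\<dots> = ennreal (\<Sum>j. A * ((real j + 1) ^ q * exp (- (pi * (real j)\<^sup>2))))"
    using A by (intro suminf_ennreal2 summable_mult gauss_moment_summable) auto
  also have "(\<Sum>j. A * ((real j + 1) ^ q * exp (- (pi * (real j)\<^sup>2)))) = A * gauss_moment q"
    unfolding gauss_moment_def by (rule suminf_mult[OF gauss_moment_summable])
  finally show ?thesis .
qed

text \<open>The slab is translated along \<open>e\<close> by all amounts in [0, 1] and the volumes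
  are averaged. By Fubini's theorem each line in direction \<open>e\<close> contributes at most 2 w,
  and no rotation of coordinates is needed; the translations enlarge the radius by 1.\<close>

lemma emeasure_lborel_slab_le:
  fixes e :: "'a::euclidean_space"
  assumes e: "norm e = 1" and w: "0 \<le> w"
  shows "emeasure lborel {y \<in> cball 0 M. \<bar>e \<bullet> y - c\<bar> \<le> w} \<le> ennreal (2 * w) * emeasure lborel (cball (0::'a) (M + 1))"
proof -
  define S where "S = {y \<in> cball 0 M. \<bar>e \<bullet> y - c\<bar> \<le> w}"
  have "closed S"
    unfolding S_def mem_cball_0 by (intro closed_Collect_conj closed_Collect_le continuous_intros)
  then have S [measurable]: "S \<in> sets borel" by simp
  have "emeasure lborel S = (\<integral>\<^sup>+\<tau>. indicator {0..1::real} \<tau> * emeasure lborel S \<partial>lborel)"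
    by (subst nn_integral_multc) auto
  also have "\<dots> = (\<integral>\<^sup>+\<tau>. (\<integral>\<^sup>+y. indicator {0..1} \<tau> * indicator S (y - \<tau> *\<^sub>R e) \<partial>lborel) \<partial>lborel)"
  proof (intro nn_integral_cong)
    fix \<tau> :: real
    have "(\<integral>\<^sup>+y. indicator S (y - \<tau> *\<^sub>R e) \<partial>lborel) = (\<integral>\<^sup>+y. indicator S y \<partial>distr lborel borel ((+) (- \<tau> *\<^sub>R e)))"
      by (subst nn_integral_distr) (auto simp: algebra_simps)
    also have "\<dots> = emeasure lborel S" by (simp add: lborel_distr_plus)
    finally show "indicator {0..1} \<tau> * emeasure lborel S = (\<integral>\<^sup>+y. indicator {0..1} \<tau> * indicator S (y - \<tau> *\<^sub>R e) \<partial>lborel)"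
      by (subst nn_integral_cmult) auto
  qed
  also have "\<dots> = (\<integral>\<^sup>+y. (\<integral>\<^sup>+\<tau>. indicator {0..1} \<tau> * indicator S (y - \<tau> *\<^sub>R e) \<partial>lborel) \<partial>lborel)"
    by (rule lborel_pair.Fubini') measurable
  also have "\<dots> \<le> (\<integral>\<^sup>+y. ennreal (2 * w) * indicator (cball (0::'a) (M + 1)) y \<partial>lborel)"
  proof (rule nn_integral_mono)
    fix y :: 'a
    show "(\<integral>\<^sup>+\<tau>. indicator {0..1} \<tau> * indicator S (y - \<tau> *\<^sub>R e) \<partial>lborel) \<le> ennreal (2 * w) * indicator (cball (0::'a) (M + 1)) y"
    proof (cases "y \<in> cball 0 (M + 1)")
      case True
      have "(\<integral>\<^sup>+\<tau>. indicator {0..1} \<tau> * indicator S (y - \<tau> *\<^sub>R e) \<partial>lborel)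
          \<le> (\<integral>\<^sup>+\<tau>. indicator {e \<bullet> y - c - w..e \<bullet> y - c + w} \<tau> \<partial>lborel)"
      proof (intro nn_integral_mono)
        fix \<tau> :: real
        have "e \<bullet> (y - \<tau> *\<^sub>R e) = e \<bullet> y - \<tau>"
          using e by (simp add: inner_diff_right norm_eq_1)
        then show "indicator {0..1} \<tau> * indicator S (y - \<tau> *\<^sub>R e) \<le> (indicator {e \<bullet> y - c - w..e \<bullet> y - c + w} \<tau> :: ennreal)"
          by (auto simp: indicator_def S_def)
      qed
      also have "\<dots> = ennreal (2 * w)" using w by simp
      finally show ?thesis using True by simp
    next
      case False
      have "indicator {0..1} \<tau> * indicator S (y - \<tau> *\<^sub>R e) = (0::ennreal)" for \<tau> :: real
      proof -
        have "norm y \<le> norm (y - \<tau> *\<^sub>R e) + norm (\<tau> *\<^sub>R e)"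
          using norm_triangle_ineq[of "y - \<tau> *\<^sub>R e" "\<tau> *\<^sub>R e"] by simp
        then show ?thesis using False e by (auto simp: indicator_def S_def)
      qed
      then show ?thesis by (simp only: nn_integral_const mult_zero_left zero_le)
    qed
  qed
  also have "\<dots> = ennreal (2 * w) * emeasure lborel (cball (0::'a) (M + 1))"
    by (rule nn_integral_cmult_indicator) simp
  finally show ?thesis unfolding S_def .
qed

text \<open>
  A slab of width \<open>w\<close> in a bounded region is covered by \<open>\<lesssim> w \<delta> powr (- d)\<close> balls of radius \<open>\<delta>\<close>;
  averaging \<open>\<mu>\<close> over balls replaces the covering.
\<close>

lemma frostman_slab_le:
  fixes \<mu> :: "'a::euclidean_space measure"
  assumes \<mu>: "finite_measure \<mu>" "sets \<mu> = sets borel"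
    and fr: "\<And>x r. 0 < r \<Longrightarrow> measure \<mu> (cball x r) \<le> C * r powr s"
    and e: "norm e = 1" and w: "0 \<le> w" and \<delta>: "0 < \<delta>" "\<delta> \<le> 2" and C: "0 \<le> C"
  shows "measure \<mu> {x \<in> cball 0 M. \<bar>e \<bullet> x - c\<bar> \<le> w}
    \<le> 2 * C * measure lborel (cball (0::'a) (M + 3)) / unit_ball_vol (real DIM('a)) * (w + \<delta>) * \<delta> powr (s - real DIM('a))"
proof -
  interpret finite_measure \<mu> by fact
  have [measurable_cong]: "sets \<mu> = sets borel" by fact
  define V where "V = measure lborel (cball (0::'a) (M + 3))"
  have V0: "0 \<le> V" by (simp add: V_def)
  define S where "S = {x \<in> cball 0 M. \<bar>e \<bullet> x - c\<bar> \<le> w}"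
  have "closed S"
    unfolding S_def mem_cball_0 by (intro closed_Collect_conj closed_Collect_le continuous_intros)
  then have S [measurable]: "S \<in> sets borel" by simp
  \<comment> \<open>The fattened slab contains every point within \<open>\<delta>\<close> of
    \<open>S\<close>; the radius grows by 2 because \<open>\<delta> \<le> 2\<close>. The volume
    bound for slabs adds the third unit seen in M + 3.\<close>
  define S' where "S' = {y \<in> cball 0 (M + 2). \<bar>e \<bullet> y - c\<bar> \<le> w + \<delta>}"
  have "closed S'"
    unfolding S'_def mem_cball_0 by (intro closed_Collect_conj closed_Collect_le continuous_intros)
  then have S' [measurable]: "S' \<in> sets borel" by simp
  interpret P: pair_sigma_finite \<mu> "lborel :: 'a measure" ..
  have eV: "emeasure lborel (cball (0::'a) (M + 3)) = ennreal V"
    using emeasure_compact_finite[OF compact_cball[of "0::'a" "M + 3"]] unfolding V_def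
    by (intro emeasure_eq_ennreal_measure) auto
  have "emeasure \<mu> S * ennreal (unit_ball_vol (real DIM('a)) * \<delta> ^ DIM('a))
      = (\<integral>\<^sup>+x. indicator S x * emeasure lborel (cball x \<delta>) \<partial>\<mu>)"
    using \<delta> by (simp add: emeasure_cball nn_integral_multc)
  also have "\<dots> = (\<integral>\<^sup>+x. (\<integral>\<^sup>+y. indicator S x * indicator {p. dist (fst p) (snd p) \<le> \<delta>} (x, y) \<partial>lborel) \<partial>\<mu>)"
  proof (intro nn_integral_cong)
    fix x :: 'a
    have "(\<integral>\<^sup>+y. indicator {p. dist (fst p) (snd p) \<le> \<delta>} (x, y) \<partial>lborel) = (\<integral>\<^sup>+y. indicator (cball x \<delta>) y \<partial>lborel)"
      by (intro nn_integral_cong) (auto simp: indicator_def)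
    then have "emeasure lborel (cball x \<delta>) = (\<integral>\<^sup>+y. indicator {p. dist (fst p) (snd p) \<le> \<delta>} (x, y) \<partial>lborel)" by simp
    then show "indicator S x * emeasure lborel (cball x \<delta>) = (\<integral>\<^sup>+y. indicator S x * indicator {p. dist (fst p) (snd p) \<le> \<delta>} (x, y) \<partial>lborel)"
      by (subst nn_integral_cmult) (auto, measurable)
  qed
  also have "\<dots> = (\<integral>\<^sup>+y. (\<integral>\<^sup>+x. indicator S x * indicator {p. dist (fst p) (snd p) \<le> \<delta>} (x, y) \<partial>\<mu>) \<partial>lborel)"
    by (rule P.Fubini'[symmetric]) measurable
  also have "\<dots> \<le> (\<integral>\<^sup>+y. ennreal (C * \<delta> powr s) * indicator S' y \<partial>lborel)"
  proof (rule nn_integral_mono)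
    fix y :: 'a
    show "(\<integral>\<^sup>+x. indicator S x * indicator {p. dist (fst p) (snd p) \<le> \<delta>} (x, y) \<partial>\<mu>) \<le> ennreal (C * \<delta> powr s) * indicator S' y"
    proof (cases "y \<in> S'")
      case True
      have "(\<integral>\<^sup>+x. indicator S x * indicator {p. dist (fst p) (snd p) \<le> \<delta>} (x, y) \<partial>\<mu>) \<le> (\<integral>\<^sup>+x. indicator (cball y \<delta>) x \<partial>\<mu>)"
        by (intro nn_integral_mono) (auto simp: indicator_def dist_commute)
      also have "\<dots> = ennreal (measure \<mu> (cball y \<delta>))" by (simp add: emeasure_eq_measure)
      also have "\<dots> \<le> ennreal (C * \<delta> powr s)" by (intro ennreal_leI fr \<delta>)
      finally show ?thesis using True by simp
    next
      case False
      have "indicator S x * indicator {p. dist (fst p) (snd p) \<le> \<delta>} (x, y) = (0::ennreal)" for x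
      proof (rule ccontr)
        assume "\<not> ?thesis"
        then have x: "x \<in> S" "dist x y \<le> \<delta>" by (auto simp: indicator_def split: if_splits)
        have "\<bar>e \<bullet> (x - y)\<bar> \<le> norm e * norm (x - y)" by (rule Cauchy_Schwarz_ineq2)
        then have "\<bar>e \<bullet> x - e \<bullet> y\<bar> \<le> \<delta>" using x e by (simp add: inner_diff_right dist_norm)
        moreover have "norm y \<le> norm x + dist x y" by (metis dist_norm norm_minus_commute norm_triangle_sub)
        ultimately have "y \<in> S'" using x \<delta> by (auto simp: S_def S'_def)
        then show False using False by simp
      qed
      then show ?thesis by (simp only: nn_integral_const mult_zero_left zero_le)
    qed
  qed
  also have "\<dots> = ennreal (C * \<delta> powr s) * emeasure lborel S'"
    by (rule nn_integral_cmult_indicator) simp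
  also have "\<dots> \<le> ennreal (C * \<delta> powr s) * (ennreal (2 * (w + \<delta>)) * ennreal V)"
    using emeasure_lborel_slab_le[OF e, of "w + \<delta>" "M + 2" c] w \<delta> unfolding S'_def eV[symmetric]
    by (intro mult_left_mono) (auto simp: add.assoc)
  also have "\<dots> = ennreal (C * \<delta> powr s * (2 * (w + \<delta>) * V))"
    using w \<delta> C V0 by (simp add: ennreal_mult mult.assoc del: mult_2 distrib_left_numeral)
  finally have "ennreal (measure \<mu> S * (unit_ball_vol (real DIM('a)) * \<delta> ^ DIM('a))) \<le> ennreal (C * \<delta> powr s * (2 * (w + \<delta>) * V))"
    by (simp only: emeasure_eq_measure ennreal_mult'[OF measure_nonneg])
  then have "measure \<mu> S * (unit_ball_vol (real DIM('a)) * \<delta> ^ DIM('a)) \<le> C * \<delta> powr s * (2 * (w + \<delta>) * V)"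
    using w \<delta> C by (subst (asm) ennreal_le_iff) (auto simp: V_def)
  moreover have "0 < unit_ball_vol (real DIM('a)) * \<delta> ^ DIM('a)" using \<delta> by simp
  ultimately have "measure \<mu> S \<le> C * \<delta> powr s * (2 * (w + \<delta>) * V) / (unit_ball_vol (real DIM('a)) * \<delta> ^ DIM('a))"
    by (simp add: pos_le_divide_eq)
  also have "\<dots> = 2 * C * V / unit_ball_vol (real DIM('a)) * (w + \<delta>) * \<delta> powr (s - real DIM('a))"
    using \<delta> by (simp add: powr_diff powr_realpow field_simps)
  finally show ?thesis unfolding S_def V_def .
qed

subsection \<open>The Fourier transform of the measure on similar copies\<close>

locale frostman_pair =
  fixes \<mu> :: "'a::euclidean_space measure" and \<nu> :: "('a \<times> real) measure" and s t C M :: real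
  assumes \<mu>_prob: "prob_space \<mu>" and \<mu>_sets [measurable_cong]: "sets \<mu> = sets borel"
    and \<nu>_prob: "prob_space \<nu>" and \<nu>_sets: "sets \<nu> = sets borel"
    and \<mu>_frostman: "\<And>x r. 0 < r \<Longrightarrow> measure \<mu> (cball x r) \<le> C * r powr s"
    and \<nu>_frostman: "\<And>p r. 0 < r \<Longrightarrow> measure \<nu> (cball p r) \<le> C * r powr t"
    and \<mu>_bounded: "AE x in \<mu>. norm x \<le> M"
    and \<nu>_bounded: "AE p in \<nu>. \<bar>snd p\<bar> \<le> M"
    and M: "1 \<le> M" and t: "0 \<le> t" and C: "0 \<le> C"
begin

lemma \<nu>_sets' [measurable_cong]: "sets \<nu> = sets (borel \<Otimes>\<^sub>M borel)"
  unfolding borel_prod by (rule \<nu>_sets)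

sublocale \<mu>: prob_space \<mu> by (rule \<mu>_prob)
sublocale \<nu>: prob_space \<nu> by (rule \<nu>_prob)
sublocale \<nu>\<mu>: pair_prob_space \<nu> \<mu> ..
sublocale \<nu>\<nu>: pair_prob_space \<nu> \<nu> ..

definition \<kappa> :: "'a measure" where
  "\<kappa> = distr (\<nu> \<Otimes>\<^sub>M \<mu>) borel (\<lambda>(p, x). snd p *\<^sub>R x + fst p)"

lemma \<kappa>_prob: "prob_space \<kappa>"
  unfolding \<kappa>_def by (rule \<nu>\<mu>.prob_space_distr) measurable

lemma \<kappa>_sets: "sets \<kappa> = sets borel"
  by (simp add: \<kappa>_def)

lemma fourier_transform_\<kappa>:
  "fourier_transform \<kappa> \<xi> = (\<integral>(p, x). phase (\<xi> \<bullet> fst p) * phase (snd p * (\<xi> \<bullet> x)) \<partial>(\<nu> \<Otimes>\<^sub>M \<mu>))"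
  unfolding fourier_transform_phase \<kappa>_def
  by (subst integral_distr)
    (auto intro!: Bochner_Integration.integral_cong simp: inner_add_right add.commute split_beta' phase_add)

definition D\<mu> :: real where
  "D\<mu> = 2 * (2 * C * measure lborel (cball (0::'a) (M + 3)) / unit_ball_vol (real DIM('a))) * gauss_moment 1"

lemma D\<mu>_nonneg: "0 \<le> D\<mu>"
  unfolding D\<mu>_def using C by (simp add: gauss_moment_nonneg)

text \<open>In the direction of \<open>\<xi>\<close> layer \<open>j\<close> is a slab of width (j +
  1) / |\<xi>|, and the slab bound is applied with balls of radius 1 / |\<xi>|; the assumption on
  \<open>norm \<xi>\<close> keeps this radius at most 2. The slab mass is linear in
  \<open>j\<close>, hence \<open>gauss_moment 1\<close>.\<close>

lemma \<mu>_gauss_le: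
  assumes \<xi>: "1 / 2 \<le> norm \<xi>"
  shows "(\<integral>\<^sup>+x'. ennreal (gauss 1 (\<xi> \<bullet> x - \<xi> \<bullet> x')) \<partial>\<mu>) \<le> ennreal (D\<mu> * norm \<xi> powr (real DIM('a) - 1 - s))"
proof -
  define N where "N = norm \<xi>"
  have N: "1 / 2 \<le> N" "0 < N" using \<xi> by (auto simp: N_def)
  define K where "K = 2 * C * measure lborel (cball (0::'a) (M + 3)) / unit_ball_vol (real DIM('a))"
  have K: "0 \<le> K" using C by (simp add: K_def)
  define e where "e = \<xi> /\<^sub>R N"
  have e: "norm e = 1" using N by (simp add: e_def N_def)
  have "(\<integral>\<^sup>+x'. ennreal (gauss 1 (\<xi> \<bullet> x - \<xi> \<bullet> x')) \<partial>\<mu>)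
      = (\<integral>\<^sup>+x'. ennreal (exp (- (pi * \<bar>\<xi> \<bullet> x - \<xi> \<bullet> x'\<bar>\<^sup>2))) * indicator (cball 0 M) x' \<partial>\<mu>)"
    by (rule nn_integral_cong_AE) (use \<mu>_bounded in \<open>auto simp: gauss_def\<close>)
  also have "\<dots> \<le> ennreal (2 * K * N powr (real DIM('a) - 1 - s) * gauss_moment 1)"
  proof (rule nn_integral_gauss_layers)
    fix j :: nat
    have "{x' \<in> space \<mu>. x' \<in> cball 0 M \<and> \<bar>\<xi> \<bullet> x - \<xi> \<bullet> x'\<bar> \<le> real j + 1}
        = {x' \<in> cball 0 M. \<bar>e \<bullet> x' - e \<bullet> x\<bar> \<le> (real j + 1) / N}"
    proof -
      have "\<bar>e \<bullet> x' - e \<bullet> x\<bar> = \<bar>\<xi> \<bullet> x - \<xi> \<bullet> x'\<bar> / N" for x'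
      proof -
        have "e \<bullet> x' - e \<bullet> x = (\<xi> \<bullet> x' - \<xi> \<bullet> x) / N"
          by (simp add: e_def right_diff_distrib divide_inverse mult.commute)
        then show ?thesis using N by (simp add: abs_minus_commute)
      qed
      moreover have "space \<mu> = UNIV" using sets_eq_imp_space_eq[OF \<mu>_sets] by simp
      ultimately show ?thesis using N by (auto simp: divide_right_mono divide_le_cancel)
    qed
    moreover have "measure \<mu> {x' \<in> cball 0 M. \<bar>e \<bullet> x' - e \<bullet> x\<bar> \<le> (real j + 1) / N}
        \<le> K * ((real j + 1) / N + 1 / N) * (1 / N) powr (s - real DIM('a))"
      unfolding K_def using N by (intro frostman_slab_le[OF \<mu>.finite_measure_axioms \<mu>_sets \<mu>_frostman e]) (auto simp: C field_simps)
    moreover have "\<dots> \<le> 2 * K * N powr (real DIM('a) - 1 - s) * (real j + 1) ^ 1"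
    proof -
      have "(1 / N) powr (s - real DIM('a)) = N powr (real DIM('a) - s)"
        using N by (simp add: powr_divide powr_minus_divide[symmetric] flip: powr_minus)
      moreover have "N powr (real DIM('a) - 1 - s) = N powr (real DIM('a) - s) / N"
        using N powr_diff[of N "real DIM('a) - s" 1] by (simp add: algebra_simps)
      moreover have "(real j + 1) / N + 1 / N \<le> 2 * (real j + 1) / N"
        using N by (simp add: field_simps)
      then have "K * ((real j + 1) / N + 1 / N) * N powr (real DIM('a) - s) \<le> K * (2 * (real j + 1) / N) * N powr (real DIM('a) - s)"
        using K by (intro mult_left_mono mult_right_mono) auto
      ultimately show ?thesis by (simp add: field_simps)
    qed
    ultimately show "emeasure \<mu> {x' \<in> space \<mu>. x' \<in> cball 0 M \<and> \<bar>\<xi> \<bullet> x - \<xi> \<bullet> x'\<bar> \<le> real j + 1}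
        \<le> ennreal (2 * K * N powr (real DIM('a) - 1 - s) * (real j + 1) ^ 1)"
      unfolding \<mu>.emeasure_eq_measure by (intro ennreal_leI) simp
  qed (use K in \<open>auto, measurable\<close>)
  also have "2 * K * N powr (real DIM('a) - 1 - s) * gauss_moment 1 = D\<mu> * norm \<xi> powr (real DIM('a) - 1 - s)"
    by (simp add: D\<mu>_def K_def N_def)
  finally show ?thesis .
qed

definition D\<nu> :: real where
  "D\<nu> = C * 2 powr t * gauss_moment (nat \<lceil>t\<rceil>)"

lemma D\<nu>_nonneg: "0 \<le> D\<nu>"
  unfolding D\<nu>_def using C by (simp add: gauss_moment_nonneg)

text \<open>The Gaussian controls the distance of the centres and the indicator that of the ratios,
  so layer \<open>j\<close> lies in a ball of radius 2 (j + 1) / R around \<open>p\<close>. The real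
  exponent \<open>t\<close> is rounded up to fit \<open>gauss_moment\<close>.\<close>

lemma \<nu>_gauss_le:
  assumes R: "0 < R"
  shows "(\<integral>\<^sup>+p'. ennreal (gauss 1 (R *\<^sub>R (fst p - fst p'))) * indicator {p'. \<bar>snd p - snd p'\<bar> \<le> 1 / R} p' \<partial>\<nu>)
    \<le> ennreal (D\<nu> * R powr (- t))"
proof -
  have "(\<integral>\<^sup>+p'. ennreal (gauss 1 (R *\<^sub>R (fst p - fst p'))) * indicator {p'. \<bar>snd p - snd p'\<bar> \<le> 1 / R} p' \<partial>\<nu>)
      = (\<integral>\<^sup>+p'. ennreal (exp (- (pi * (R * norm (fst p - fst p'))\<^sup>2))) * indicator {p'. \<bar>snd p - snd p'\<bar> \<le> 1 / R} p' \<partial>\<nu>)"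
    using R by (simp add: gauss_def)
  also have "\<dots> \<le> ennreal (C * 2 powr t * R powr (- t) * gauss_moment (nat \<lceil>t\<rceil>))"
  proof (rule nn_integral_gauss_layers)
    fix j :: nat
    define r where "r = 2 * (real j + 1) / R"
    have r: "0 < r" using R by (simp add: r_def)
    have "{p' \<in> space \<nu>. p' \<in> {p'. \<bar>snd p - snd p'\<bar> \<le> 1 / R} \<and> R * norm (fst p - fst p') \<le> real j + 1} \<subseteq> cball p r"
    proof
      fix p' assume "p' \<in> {p' \<in> space \<nu>. p' \<in> {p'. \<bar>snd p - snd p'\<bar> \<le> 1 / R} \<and> R * norm (fst p - fst p') \<le> real j + 1}"
      then have "\<bar>snd p - snd p'\<bar> \<le> 1 / R" "norm (fst p - fst p') \<le> (real j + 1) / R"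
        using R by (auto simp: field_simps)
      moreover have "dist p p' \<le> norm (fst p - fst p') + \<bar>snd p - snd p'\<bar>"
        using norm_Pair_le[of "fst p - fst p'" "snd p - snd p'"] by (simp add: dist_norm minus_prod_def)
      moreover have "(real j + 1) / R + 1 / R \<le> r" using R by (simp add: r_def field_simps)
      ultimately show "p' \<in> cball p r" by simp
    qed
    then have "measure \<nu> {p' \<in> space \<nu>. p' \<in> {p'. \<bar>snd p - snd p'\<bar> \<le> 1 / R} \<and> R * norm (fst p - fst p') \<le> real j + 1} \<le> measure \<nu> (cball p r)"
      by (intro \<nu>.finite_measure_mono) (auto simp: \<nu>_sets)
    also have "\<dots> \<le> C * r powr t" by (rule \<nu>_frostman[OF r])
    also have "r powr t = 2 powr t * R powr (- t) * (real j + 1) powr t"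
    proof -
      have "(2 * (real j + 1)) powr t = 2 powr t * (real j + 1) powr t" by (rule powr_mult)
      then show ?thesis unfolding r_def using R by (subst powr_divide) (auto simp: powr_minus_divide)
    qed
    also have "C * (2 powr t * R powr (- t) * (real j + 1) powr t) \<le> C * (2 powr t * R powr (- t) * (real j + 1) ^ nat \<lceil>t\<rceil>)"
    proof -
      have "(real j + 1) powr t \<le> (real j + 1) powr real (nat \<lceil>t\<rceil>)"
        using t by (intro powr_mono) (auto simp: real_nat_ceiling_ge)
      also have "\<dots> = (real j + 1) ^ nat \<lceil>t\<rceil>" by (rule powr_realpow) simp
      finally show ?thesis using C by (intro mult_left_mono) auto
    qed
    finally show "emeasure \<nu> {p' \<in> space \<nu>. p' \<in> {p'. \<bar>snd p - snd p'\<bar> \<le> 1 / R} \<and> R * norm (fst p - fst p') \<le> real j + 1}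
        \<le> ennreal (C * 2 powr t * R powr (- t) * (real j + 1) ^ nat \<lceil>t\<rceil>)"
      unfolding \<nu>.emeasure_eq_measure by (intro ennreal_leI) (simp add: mult.assoc)
  next
    have "closed {p'. \<bar>snd p - snd p'\<bar> \<le> 1 / R}" by (intro closed_Collect_le continuous_intros)
    then show "{p'. \<bar>snd p - snd p'\<bar> \<le> 1 / R} \<in> sets \<nu>" unfolding \<nu>_sets by (rule borel_closed)
    show "(\<lambda>p'. R * norm (fst p - fst p')) \<in> borel_measurable \<nu>" by measurable
  qed (use R C in auto)
  also have "C * 2 powr t * R powr (- t) * gauss_moment (nat \<lceil>t\<rceil>) = D\<nu> * R powr (- t)"
    by (simp add: D\<nu>_def)
  finally show ?thesis .
qed


text \<open>Lebesgue measure on an interval one unit longer at each end than the range of the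
  ratios, so that a window of half-width at most 1 around any ratio is not truncated. Its finiteness
  justifies the later uses of Fubini's theorem.\<close>

definition \<zeta> :: "real measure" where
  "\<zeta> = density lborel (\<lambda>r. ennreal (indicator {-(M + 1)..M + 1} r))"

lemma \<zeta>_sets [simp, measurable_cong]: "sets \<zeta> = sets borel" and \<zeta>_space [simp]: "space \<zeta> = UNIV"
  by (simp_all add: \<zeta>_def)

lemma \<zeta>_finite: "finite_measure \<zeta>"
proof (rule finite_measureI)
  have "emeasure \<zeta> (space \<zeta>) = emeasure lborel {-(M + 1)..M + 1}"
    unfolding \<zeta>_def by (subst emeasure_density) (auto simp: ennreal_indicator)
  then show "emeasure \<zeta> (space \<zeta>) \<noteq> \<infinity>" by (simp add: emeasure_lborel_Icc_eq)
qed

section \<open>Averaging over the ratio at a fixed frequency scale\<close>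

context
  fixes R :: real
  assumes R: "1 \<le> R"
begin

text \<open>The half-width of the averaging window. The 8 keeps the phase of the window below an
  eighth of a turn for all frequencies up to R * M, and it also keeps the full width within 1 /
  R.\<close>

definition \<tau> :: real where "\<tau> = 1 / (8 * M * R)"

lemma \<tau>: "0 < \<tau>" "2 * \<tau> \<le> 1 / R" "\<tau> \<le> 1"
proof -
  have MR: "1 \<le> M * R" using M R mult_mono[of 1 M 1 R] by simp
  show "0 < \<tau>" using MR by (simp add: \<tau>_def mult.assoc)
  have "2 * \<tau> = 1 / (4 * M) * (1 / R)" using M R by (simp add: \<tau>_def)
  also have "\<dots> \<le> 1 * (1 / R)" using M R by (intro mult_right_mono) auto
  finally show "2 * \<tau> \<le> 1 / R" by simp
  show "\<tau> \<le> 1" using MR by (simp add: \<tau>_def divide_le_eq mult.assoc)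
qed

text \<open>The Fourier transform of the window: averaging over ratios near \<open>\<rho>\<close>
  multiplies \<open>phase (\<rho> * \<theta>)\<close> by this factor, whatever \<open>\<rho>\<close>
  is.\<close>

definition S :: "real \<Rightarrow> complex" where
  "S \<theta> = (\<integral>v. complex_of_real (indicator {-\<tau>..\<tau>} v) * phase (v * \<theta>) \<partial>lborel)"

lemma S_measurable [measurable]: "S \<in> borel_measurable borel"
  unfolding S_def by measurable

lemma window_integrable: "integrable lborel (indicator {-\<tau>..\<tau>} :: real \<Rightarrow> real)"
  by (rule integrable_real_indicator) (auto simp: emeasure_lborel_Icc_eq)

lemma S_integrable: "integrable lborel (\<lambda>v. complex_of_real (indicator {-\<tau>..\<tau>} v) * phase (v * \<theta>))"
  by (rule Bochner_Integration.integrable_bound[OF window_integrable]) (auto simp: norm_mult)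

text \<open>Throughout the window the angle stays at most pi / 4, hence below pi / 3, so the
  integrand has real part at least 1 / 2. No cancellation occurs over the length
  \<open>2 * \<tau>\<close>.\<close>

lemma norm_S_ge:
  assumes "\<bar>\<theta>\<bar> \<le> R * M"
  shows "\<tau> \<le> norm (S \<theta>)"
proof -
  have "\<tau> = (\<integral>v. indicator {-\<tau>..\<tau>} v * (1 / 2) \<partial>lborel)" using \<tau> by simp
  also have "\<dots> \<le> (\<integral>v. Re (complex_of_real (indicator {-\<tau>..\<tau>} v) * phase (v * \<theta>)) \<partial>lborel)"
  proof (rule integral_mono)
    show "integrable lborel (\<lambda>v. indicator {-\<tau>..\<tau>} v * (1 / 2 :: real))"
      by (rule integrable_mult_left[OF window_integrable])
    show "integrable lborel (\<lambda>v. Re (complex_of_real (indicator {-\<tau>..\<tau>} v) * phase (v * \<theta>)))"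
      by (intro integrable_Re S_integrable)
    fix v :: real
    show "indicator {-\<tau>..\<tau>} v * (1 / 2) \<le> Re (complex_of_real (indicator {-\<tau>..\<tau>} v) * phase (v * \<theta>))"
    proof (cases "v \<in> {-\<tau>..\<tau>}")
      case True
      have "\<bar>v * \<theta>\<bar> \<le> \<tau> * (R * M)" unfolding abs_mult using True assms \<tau> by (intro mult_mono) auto
      also have "\<tau> * (R * M) = 1 / 8" using M R by (simp add: \<tau>_def)
      finally have "2 * pi * \<bar>v * \<theta>\<bar> \<le> 2 * pi * (1 / 8)" by (intro mult_left_mono) auto
      then have "2 * pi * \<bar>v * \<theta>\<bar> \<le> pi / 3" using pi_gt_zero by linarith
      then have "cos (pi / 3) \<le> cos (2 * pi * \<bar>v * \<theta>\<bar>)"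
        using pi_gt_zero by (intro cos_monotone_0_pi_le) auto
      also have "cos (2 * pi * \<bar>v * \<theta>\<bar>) = cos (- (2 * pi * (v * \<theta>)))"
        by (cases "0 \<le> v * \<theta>") (auto simp: abs_of_neg)
      finally show ?thesis using True by (simp add: phase_def cos_60)
    qed simp
  qed
  also have "\<dots> = Re (S \<theta>)" unfolding S_def by (rule integral_Re[OF S_integrable])
  also have "\<dots> \<le> norm (S \<theta>)" by (rule complex_Re_le_cmod)
  finally show ?thesis .
qed

text \<open>The reciprocal of the window factor, which undoes the averaging. The cut-off makes it
  bounded by \<open>1 / \<tau>\<close> everywhere; it is inactive for frequencies up to
  \<open>R\<close> and points of norm at most \<open>M\<close>.\<close>

definition \<eta> :: "'a \<Rightarrow> 'a \<Rightarrow> complex" where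
  "\<eta> \<xi> x = (if \<tau> \<le> norm (S (\<xi> \<bullet> x)) then 1 / S (\<xi> \<bullet> x) else 0)"

lemma \<eta>_measurable [measurable]: "(\<lambda>(\<xi>, x). \<eta> \<xi> x) \<in> borel_measurable (borel \<Otimes>\<^sub>M borel)"
  unfolding \<eta>_def split_beta' by measurable

lemma norm_\<eta>_le: "norm (\<eta> \<xi> x) \<le> 1 / \<tau>"
  using \<tau>(1) by (auto simp: \<eta>_def norm_divide intro!: frac_le)

lemma \<eta>_S: "norm \<xi> \<le> R \<Longrightarrow> norm x \<le> M \<Longrightarrow> \<eta> \<xi> x * S (\<xi> \<bullet> x) = 1"
proof -
  assume "norm \<xi> \<le> R" "norm x \<le> M"
  then have "\<bar>\<xi> \<bullet> x\<bar> \<le> R * M"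
    using Cauchy_Schwarz_ineq2[of \<xi> x] R by (meson mult_mono norm_ge_zero order_trans zero_le_one)
  then show ?thesis using norm_S_ge \<tau>(1) by (force simp: \<eta>_def)
qed

text \<open>The two factors after averaging at ratio \<open>r\<close>: \<open>m\<close> is a
  weighted transform of \<open>\<mu>\<close> at frequency \<open>r \<xi>\<close>, and
  \<open>H\<close> is the transform in the centre variable of the part of \<open>\<nu>\<close> with
  ratio in the window around \<open>r\<close>.\<close>

definition m :: "'a \<Rightarrow> real \<Rightarrow> complex" where
  "m \<xi> r = (\<integral>x. \<eta> \<xi> x * phase (r * (\<xi> \<bullet> x)) \<partial>\<mu>)"

definition H :: "'a \<Rightarrow> real \<Rightarrow> complex" where
  "H \<xi> r = (\<integral>p. complex_of_real (indicator {-\<tau>..\<tau>} (r - snd p)) * phase (\<xi> \<bullet> fst p) \<partial>\<nu>)"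

lemma m_measurable [measurable]: "(\<lambda>(\<xi>, r). m \<xi> r) \<in> borel_measurable (borel \<Otimes>\<^sub>M borel)"
  unfolding m_def split_beta' by measurable

lemma H_measurable [measurable]: "(\<lambda>(\<xi>, r). H \<xi> r) \<in> borel_measurable (borel \<Otimes>\<^sub>M borel)"
  unfolding H_def split_beta' by measurable

lemma integral_\<zeta>_window:
  assumes "\<bar>\<rho>\<bar> \<le> M"
  shows "(\<integral>r. complex_of_real (indicator {-\<tau>..\<tau>} (r - \<rho>)) * phase (r * \<theta>) \<partial>\<zeta>) = phase (\<rho> * \<theta>) * S \<theta>"
proof -
  have "(\<integral>r. complex_of_real (indicator {-\<tau>..\<tau>} (r - \<rho>)) * phase (r * \<theta>) \<partial>\<zeta>)
      = (\<integral>r. indicator {-(M + 1)..M + 1} r *\<^sub>R (complex_of_real (indicator {-\<tau>..\<tau>} (r - \<rho>)) * phase (r * \<theta>)) \<partial>lborel)"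
    unfolding \<zeta>_def by (subst integral_density) auto
  also have "\<dots> = (\<integral>r. complex_of_real (indicator {-\<tau>..\<tau>} (r - \<rho>)) * phase (r * \<theta>) \<partial>lborel)"
    using assms \<tau> by (intro Bochner_Integration.integral_cong) (auto simp: indicator_def)
  also have "\<dots> = (\<integral>v. complex_of_real (indicator {-\<tau>..\<tau>} v) * phase ((\<rho> + v) * \<theta>) \<partial>lborel)"
    by (subst lborel_integral_real_affine[where c = 1 and t = \<rho>]) auto
  also have "\<dots> = (\<integral>v. phase (\<rho> * \<theta>) * (complex_of_real (indicator {-\<tau>..\<tau>} v) * phase (v * \<theta>)) \<partial>lborel)"
  proof -
    have "phase ((\<rho> + v) * \<theta>) = phase (\<rho> * \<theta>) * phase (v * \<theta>)" for v
      by (simp add: distrib_right phase_add)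
    then show ?thesis by (simp only: mult.left_commute)
  qed
  also have "\<dots> = phase (\<rho> * \<theta>) * S \<theta>" unfolding S_def by (rule integral_mult_right_zero)
  finally show ?thesis .
qed

text \<open>The number 1 is inserted as \<open>\<eta> \<xi> x * S (\<xi> \<bullet> x)\<close>, and
  \<open>S\<close> times the phase is written as an integral over \<open>r\<close>. Exchanging the
  integrals, which is allowed for a bounded integrand on a finite measure, separates
  \<open>\<nu>\<close> from \<open>\<mu>\<close> for each \<open>r\<close>.\<close>

lemma fourier_transform_\<kappa>_factor:
  assumes \<xi>: "norm \<xi> \<le> R"
  shows "fourier_transform \<kappa> \<xi> = (\<integral>r. H \<xi> r * m \<xi> r \<partial>\<zeta>)"
proof -
  interpret \<zeta>: finite_measure \<zeta> by (rule \<zeta>_finite)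
  interpret P: pair_sigma_finite "\<nu> \<Otimes>\<^sub>M \<mu>" \<zeta> ..
  interpret PF: finite_measure "(\<nu> \<Otimes>\<^sub>M \<mu>) \<Otimes>\<^sub>M \<zeta>"
    by (intro finite_measure_pair_measure \<nu>\<mu>.finite_measure_axioms \<zeta>_finite)
  define f where "f = (\<lambda>r (p :: 'a \<times> real). complex_of_real (indicator {-\<tau>..\<tau>} (r - snd p)) * phase (\<xi> \<bullet> fst p))"
  define g where "g = (\<lambda>r x. \<eta> \<xi> x * phase (r * (\<xi> \<bullet> x)))"
  have mf [measurable]: "(\<lambda>(r, p). f r p) \<in> borel_measurable (borel \<Otimes>\<^sub>M (borel \<Otimes>\<^sub>M borel))"
    unfolding f_def split_beta' by measurable
  have mg [measurable]: "(\<lambda>(r, x). g r x) \<in> borel_measurable (borel \<Otimes>\<^sub>M borel)"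
    unfolding g_def split_beta' by measurable
  have bnd: "norm (f r p * g r x) \<le> 1 / \<tau>" for r p x
    using norm_\<eta>_le[of \<xi> x] \<tau>(1) by (auto simp: f_def g_def norm_mult indicator_def)
  have iF: "integrable ((\<nu> \<Otimes>\<^sub>M \<mu>) \<Otimes>\<^sub>M \<zeta>) (\<lambda>((p, x), r). f r p * g r x)"
    by (rule PF.integrable_const_bound[where B = "1 / \<tau>"])
      (use bnd in \<open>auto simp: split_beta'\<close>)
  have "fourier_transform \<kappa> \<xi> = (\<integral>q. (\<integral>r. f r (fst q) * g r (snd q) \<partial>\<zeta>) \<partial>(\<nu> \<Otimes>\<^sub>M \<mu>))"
    unfolding fourier_transform_\<kappa>
  proof (rule integral_cong_AE)
    have "AE p in \<nu>. AE x in \<mu>. \<bar>snd p\<bar> \<le> M \<and> norm x \<le> M"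
      using \<nu>_bounded by eventually_elim (use \<mu>_bounded in auto)
    then have "AE q in \<nu> \<Otimes>\<^sub>M \<mu>. \<bar>snd (fst q)\<bar> \<le> M \<and> norm (snd q) \<le> M"
      by (intro \<nu>\<mu>.AE_pair_measure) auto
    then show "AE q in \<nu> \<Otimes>\<^sub>M \<mu>. (case q of (p, x) \<Rightarrow> phase (\<xi> \<bullet> fst p) * phase (snd p * (\<xi> \<bullet> x)))
        = (\<integral>r. f r (fst q) * g r (snd q) \<partial>\<zeta>)"
    proof eventually_elim
      fix q :: "('a \<times> real) \<times> 'a"
      assume q: "\<bar>snd (fst q)\<bar> \<le> M \<and> norm (snd q) \<le> M"
      obtain p x where qq: "q = (p, x)" by (cases q)
      have "(\<integral>r. f r p * g r x \<partial>\<zeta>) = (\<integral>r. (phase (\<xi> \<bullet> fst p) * \<eta> \<xi> x) * (complex_of_real (indicator {-\<tau>..\<tau>} (r - snd p)) * phase (r * (\<xi> \<bullet> x))) \<partial>\<zeta>)"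
        by (simp add: f_def g_def mult_ac)
      also have "\<dots> = (phase (\<xi> \<bullet> fst p) * \<eta> \<xi> x) * (phase (snd p * (\<xi> \<bullet> x)) * S (\<xi> \<bullet> x))"
        using q by (simp add: integral_\<zeta>_window qq)
      also have "\<dots> = phase (\<xi> \<bullet> fst p) * phase (snd p * (\<xi> \<bullet> x)) * (\<eta> \<xi> x * S (\<xi> \<bullet> x))"
        by (simp add: mult_ac)
      also have "\<eta> \<xi> x * S (\<xi> \<bullet> x) = 1" using q by (intro \<eta>_S \<xi>) (simp add: qq)
      finally show "(case q of (p, x) \<Rightarrow> phase (\<xi> \<bullet> fst p) * phase (snd p * (\<xi> \<bullet> x)))
          = (\<integral>r. f r (fst q) * g r (snd q) \<partial>\<zeta>)" by (simp add: qq)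
    qed
  next
    show "(\<lambda>q. case q of (p, x) \<Rightarrow> phase (\<xi> \<bullet> fst p) * phase (snd p * (\<xi> \<bullet> x))) \<in> borel_measurable (\<nu> \<Otimes>\<^sub>M \<mu>)"
      unfolding split_beta' by measurable
    show "(\<lambda>q. \<integral>r. f r (fst q) * g r (snd q) \<partial>\<zeta>) \<in> borel_measurable (\<nu> \<Otimes>\<^sub>M \<mu>)"
      by (rule \<zeta>.borel_measurable_lebesgue_integral) measurable
  qed
  also have "\<dots> = (\<integral>r. (\<integral>q. f r (fst q) * g r (snd q) \<partial>(\<nu> \<Otimes>\<^sub>M \<mu>)) \<partial>\<zeta>)"
    using P.Fubini_integral[of "\<lambda>q r. f r (fst q) * g r (snd q)"] iF by (simp add: split_beta')
  also have "\<dots> = (\<integral>r. H \<xi> r * m \<xi> r \<partial>\<zeta>)"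
  proof (rule Bochner_Integration.integral_cong[OF refl])
    fix r
    have "integrable (\<nu> \<Otimes>\<^sub>M \<mu>) (\<lambda>q. f r (fst q) * g r (snd q))"
      by (rule \<nu>\<mu>.integrable_const_bound[where B = "1 / \<tau>"]) (use bnd in auto)
    then show "(\<integral>q. f r (fst q) * g r (snd q) \<partial>(\<nu> \<Otimes>\<^sub>M \<mu>)) = H \<xi> r * m \<xi> r"
      by (subst \<nu>\<mu>.integral_times) (auto simp: f_def g_def H_def m_def)
  qed
  finally show ?thesis .
qed

end

end

section \<open>Square integrals of the two factors\<close>

lemma powr_annulus_le:
  fixes a :: real
  assumes "0 < R" "R / 2 \<le> N" "N \<le> 2 * R"
  shows "N powr a \<le> 2 powr \<bar>a\<bar> * R powr a"
proof (cases "0 \<le> a")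
  case True
  then have "N powr a \<le> (2 * R) powr a" using assms by (intro powr_mono2) auto
  then show ?thesis using True assms by (simp add: powr_mult)
next
  case False
  then have "N powr a \<le> (R / 2) powr a" using assms by (intro powr_mono2') auto
  also have "\<dots> = 2 powr (- a) * R powr a" using assms by (simp add: powr_divide powr_minus_divide)
  finally show ?thesis using False by simp
qed

context frostman_pair
begin

lemma nn_integral_\<zeta>:
  assumes [measurable]: "f \<in> borel_measurable borel"
  shows "(\<integral>\<^sup>+r. f r \<partial>\<zeta>) = (\<integral>\<^sup>+r. indicator {-(M + 1)..M + 1} r * f r \<partial>lborel)"
  unfolding \<zeta>_def by (subst nn_integral_density) (auto simp: ennreal_indicator)

text \<open>As a function of \<open>r\<close> alone, \<open>m\<close> is a one-dimensional transform
  of \<open>\<mu>\<close> projected along \<open>\<xi>\<close>, so the Gaussian form applies with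
  the scalar map given by the inner product with \<open>\<xi>\<close>. The window is not normalised:
  the whole loss of the averaging is the factor 1 / \<tau>^2 from \<open>\<eta>\<close>. As
  \<open>1 \<le> L\<close>, the kernel may be widened to the one in
  \<open>\<mu>_gauss_le\<close>.\<close>

lemma m_L2_le:
  assumes R: "1 \<le> R" and \<xi>: "1 / 2 \<le> norm \<xi>"
  shows "(\<integral>\<^sup>+r. ennreal ((norm (m R \<xi> r))\<^sup>2) \<partial>\<zeta>)
    \<le> ennreal (exp pi * ((M + 1) / (\<tau> R)\<^sup>2 * (D\<mu> * norm \<xi> powr (real DIM('a) - 1 - s))))"
proof -
  define L where "L = M + 1"
  have L: "1 \<le> L" using M by (simp add: L_def)
  have \<tau>0: "0 < \<tau> R" by (rule \<tau>[OF R])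
  note [measurable] = m_measurable[OF R] \<eta>_measurable[OF R]
  have "(\<integral>\<^sup>+r. ennreal ((norm (m R \<xi> r))\<^sup>2) \<partial>\<zeta>) = (\<integral>\<^sup>+r. indicator {-L..L} r * ennreal ((norm (m R \<xi> r))\<^sup>2) \<partial>lborel)"
    unfolding L_def by (rule nn_integral_\<zeta>) measurable
  also have "\<dots> \<le> (\<integral>\<^sup>+r. ennreal (exp pi) * ennreal (gauss L r * (norm (m R \<xi> r))\<^sup>2) \<partial>lborel)"
  proof (rule nn_integral_mono)
    fix r :: real
    show "indicator {-L..L} r * ennreal ((norm (m R \<xi> r))\<^sup>2) \<le> ennreal (exp pi) * ennreal (gauss L r * (norm (m R \<xi> r))\<^sup>2)"
    proof (cases "r \<in> {-L..L}")
      case True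
      then have "exp (- pi) \<le> gauss L r" using L by (intro gauss_ge) auto
      then have "exp pi * exp (- pi) \<le> exp pi * gauss L r" by simp
      then have "1 * (norm (m R \<xi> r))\<^sup>2 \<le> (exp pi * gauss L r) * (norm (m R \<xi> r))\<^sup>2"
        by (intro mult_right_mono) (auto simp flip: exp_add)
      then show ?thesis using True by (simp add: mult.assoc ennreal_leI flip: ennreal_mult)
    qed simp
  qed
  also have "\<dots> = ennreal (exp pi) * (\<integral>\<^sup>+r. ennreal (gauss L r * (norm (m R \<xi> r))\<^sup>2) \<partial>lborel)"
    by (rule nn_integral_cmult) measurable
  also have "(\<integral>\<^sup>+r. ennreal (gauss L r * (norm (m R \<xi> r))\<^sup>2) \<partial>lborel)
      \<le> (\<integral>\<^sup>+x. (\<integral>\<^sup>+x'. ennreal (norm (\<eta> R \<xi> x) * norm (\<eta> R \<xi> x') * (L ^ DIM(real) * gauss 1 (L *\<^sub>R (\<xi> \<bullet> x - \<xi> \<bullet> x')))) \<partial>\<mu>) \<partial>\<mu>)"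
    using nn_gauss_form_le[where \<phi> = "\<lambda>x. \<xi> \<bullet> x" and \<eta> = "\<eta> R \<xi>" and R = L and \<rho> = \<mu> and B = "1 / \<tau> R"] L norm_\<eta>_le[OF R]
      \<mu>.finite_measure_axioms
    by (simp add: m_def[OF R])
  also have "\<dots> \<le> (\<integral>\<^sup>+x. (\<integral>\<^sup>+x'. ennreal (L / (\<tau> R)\<^sup>2) * ennreal (gauss 1 (\<xi> \<bullet> x - \<xi> \<bullet> x')) \<partial>\<mu>) \<partial>\<mu>)"
  proof (intro nn_integral_mono)
    fix x x'
    define a where "a = \<xi> \<bullet> x - \<xi> \<bullet> x'"
    have "1 * a\<^sup>2 \<le> L\<^sup>2 * a\<^sup>2" using L by (intro mult_right_mono one_le_power) auto
    then have "gauss 1 (L *\<^sub>R a) \<le> gauss 1 a"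
      by (simp add: gauss_def power_mult_distrib)
    moreover have "norm (\<eta> R \<xi> x) * norm (\<eta> R \<xi> x') \<le> (1 / \<tau> R) * (1 / \<tau> R)"
      using \<tau>0 by (intro mult_mono norm_\<eta>_le[OF R]) auto
    moreover have "L ^ DIM(real) * gauss 1 (L *\<^sub>R a) \<le> L * gauss 1 a" using calculation(1) L by simp
    ultimately have "norm (\<eta> R \<xi> x) * norm (\<eta> R \<xi> x') * (L ^ DIM(real) * gauss 1 (L *\<^sub>R a)) \<le> (1 / \<tau> R) * (1 / \<tau> R) * (L * gauss 1 a)"
      using L \<tau>0 mult_mono[of "norm (\<eta> R \<xi> x) * norm (\<eta> R \<xi> x')" "(1 / \<tau> R) * (1 / \<tau> R)" "L ^ DIM(real) * gauss 1 (L *\<^sub>R a)" "L * gauss 1 a"]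
      by simp
    then show "ennreal (norm (\<eta> R \<xi> x) * norm (\<eta> R \<xi> x') * (L ^ DIM(real) * gauss 1 (L *\<^sub>R (\<xi> \<bullet> x - \<xi> \<bullet> x'))))
        \<le> ennreal (L / (\<tau> R)\<^sup>2) * ennreal (gauss 1 (\<xi> \<bullet> x - \<xi> \<bullet> x'))"
      using L by (simp add: a_def ennreal_leI power2_eq_square flip: ennreal_mult)
  qed
  also have "\<dots> = (\<integral>\<^sup>+x. ennreal (L / (\<tau> R)\<^sup>2) * (\<integral>\<^sup>+x'. ennreal (gauss 1 (\<xi> \<bullet> x - \<xi> \<bullet> x')) \<partial>\<mu>) \<partial>\<mu>)"
    by (intro nn_integral_cong nn_integral_cmult) measurable
  also have "\<dots> \<le> (\<integral>\<^sup>+x. ennreal (L / (\<tau> R)\<^sup>2) * ennreal (D\<mu> * norm \<xi> powr (real DIM('a) - 1 - s)) \<partial>\<mu>)"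
    by (intro nn_integral_mono mult_left_mono \<mu>_gauss_le \<xi>) simp
  also have "\<dots> = ennreal (L / (\<tau> R)\<^sup>2 * (D\<mu> * norm \<xi> powr (real DIM('a) - 1 - s)))"
    using L D\<mu>_nonneg by (simp add: \<mu>.emeasure_space_1 flip: ennreal_mult)
  finally have "(\<integral>\<^sup>+r. ennreal ((norm (m R \<xi> r))\<^sup>2) \<partial>\<zeta>)
      \<le> ennreal (exp pi) * ennreal (L / (\<tau> R)\<^sup>2 * (D\<mu> * norm \<xi> powr (real DIM('a) - 1 - s)))"
    by (simp add: mult_left_mono)
  then show ?thesis unfolding L_def by (subst ennreal_mult') (rule exp_ge_zero | assumption)+
qed

text \<open>The order of integration is exchanged so that for fixed \<open>r\<close> the
  d-dimensional Gaussian form applies in \<open>\<xi>\<close>. Integrating over \<open>r\<close>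
  afterwards gives a factor \<open>2 * \<tau> R\<close> and retains only pairs of points of \<Gamma>
  with close ratios.\<close>

lemma H_L2_le:
  assumes R: "1 \<le> R"
  shows "(\<integral>\<^sup>+\<xi>. indicator (cball 0 R) \<xi> * (\<integral>\<^sup>+r. ennreal ((norm (H R \<xi> r))\<^sup>2) \<partial>\<zeta>) \<partial>lborel)
    \<le> ennreal (exp pi * (2 * \<tau> R * R ^ DIM('a) * (D\<nu> * R powr (- t))))"
proof -
  interpret \<zeta>: finite_measure \<zeta> by (rule \<zeta>_finite)
  interpret Z: pair_sigma_finite "lborel :: 'a measure" \<zeta> ..
  interpret Q: pair_sigma_finite "\<nu> \<Otimes>\<^sub>M \<nu>" "lborel :: real measure" ..
  have \<tau>0: "0 < \<tau> R" by (rule \<tau>[OF R])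
  note [measurable] = H_measurable[OF R]
  define J where "J = (\<lambda>r (p :: 'a \<times> real). indicator {-\<tau> R..\<tau> R} (r - snd p) :: real)"
  have J [measurable]: "(\<lambda>(r, p). J r p) \<in> borel_measurable (borel \<Otimes>\<^sub>M (borel \<Otimes>\<^sub>M borel))"
    unfolding J_def split_beta' by measurable
  define G where "G = (\<lambda>(p :: 'a \<times> real) (p' :: 'a \<times> real). R ^ DIM('a) * gauss 1 (R *\<^sub>R (fst p - fst p')))"
  have G [measurable]: "(\<lambda>(p, p'). G p p') \<in> borel_measurable ((borel \<Otimes>\<^sub>M borel) \<Otimes>\<^sub>M (borel \<Otimes>\<^sub>M borel))"
    unfolding G_def split_beta' by measurable
  have G0: "0 \<le> G p p'" for p p' using R by (simp add: G_def)
  have [measurable]: "cball (0::'a) R \<in> sets borel" by simp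
  have [measurable]: "(\<lambda>q. H R (fst q) (snd q)) \<in> borel_measurable (borel \<Otimes>\<^sub>M borel)"
    using H_measurable[OF R] by (simp add: split_beta')
  have HJ: "H R \<xi> r = (\<integral>p. complex_of_real (J r p) * phase (\<xi> \<bullet> fst p) \<partial>\<nu>)" for \<xi> r
    by (simp add: H_def[OF R] J_def)
  have "(\<integral>\<^sup>+\<xi>. indicator (cball 0 R) \<xi> * (\<integral>\<^sup>+r. ennreal ((norm (H R \<xi> r))\<^sup>2) \<partial>\<zeta>) \<partial>lborel)
      = (\<integral>\<^sup>+\<xi>. (\<integral>\<^sup>+r. indicator (cball 0 R) \<xi> * ennreal ((norm (H R \<xi> r))\<^sup>2) \<partial>\<zeta>) \<partial>lborel)"
    by (intro nn_integral_cong nn_integral_cmult[symmetric]) measurable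
  also have "\<dots> = (\<integral>\<^sup>+r. (\<integral>\<^sup>+\<xi>. indicator (cball 0 R) \<xi> * ennreal ((norm (H R \<xi> r))\<^sup>2) \<partial>lborel) \<partial>\<zeta>)"
    by (rule Z.Fubini'[symmetric]) measurable
  also have "\<dots> \<le> (\<integral>\<^sup>+r. ennreal (exp pi) * (\<integral>\<^sup>+p. (\<integral>\<^sup>+p'. ennreal (J r p * J r p' * G p p') \<partial>\<nu>) \<partial>\<nu>) \<partial>\<zeta>)"
  proof (rule nn_integral_mono)
    fix r
    have "(\<integral>\<^sup>+\<xi>. indicator (cball 0 R) \<xi> * ennreal ((norm (H R \<xi> r))\<^sup>2) \<partial>lborel)
        \<le> (\<integral>\<^sup>+\<xi>. ennreal (exp pi) * ennreal (gauss R \<xi> * (norm (H R \<xi> r))\<^sup>2) \<partial>lborel)"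
    proof (rule nn_integral_mono)
      fix \<xi> :: 'a
      show "indicator (cball 0 R) \<xi> * ennreal ((norm (H R \<xi> r))\<^sup>2) \<le> ennreal (exp pi) * ennreal (gauss R \<xi> * (norm (H R \<xi> r))\<^sup>2)"
      proof (cases "\<xi> \<in> cball 0 R")
        case True
        then have "exp (- pi) \<le> gauss R \<xi>" using R by (intro gauss_ge) auto
        then have "exp pi * exp (- pi) \<le> exp pi * gauss R \<xi>" by simp
        then have "1 * (norm (H R \<xi> r))\<^sup>2 \<le> (exp pi * gauss R \<xi>) * (norm (H R \<xi> r))\<^sup>2"
          by (intro mult_right_mono) (auto simp flip: exp_add)
        then show ?thesis using True by (simp add: mult.assoc ennreal_leI flip: ennreal_mult)
      qed simp
    qed
    also have "\<dots> = ennreal (exp pi) * (\<integral>\<^sup>+\<xi>. ennreal (gauss R \<xi> * (norm (H R \<xi> r))\<^sup>2) \<partial>lborel)"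
      by (rule nn_integral_cmult) measurable
    also have "(\<integral>\<^sup>+\<xi>. ennreal (gauss R \<xi> * (norm (H R \<xi> r))\<^sup>2) \<partial>lborel)
        \<le> (\<integral>\<^sup>+p. (\<integral>\<^sup>+p'. ennreal (norm (complex_of_real (J r p)) * norm (complex_of_real (J r p')) * (R ^ DIM('a) * gauss 1 (R *\<^sub>R (fst p - fst p')))) \<partial>\<nu>) \<partial>\<nu>)"
      unfolding HJ
    proof (rule nn_gauss_form_le[where B = 1])
      show "finite_measure \<nu>" by (rule \<nu>.finite_measure_axioms)
      show "(\<lambda>p. complex_of_real (J r p)) \<in> borel_measurable \<nu>" by measurable
      show "norm (complex_of_real (J r p)) \<le> 1" for p by (simp add: J_def indicator_def)
    qed (use R in auto)
    also have "\<dots> = (\<integral>\<^sup>+p. (\<integral>\<^sup>+p'. ennreal (J r p * J r p' * G p p') \<partial>\<nu>) \<partial>\<nu>)"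
      by (simp add: J_def G_def)
    finally show "(\<integral>\<^sup>+\<xi>. indicator (cball 0 R) \<xi> * ennreal ((norm (H R \<xi> r))\<^sup>2) \<partial>lborel)
        \<le> ennreal (exp pi) * (\<integral>\<^sup>+p. (\<integral>\<^sup>+p'. ennreal (J r p * J r p' * G p p') \<partial>\<nu>) \<partial>\<nu>)"
      by (simp add: mult_left_mono)
  qed
  also have "\<dots> = ennreal (exp pi) * (\<integral>\<^sup>+r. (\<integral>\<^sup>+p. (\<integral>\<^sup>+p'. ennreal (J r p * J r p' * G p p') \<partial>\<nu>) \<partial>\<nu>) \<partial>\<zeta>)"
    by (rule nn_integral_cmult) measurable
  also have "(\<integral>\<^sup>+r. (\<integral>\<^sup>+p. (\<integral>\<^sup>+p'. ennreal (J r p * J r p' * G p p') \<partial>\<nu>) \<partial>\<nu>) \<partial>\<zeta>)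
      \<le> (\<integral>\<^sup>+r. (\<integral>\<^sup>+p. (\<integral>\<^sup>+p'. ennreal (J r p * J r p' * G p p') \<partial>\<nu>) \<partial>\<nu>) \<partial>lborel)"
    by (subst nn_integral_\<zeta>, measurable, intro nn_integral_mono) (auto simp: indicator_def)
  also have "\<dots> = (\<integral>\<^sup>+r. (\<integral>\<^sup>+q. ennreal (J r (fst q) * J r (snd q) * G (fst q) (snd q)) \<partial>(\<nu> \<Otimes>\<^sub>M \<nu>)) \<partial>lborel)"
  proof (rule nn_integral_cong)
    fix r
    have "(\<lambda>q. ennreal (J r (fst q) * J r (snd q) * G (fst q) (snd q))) \<in> borel_measurable (\<nu> \<Otimes>\<^sub>M \<nu>)" by measurable
    from \<nu>.nn_integral_fst[OF this]
    show "(\<integral>\<^sup>+p. (\<integral>\<^sup>+p'. ennreal (J r p * J r p' * G p p') \<partial>\<nu>) \<partial>\<nu>)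
        = (\<integral>\<^sup>+q. ennreal (J r (fst q) * J r (snd q) * G (fst q) (snd q)) \<partial>(\<nu> \<Otimes>\<^sub>M \<nu>))" by simp
  qed
  also have "\<dots> = (\<integral>\<^sup>+q. (\<integral>\<^sup>+r. ennreal (J r (fst q) * J r (snd q) * G (fst q) (snd q)) \<partial>lborel) \<partial>(\<nu> \<Otimes>\<^sub>M \<nu>))"
    by (rule Q.Fubini') measurable
  \<comment> \<open>If both windows contain the same \<open>r\<close>, the two ratios differ by at
    most \<open>2 * \<tau> R\<close>, hence by at most 1 / R; such \<open>r\<close> fill an interval
    of length at most \<open>2 * \<tau> R\<close>.\<close>
  also have "\<dots> \<le> (\<integral>\<^sup>+q. ennreal (2 * \<tau> R) * (ennreal (G (fst q) (snd q)) * indicator {p'. \<bar>snd (fst q) - snd p'\<bar> \<le> 1 / R} (snd q)) \<partial>(\<nu> \<Otimes>\<^sub>M \<nu>))"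
  proof (rule nn_integral_mono)
    fix q :: "('a \<times> real) \<times> ('a \<times> real)"
    define \<rho> \<rho>' where "\<rho> = snd (fst q)" and "\<rho>' = snd (snd q)"
    define c where "c = ennreal (G (fst q) (snd q)) * indicator {p'. \<bar>\<rho> - snd p'\<bar> \<le> 1 / R} (snd q)"
    have "(\<integral>\<^sup>+r. ennreal (J r (fst q) * J r (snd q) * G (fst q) (snd q)) \<partial>lborel) \<le> (\<integral>\<^sup>+r. c * indicator {\<rho> - \<tau> R..\<rho> + \<tau> R} r \<partial>lborel)"
    proof (rule nn_integral_mono)
      fix r :: real
      show "ennreal (J r (fst q) * J r (snd q) * G (fst q) (snd q)) \<le> c * indicator {\<rho> - \<tau> R..\<rho> + \<tau> R} r"
      proof (cases "r - \<rho> \<in> {-\<tau> R..\<tau> R} \<and> r - \<rho>' \<in> {-\<tau> R..\<tau> R}")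
        case True
        then have "\<bar>\<rho> - \<rho>'\<bar> \<le> 1 / R" using \<tau>(2)[OF R] by auto
        then show ?thesis using True by (simp add: J_def c_def \<rho>_def \<rho>'_def)
      next
        case False
        then have "J r (fst q) * J r (snd q) = 0" by (auto simp: J_def \<rho>_def \<rho>'_def)
        then show ?thesis by (simp only: mult_zero_left ennreal_0 zero_le)
      qed
    qed
    also have "\<dots> = c * ennreal (2 * \<tau> R)" using \<tau>0 by (subst nn_integral_cmult_indicator) auto
    finally show "(\<integral>\<^sup>+r. ennreal (J r (fst q) * J r (snd q) * G (fst q) (snd q)) \<partial>lborel)
        \<le> ennreal (2 * \<tau> R) * (ennreal (G (fst q) (snd q)) * indicator {p'. \<bar>snd (fst q) - snd p'\<bar> \<le> 1 / R} (snd q))"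
      by (simp add: c_def \<rho>_def mult.commute)
  qed
  also have "\<dots> = (\<integral>\<^sup>+p. (\<integral>\<^sup>+p'. ennreal (2 * \<tau> R) * (ennreal (G p p') * indicator {p'. \<bar>snd p - snd p'\<bar> \<le> 1 / R} p') \<partial>\<nu>) \<partial>\<nu>)"
    by (subst \<nu>.nn_integral_fst[symmetric]) (simp_all add: indicator_def)
  also have "\<dots> = (\<integral>\<^sup>+p. ennreal (2 * \<tau> R * R ^ DIM('a)) * (\<integral>\<^sup>+p'. ennreal (gauss 1 (R *\<^sub>R (fst p - fst p'))) * indicator {p'. \<bar>snd p - snd p'\<bar> \<le> 1 / R} p' \<partial>\<nu>) \<partial>\<nu>)"
  proof (rule nn_integral_cong)
    fix p
    have m: "(\<lambda>p'. ennreal (gauss 1 (R *\<^sub>R (fst p - fst p'))) * indicator {p'. \<bar>snd p - snd p'\<bar> \<le> 1 / R} p') \<in> borel_measurable \<nu>"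
      unfolding indicator_def by measurable
    show "(\<integral>\<^sup>+p'. ennreal (2 * \<tau> R) * (ennreal (G p p') * indicator {p'. \<bar>snd p - snd p'\<bar> \<le> 1 / R} p') \<partial>\<nu>)
      = ennreal (2 * \<tau> R * R ^ DIM('a)) * (\<integral>\<^sup>+p'. ennreal (gauss 1 (R *\<^sub>R (fst p - fst p'))) * indicator {p'. \<bar>snd p - snd p'\<bar> \<le> 1 / R} p' \<partial>\<nu>)"
      unfolding nn_integral_cmult[OF m, symmetric]
      using R \<tau>0 by (intro nn_integral_cong) (simp add: G_def ennreal_mult mult.assoc)
  qed
  also have "\<dots> \<le> (\<integral>\<^sup>+p. ennreal (2 * \<tau> R * R ^ DIM('a)) * ennreal (D\<nu> * R powr (- t)) \<partial>\<nu>)"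
    using R by (intro nn_integral_mono mult_left_mono \<nu>_gauss_le) auto
  also have "\<dots> = ennreal (2 * \<tau> R * R ^ DIM('a) * (D\<nu> * R powr (- t)))"
    using R \<tau>0 D\<nu>_nonneg by (simp add: \<nu>.emeasure_space_1 ennreal_mult)
  finally have "(\<integral>\<^sup>+\<xi>. indicator (cball 0 R) \<xi> * (\<integral>\<^sup>+r. ennreal ((norm (H R \<xi> r))\<^sup>2) \<partial>\<zeta>) \<partial>lborel)
      \<le> ennreal (exp pi) * ennreal (2 * \<tau> R * R ^ DIM('a) * (D\<nu> * R powr (- t)))"
    by (simp add: mult_left_mono)
  then show ?thesis by (subst ennreal_mult') (rule exp_ge_zero | assumption)+
qed

end

section \<open>Decay on annuli and finiteness of the Sobolev integral\<close>

lemma norm_fourier_transform_le: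
  assumes "prob_space \<kappa>"
  shows "norm (fourier_transform \<kappa> \<xi>) \<le> 1"
proof -
  interpret prob_space \<kappa> by fact
  have "norm (fourier_transform \<kappa> \<xi>) \<le> (\<integral>x. norm (phase (\<xi> \<bullet> x)) \<partial>\<kappa>)"
    unfolding fourier_transform_phase by (rule integral_norm_bound)
  also have "\<dots> = 1" by (simp add: prob_space)
  finally show ?thesis .
qed

lemma fourier_transform_measurable:
  fixes \<kappa> :: "'a::euclidean_space measure"
  assumes "finite_measure \<kappa>" "sets \<kappa> = sets borel"
  shows "fourier_transform \<kappa> \<in> borel_measurable borel"
proof -
  interpret finite_measure \<kappa> by fact
  have [measurable_cong]: "sets \<kappa> = sets borel" by fact
  show ?thesis unfolding fourier_transform_phase[abs_def] by measurable
qed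

context frostman_pair
begin

lemma fourier_transform_pointwise_le:
  assumes R: "1 \<le> R" and \<xi>: "1 / 2 \<le> norm \<xi>" "norm \<xi> \<le> R"
  shows "ennreal ((norm (fourier_transform \<kappa> \<xi>))\<^sup>2)
    \<le> (\<integral>\<^sup>+r. ennreal ((norm (m R \<xi> r))\<^sup>2) \<partial>\<zeta>) * (\<integral>\<^sup>+r. ennreal ((norm (H R \<xi> r))\<^sup>2) \<partial>\<zeta>)"
proof -
  interpret \<zeta>: finite_measure \<zeta> by (rule \<zeta>_finite)
  have mm [measurable]: "m R \<xi> \<in> borel_measurable borel"
    using measurable_compose[OF measurable_Pair1' m_measurable[OF R], of \<xi>] by simp
  have mH [measurable]: "H R \<xi> \<in> borel_measurable borel"
    using measurable_compose[OF measurable_Pair1' H_measurable[OF R], of \<xi>] by simp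
  have F: "fourier_transform \<kappa> \<xi> = (\<integral>r. H R \<xi> r * m R \<xi> r \<partial>\<zeta>)"
    by (rule fourier_transform_\<kappa>_factor[OF R \<xi>(2)])
  have "ennreal (norm (fourier_transform \<kappa> \<xi>)) \<le> (\<integral>\<^sup>+r. ennreal (norm (H R \<xi> r * m R \<xi> r)) \<partial>\<zeta>)"
  proof (cases "integrable \<zeta> (\<lambda>r. H R \<xi> r * m R \<xi> r)")
    case True
    then show ?thesis unfolding F by (rule integral_norm_bound_ennreal)
  next
    \<comment> \<open>A Bochner integral that does not exist is 0 by convention, so the bound holds
      trivially.\<close>
    case False
    then show ?thesis unfolding F by (simp add: not_integrable_integral_eq)
  qed
  also have "\<dots> = (\<integral>\<^sup>+r. ennreal (norm (m R \<xi> r)) * ennreal (norm (H R \<xi> r)) \<partial>\<zeta>)"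
    by (simp add: norm_mult ennreal_mult mult.commute)
  finally have "(ennreal (norm (fourier_transform \<kappa> \<xi>)))\<^sup>2 \<le> (\<integral>\<^sup>+r. ennreal (norm (m R \<xi> r)) * ennreal (norm (H R \<xi> r)) \<partial>\<zeta>)\<^sup>2"
    by (rule power_mono) simp
  also have "\<dots> \<le> (\<integral>\<^sup>+r. (ennreal (norm (m R \<xi> r)))\<^sup>2 \<partial>\<zeta>) * (\<integral>\<^sup>+r. (ennreal (norm (H R \<xi> r)))\<^sup>2 \<partial>\<zeta>)"
    by (rule Cauchy_Schwarz_nn_integral) measurable
  finally show ?thesis by (simp add: ennreal_power)
qed

definition D\<kappa> :: real where
  "D\<kappa> = exp pi * exp pi * (M + 1) * D\<mu> * D\<nu> * (16 * M) * 2 powr \<bar>real DIM('a) - 1 - s\<bar>"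

lemma D\<kappa>_nonneg: "0 \<le> D\<kappa>"
  unfolding D\<kappa>_def using M D\<mu>_nonneg D\<nu>_nonneg by simp

text \<open>The bound on \<open>m\<close> is uniform over the annulus and is taken out of the
  integral; the rest is \<open>H\<close> integrated over the ball. The powers of
  \<open>\<tau>\<close> combine to 1 / \<tau>, of order R, which turns the exponents d - 1 - s and d
  - t into 2 d - s - t. The constant 16 M comes from 2 / \<tau>.\<close>

lemma fourier_transform_annulus_le:
  assumes R: "1 \<le> R"
  defines "A \<equiv> {\<xi>::'a. R / 2 \<le> norm \<xi> \<and> norm \<xi> \<le> R}"
  shows "(\<integral>\<^sup>+\<xi>. indicator A \<xi> * ennreal ((norm (fourier_transform \<kappa> \<xi>))\<^sup>2) \<partial>lborel)
    \<le> ennreal (D\<kappa> * R powr (2 * real DIM('a) - s - t))"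
proof -
  interpret \<zeta>: finite_measure \<zeta> by (rule \<zeta>_finite)
  have \<tau>0: "0 < \<tau> R" by (rule \<tau>[OF R])
  define a where "a = real DIM('a) - 1 - s"
  define B where "B = exp pi * ((M + 1) / (\<tau> R)\<^sup>2 * (D\<mu> * (2 powr \<bar>a\<bar> * R powr a)))"
  have B0: "0 \<le> B" unfolding B_def using M D\<mu>_nonneg by simp
  have [measurable]: "(\<lambda>q. H R (fst q) (snd q)) \<in> borel_measurable (borel \<Otimes>\<^sub>M borel)"
    using H_measurable[OF R] by (simp add: split_beta')
  have [measurable]: "cball (0::'a) R \<in> sets borel" by simp
  have "(\<integral>\<^sup>+\<xi>. indicator A \<xi> * ennreal ((norm (fourier_transform \<kappa> \<xi>))\<^sup>2) \<partial>lborel)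
      \<le> (\<integral>\<^sup>+\<xi>. ennreal B * (indicator (cball 0 R) \<xi> * (\<integral>\<^sup>+r. ennreal ((norm (H R \<xi> r))\<^sup>2) \<partial>\<zeta>)) \<partial>lborel)"
  proof (rule nn_integral_mono)
    fix \<xi> :: 'a
    show "indicator A \<xi> * ennreal ((norm (fourier_transform \<kappa> \<xi>))\<^sup>2)
        \<le> ennreal B * (indicator (cball 0 R) \<xi> * (\<integral>\<^sup>+r. ennreal ((norm (H R \<xi> r))\<^sup>2) \<partial>\<zeta>))"
    proof (cases "\<xi> \<in> A")
      case True
      then have \<xi>: "R / 2 \<le> norm \<xi>" "norm \<xi> \<le> R" "1 / 2 \<le> norm \<xi>" using R by (auto simp: A_def)
      have "(\<integral>\<^sup>+r. ennreal ((norm (m R \<xi> r))\<^sup>2) \<partial>\<zeta>) \<le> ennreal (exp pi * ((M + 1) / (\<tau> R)\<^sup>2 * (D\<mu> * norm \<xi> powr a)))"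
        unfolding a_def by (rule m_L2_le[OF R \<xi>(3)])
      also have "\<dots> \<le> ennreal B"
        unfolding B_def using \<xi> R M D\<mu>_nonneg powr_annulus_le[of R "norm \<xi>" a]
        by (intro ennreal_leI mult_left_mono) auto
      finally have "(\<integral>\<^sup>+r. ennreal ((norm (m R \<xi> r))\<^sup>2) \<partial>\<zeta>) \<le> ennreal B" .
      then have "ennreal ((norm (fourier_transform \<kappa> \<xi>))\<^sup>2) \<le> ennreal B * (\<integral>\<^sup>+r. ennreal ((norm (H R \<xi> r))\<^sup>2) \<partial>\<zeta>)"
        using fourier_transform_pointwise_le[OF R \<xi>(3,2)] by (meson mult_right_mono order_trans zero_le)
      then show ?thesis using True \<xi> by simp
    qed simp
  qed
  also have "\<dots> = ennreal B * (\<integral>\<^sup>+\<xi>. indicator (cball 0 R) \<xi> * (\<integral>\<^sup>+r. ennreal ((norm (H R \<xi> r))\<^sup>2) \<partial>\<zeta>) \<partial>lborel)"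
    by (rule nn_integral_cmult) measurable
  also have "\<dots> \<le> ennreal B * ennreal (exp pi * (2 * \<tau> R * R ^ DIM('a) * (D\<nu> * R powr (- t))))"
    by (intro mult_left_mono H_L2_le R) simp
  also have "\<dots> = ennreal (B * (exp pi * (2 * \<tau> R * R ^ DIM('a) * (D\<nu> * R powr (- t)))))"
    by (rule ennreal_mult'[symmetric, OF B0])
  also have "B * (exp pi * (2 * \<tau> R * R ^ DIM('a) * (D\<nu> * R powr (- t))))
      = exp pi * exp pi * (M + 1) * D\<mu> * D\<nu> * 2 powr \<bar>a\<bar> * (2 / \<tau> R) * (R powr a * R powr real DIM('a) * R powr (- t))"
    using \<tau>0 R by (simp add: B_def power2_eq_square powr_realpow field_simps)
  also have "2 / \<tau> R = 16 * M * R" using M R by (simp add: \<tau>_def[OF R])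
  also have "R powr a * R powr real DIM('a) * R powr (- t) = R powr (a + real DIM('a) - t)"
    by (simp add: powr_add[symmetric])
  also have "exp pi * exp pi * (M + 1) * D\<mu> * D\<nu> * 2 powr \<bar>a\<bar> * (16 * M * R) * R powr (a + real DIM('a) - t)
      = D\<kappa> * (R powr 1 * R powr (a + real DIM('a) - t))"
    using R by (simp add: D\<kappa>_def a_def)
  also have "R powr 1 * R powr (a + real DIM('a) - t) = R powr (2 * real DIM('a) - s - t)"
    unfolding powr_add[symmetric] by (simp add: a_def algebra_simps)
  finally show ?thesis .
qed

text \<open>The frequencies are split into the unit ball, where the transform is at most 1, and the
  annuli ending at 2^(k+1). The annuli contribute a geometric series of ratio 2^b with b = \<sigma>
  + d - s - t, which is negative.\<close>

theorem sobolev_integral_finite: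
  assumes \<sigma>: "\<sigma> < s + t - real DIM('a)"
  shows "(\<integral>\<^sup>+\<xi>. ennreal ((norm (fourier_transform \<kappa> \<xi>))\<^sup>2 * (1 + norm \<xi>) powr (\<sigma> - real DIM('a))) \<partial>lborel) < \<infinity>"
proof -
  interpret \<kappa>: prob_space \<kappa> by (rule \<kappa>_prob)
  have [measurable]: "fourier_transform \<kappa> \<in> borel_measurable borel"
    by (rule fourier_transform_measurable[OF \<kappa>.finite_measure_axioms \<kappa>_sets])
  define a where "a = \<sigma> - real DIM('a)"
  define b where "b = a + (2 * real DIM('a) - s - t)"
  have b: "b < 0" using \<sigma> by (simp add: b_def a_def)
  define \<phi> where "\<phi> = (\<lambda>\<xi>. ennreal ((norm (fourier_transform \<kappa> \<xi>))\<^sup>2))"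
  have [measurable]: "\<phi> \<in> borel_measurable borel" unfolding \<phi>_def by measurable
  define A where "A = (\<lambda>k::nat. {\<xi>::'a. 2 ^ Suc k / 2 \<le> norm \<xi> \<and> norm \<xi> \<le> 2 ^ Suc k})"
  have [measurable]: "A k \<in> sets borel" for k unfolding A_def by measurable
  have [measurable]: "cball (0::'a) 1 \<in> sets borel" by simp
  define w where "w = (\<lambda>k::nat. 2 powr \<bar>a\<bar> * (2 ^ Suc k) powr a)"
  have le: "ennreal ((norm (fourier_transform \<kappa> \<xi>))\<^sup>2 * (1 + norm \<xi>) powr a)
      \<le> ennreal (2 powr \<bar>a\<bar>) * indicator (cball 0 1) \<xi> + (\<Sum>k. ennreal (w k) * (indicator (A k) \<xi> * \<phi> \<xi>))" for \<xi> :: 'a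
  proof (cases "norm \<xi> \<le> 1")
    case True
    have "norm (fourier_transform \<kappa> \<xi>) \<le> 1" by (rule norm_fourier_transform_le[OF \<kappa>_prob])
    then have "(norm (fourier_transform \<kappa> \<xi>))\<^sup>2 \<le> 1" by (simp add: power_le_one)
    moreover have "(1 + norm \<xi>) powr a \<le> 2 powr \<bar>a\<bar> * 1 powr a" using True by (intro powr_annulus_le) auto
    ultimately have "(norm (fourier_transform \<kappa> \<xi>))\<^sup>2 * (1 + norm \<xi>) powr a \<le> 1 * (2 powr \<bar>a\<bar>)"
      by (intro mult_mono) auto
    then have "ennreal ((norm (fourier_transform \<kappa> \<xi>))\<^sup>2 * (1 + norm \<xi>) powr a) \<le> ennreal (2 powr \<bar>a\<bar>) * indicator (cball 0 1) \<xi>"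
      using True by (simp add: ennreal_leI)
    then show ?thesis by (rule order_trans) simp
  next
    case False
    obtain n where n: "norm \<xi> < 2 ^ n" using real_arch_pow[of 2 "norm \<xi>"] by auto
    have "\<not> norm \<xi> < 2 ^ 0" using False by simp
    with n obtain k where k: "\<not> norm \<xi> < 2 ^ k" "norm \<xi> < 2 ^ Suc k"
      using ex_least_nat_less[of "\<lambda>k. norm \<xi> < 2 ^ k" n] by auto
    then have \<xi>A: "\<xi> \<in> A k" by (simp add: A_def)
    have "1 + norm \<xi> \<le> 2 * 2 ^ Suc k" using k(2) one_le_power[of "2::real" k] unfolding power_Suc by linarith
    then have "(1 + norm \<xi>) powr a \<le> w k"
      unfolding w_def using k by (intro powr_annulus_le) auto
    then have "ennreal ((norm (fourier_transform \<kappa> \<xi>))\<^sup>2 * (1 + norm \<xi>) powr a) \<le> ennreal ((norm (fourier_transform \<kappa> \<xi>))\<^sup>2 * w k)"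
      by (intro ennreal_leI mult_left_mono) auto
    also have "\<dots> = (\<Sum>k\<in>{k}. ennreal (w k) * (indicator (A k) \<xi> * \<phi> \<xi>))"
      using \<xi>A by (simp add: \<phi>_def w_def ennreal_mult mult.commute)
    also have "\<dots> \<le> (\<Sum>k. ennreal (w k) * (indicator (A k) \<xi> * \<phi> \<xi>))"
      by (rule sum_le_suminf) auto
    finally show ?thesis by (rule order_trans) simp
  qed
  have "(\<integral>\<^sup>+\<xi>. ennreal ((norm (fourier_transform \<kappa> \<xi>))\<^sup>2 * (1 + norm \<xi>) powr a) \<partial>lborel)
      \<le> (\<integral>\<^sup>+\<xi>. ennreal (2 powr \<bar>a\<bar>) * indicator (cball 0 1) \<xi> + (\<Sum>k. ennreal (w k) * (indicator (A k) \<xi> * \<phi> \<xi>)) \<partial>(lborel :: 'a measure))"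
    by (intro nn_integral_mono le)
  also have "\<dots> = (\<integral>\<^sup>+\<xi>. ennreal (2 powr \<bar>a\<bar>) * indicator (cball 0 1) \<xi> \<partial>(lborel :: 'a measure))
      + (\<integral>\<^sup>+\<xi>. (\<Sum>k. ennreal (w k) * (indicator (A k) \<xi> * \<phi> \<xi>)) \<partial>lborel)"
    by (rule nn_integral_add) measurable
  also have "(\<integral>\<^sup>+\<xi>. (\<Sum>k. ennreal (w k) * (indicator (A k) \<xi> * \<phi> \<xi>)) \<partial>lborel)
      = (\<Sum>k. ennreal (w k) * (\<integral>\<^sup>+\<xi>. indicator (A k) \<xi> * \<phi> \<xi> \<partial>lborel))"
    by (subst nn_integral_suminf, measurable) (subst nn_integral_cmult, measurable)
  also have "(\<integral>\<^sup>+\<xi>. ennreal (2 powr \<bar>a\<bar>) * indicator (cball 0 1) \<xi> \<partial>(lborel :: 'a measure)) + (\<Sum>k. ennreal (w k) * (\<integral>\<^sup>+\<xi>. indicator (A k) \<xi> * \<phi> \<xi> \<partial>lborel)) < \<infinity>"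
  proof -
    have "(\<integral>\<^sup>+\<xi>. ennreal (2 powr \<bar>a\<bar>) * indicator (cball 0 1) \<xi> \<partial>(lborel :: 'a measure)) < \<infinity>"
      using emeasure_compact_finite[OF compact_cball[of "0::'a" 1]]
      by (subst nn_integral_cmult_indicator) (auto simp: ennreal_mult_less_top)
    moreover have "(\<Sum>k. ennreal (w k) * (\<integral>\<^sup>+\<xi>. indicator (A k) \<xi> * \<phi> \<xi> \<partial>lborel)) < \<infinity>"
    proof -
      have bk: "ennreal (w k) * (\<integral>\<^sup>+\<xi>. indicator (A k) \<xi> * \<phi> \<xi> \<partial>lborel) \<le> ennreal (2 powr \<bar>a\<bar> * D\<kappa> * 2 powr b * (2 powr b) ^ k)" for k
      proof -
        have R: "1 \<le> (2::real) ^ Suc k" by (rule one_le_power) simp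
        have "ennreal (w k) * (\<integral>\<^sup>+\<xi>. indicator (A k) \<xi> * \<phi> \<xi> \<partial>lborel)
            \<le> ennreal (w k) * ennreal (D\<kappa> * (2 ^ Suc k) powr (2 * real DIM('a) - s - t))"
          unfolding A_def \<phi>_def by (intro mult_left_mono fourier_transform_annulus_le[OF R]) simp
        also have "\<dots> = ennreal (w k * (D\<kappa> * (2 ^ Suc k) powr (2 * real DIM('a) - s - t)))"
          by (rule ennreal_mult'[symmetric]) (simp add: w_def)
        also have "w k * (D\<kappa> * (2 ^ Suc k) powr (2 * real DIM('a) - s - t)) = 2 powr \<bar>a\<bar> * D\<kappa> * ((2 ^ Suc k) powr a * (2 ^ Suc k) powr (2 * real DIM('a) - s - t))"
          by (simp add: w_def)
        also have "(2 ^ Suc k) powr a * (2 ^ Suc k) powr (2 * real DIM('a) - s - t) = (2 ^ Suc k) powr b"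
          unfolding powr_add[symmetric] b_def ..
        also have "(2 ^ Suc k) powr b = (2 powr b) ^ Suc k"
          by (simp only: powr_realpow[symmetric] powr_powr powr_gt_zero zero_less_numeral mult.commute zero_less_power)
        finally show ?thesis by (simp add: mult.assoc)
      qed
      have "(\<Sum>k. ennreal (w k) * (\<integral>\<^sup>+\<xi>. indicator (A k) \<xi> * \<phi> \<xi> \<partial>lborel)) \<le> (\<Sum>k. ennreal (2 powr \<bar>a\<bar> * D\<kappa> * 2 powr b * (2 powr b) ^ k))"
        by (intro suminf_le bk) auto
      also have "\<dots> = ennreal (\<Sum>k. 2 powr \<bar>a\<bar> * D\<kappa> * 2 powr b * (2 powr b) ^ k)"
      proof (rule suminf_ennreal2)
        have "2 powr b < 2 powr 0" using b by (intro powr_less_mono) auto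
        then show "summable (\<lambda>k. 2 powr \<bar>a\<bar> * D\<kappa> * 2 powr b * (2 powr b) ^ k)"
          by (intro summable_mult summable_geometric) simp
      qed (use D\<kappa>_nonneg in auto)
      also have "\<dots> < \<infinity>" by simp
      finally show ?thesis .
    qed
    ultimately show ?thesis by simp
  qed
  finally show ?thesis unfolding a_def .
qed

end

subsection \<open>Measures of finite Sobolev energy\<close>

text \<open>With y = r |x| one has 1 + |x| at most (1 + y) / r because \<open>r \<le> 1\<close>;
  then (1 + y)^a is at most exp (a y), and the square of a - y being non-negative absorbs the linear
  term into the Gaussian.\<close>

lemma gauss_powr_bound:
  fixes x :: "'a::real_normed_vector"
  assumes r: "0 < r" "r \<le> 1" and a: "0 \<le> a"
  shows "gauss (1 / r) x \<le> exp (a\<^sup>2) * r powr (- a) * (1 + norm x) powr (- a)"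
proof -
  define y where "y = r * norm x"
  have y: "0 \<le> y" using r by (simp add: y_def)
  have "1 + norm x \<le> (1 + y) / r" using r by (simp add: y_def field_simps)
  then have "(1 + norm x) powr a \<le> ((1 + y) / r) powr a" using a by (intro powr_mono2) auto
  also have "\<dots> = (1 + y) powr a * r powr (- a)"
    using r y by (simp add: powr_divide powr_minus_divide)
  finally have 1: "(1 + norm x) powr a \<le> (1 + y) powr a * r powr (- a)" .
  have "(1 + y) powr a \<le> exp y powr a" using y a by (intro powr_mono2) auto
  also have "\<dots> = exp (a * y)" by (simp add: powr_def)
  finally have 2: "(1 + y) powr a \<le> exp (a * y)" .
  have "a * y - pi * y\<^sup>2 \<le> a\<^sup>2"
  proof -
    have "0 \<le> (a - y)\<^sup>2" by simp
    then have "2 * (a * y) \<le> a\<^sup>2 + y\<^sup>2" by (simp add: power2_diff)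
    moreover have "y\<^sup>2 \<le> pi * y\<^sup>2" using pi_gt3 mult_right_mono[of 1 pi "y\<^sup>2"] by simp
    moreover have "0 \<le> a * y" using a y by simp
    ultimately show ?thesis by linarith
  qed
  then have 3: "exp (a * y) * exp (- (pi * y\<^sup>2)) \<le> exp (a\<^sup>2)" by (simp flip: exp_add)
  have g: "gauss (1 / r) x = exp (- (pi * y\<^sup>2))" by (simp add: gauss_def y_def mult.commute)
  have "(1 + norm x) powr a * gauss (1 / r) x \<le> (exp (a * y) * r powr (- a)) * exp (- (pi * y\<^sup>2))"
    unfolding g by (intro mult_right_mono order_trans[OF 1] 2) auto
  also have "\<dots> \<le> exp (a\<^sup>2) * r powr (- a)"
    using mult_right_mono[OF 3, of "r powr (- a)"] by (simp add: mult_ac)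
  finally have "(1 + norm x) powr a * gauss (1 / r) x \<le> exp (a\<^sup>2) * r powr (- a)" .
  moreover have "0 < 1 + norm x" by (simp add: add_pos_nonneg)
  then have "0 < (1 + norm x) powr a" by simp
  ultimately have "gauss (1 / r) x \<le> exp (a\<^sup>2) * r powr (- a) / (1 + norm x) powr a"
    by (simp add: pos_le_divide_eq mult.commute)
  then show ?thesis by (simp add: powr_minus_divide)
qed

text \<open>The bound on \<open>\<sigma>\<close> makes the weight in the energy non-increasing in
  the frequency, the shape with which \<open>gauss_powr_bound\<close> dominates a Gaussian.\<close>

locale sobolev_measure = prob_space \<kappa> for \<kappa> :: "'a::euclidean_space measure" +
  fixes \<sigma> :: real
  assumes \<kappa>_sets [measurable_cong]: "sets \<kappa> = sets borel"
    and \<sigma>: "\<sigma> \<le> real DIM('a)"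
    and sobolev_finite: "(\<integral>\<^sup>+\<xi>. ennreal ((cmod (fourier_transform \<kappa> \<xi>))\<^sup>2 * (1 + norm \<xi>) powr (\<sigma> - real DIM('a))) \<partial>lborel) < \<infinity>"
begin

lemma \<kappa>_space [simp]: "space \<kappa> = UNIV"
  using sets_eq_imp_space_eq[OF \<kappa>_sets] by simp

text \<open>The indicator of a ball of radius \<open>r\<close> is at most exp pi times a Gaussian of
  width \<open>r\<close>. On the Fourier side this becomes a Gaussian average of width 1 / r,
  dominated by the energy; the powers of \<open>r\<close> combine to d - (d - \<sigma>).\<close>

lemma correlation_bound:
  obtains C where "0 \<le> C" "\<And>r. 0 < r \<Longrightarrow> r \<le> 1 \<Longrightarrow> (\<integral>\<^sup>+x. emeasure \<kappa> (cball x r) \<partial>\<kappa>) \<le> ennreal (C * r powr \<sigma>)"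
proof -
  define a where "a = real DIM('a) - \<sigma>"
  have a: "0 \<le> a" using \<sigma> by (simp add: a_def)
  define I where "I = (\<integral>\<^sup>+\<xi>. ennreal ((cmod (fourier_transform \<kappa> \<xi>))\<^sup>2 * (1 + norm \<xi>) powr (- a)) \<partial>lborel)"
  have "I < \<infinity>" using sobolev_finite by (simp add: I_def a_def)
  then obtain J where J: "I = ennreal J" "0 \<le> J" by (cases I) auto
  have [measurable]: "fourier_transform \<kappa> \<in> borel_measurable borel"
    by (rule fourier_transform_measurable[OF finite_measure_axioms \<kappa>_sets])
  define C where "C = exp pi * (exp (a\<^sup>2) * J)"
  show thesis
  proof
    show "0 \<le> C" using J by (simp add: C_def)
    fix r :: real assume r: "0 < r" "r \<le> 1"
    define R where "R = 1 / r"
    have R: "0 < R" using r by (simp add: R_def)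
    have "(\<integral>\<^sup>+x. emeasure \<kappa> (cball x r) \<partial>\<kappa>) \<le> (\<integral>\<^sup>+x. (\<integral>\<^sup>+y. ennreal (exp pi) * ennreal (gauss 1 (R *\<^sub>R (x - y))) \<partial>\<kappa>) \<partial>\<kappa>)"
    proof (rule nn_integral_mono)
      fix x
      have "emeasure \<kappa> (cball x r) = (\<integral>\<^sup>+y. indicator (cball x r) y \<partial>\<kappa>)" by (simp add: \<kappa>_sets)
      also have "\<dots> \<le> (\<integral>\<^sup>+y. ennreal (exp pi) * ennreal (gauss 1 (R *\<^sub>R (x - y))) \<partial>\<kappa>)"
      proof (rule nn_integral_mono)
        fix y
        show "indicator (cball x r) y \<le> ennreal (exp pi) * ennreal (gauss 1 (R *\<^sub>R (x - y)))"
        proof (cases "y \<in> cball x r")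
          case True
          then have "norm (R *\<^sub>R (x - y)) \<le> 1" using r by (simp add: R_def dist_norm)
          then have "exp (- pi) \<le> gauss 1 (R *\<^sub>R (x - y))" by (rule gauss_ge) simp
          then have "exp pi * exp (- pi) \<le> exp pi * gauss 1 (R *\<^sub>R (x - y))" by simp
          then have "1 \<le> exp pi * gauss 1 (R *\<^sub>R (x - y))" by (simp flip: exp_add)
          then show ?thesis using True by (simp flip: ennreal_mult)
        qed simp
      qed
      finally show "emeasure \<kappa> (cball x r) \<le> (\<integral>\<^sup>+y. ennreal (exp pi) * ennreal (gauss 1 (R *\<^sub>R (x - y))) \<partial>\<kappa>)" .
    qed
    also have "\<dots> = (\<integral>\<^sup>+x. ennreal (exp pi) * (\<integral>\<^sup>+y. ennreal (gauss 1 (R *\<^sub>R (x - y))) \<partial>\<kappa>) \<partial>\<kappa>)"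
      by (intro nn_integral_cong nn_integral_cmult) measurable
    also have "\<dots> = ennreal (exp pi) * (\<integral>\<^sup>+x. (\<integral>\<^sup>+y. ennreal (gauss 1 (R *\<^sub>R (x - y))) \<partial>\<kappa>) \<partial>\<kappa>)"
      by (rule nn_integral_cmult) measurable
    also have "\<dots> = ennreal (exp pi) * (ennreal (1 / R ^ DIM('a)) * (\<integral>\<^sup>+\<xi>. ennreal (gauss R \<xi> * (norm (fourier_transform \<kappa> \<xi>))\<^sup>2) \<partial>lborel))"
      unfolding gauss_form_prob[OF prob_space_axioms \<kappa>_sets R] ..
    also have "\<dots> \<le> ennreal (exp pi) * (ennreal (1 / R ^ DIM('a)) * (\<integral>\<^sup>+\<xi>. ennreal (exp (a\<^sup>2) * r powr (- a)) * ennreal ((cmod (fourier_transform \<kappa> \<xi>))\<^sup>2 * (1 + norm \<xi>) powr (- a)) \<partial>lborel))"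
    proof (intro mult_left_mono nn_integral_mono)
      fix \<xi> :: 'a
      have "gauss R \<xi> * (norm (fourier_transform \<kappa> \<xi>))\<^sup>2 \<le> (exp (a\<^sup>2) * r powr (- a) * (1 + norm \<xi>) powr (- a)) * (norm (fourier_transform \<kappa> \<xi>))\<^sup>2"
        unfolding R_def by (intro mult_right_mono gauss_powr_bound r a) simp
      then show "ennreal (gauss R \<xi> * (norm (fourier_transform \<kappa> \<xi>))\<^sup>2)
          \<le> ennreal (exp (a\<^sup>2) * r powr (- a)) * ennreal ((cmod (fourier_transform \<kappa> \<xi>))\<^sup>2 * (1 + norm \<xi>) powr (- a))"
        by (simp add: ennreal_leI mult_ac flip: ennreal_mult)
    qed auto
    also have "\<dots> = ennreal (exp pi) * (ennreal (1 / R ^ DIM('a)) * (ennreal (exp (a\<^sup>2) * r powr (- a)) * I))"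
      unfolding I_def by (subst nn_integral_cmult) auto
    also have "\<dots> = ennreal (exp pi * (1 / R ^ DIM('a) * (exp (a\<^sup>2) * r powr (- a) * J)))"
      using R J by (simp add: ennreal_mult[symmetric] mult.assoc)
    also have "exp pi * (1 / R ^ DIM('a) * (exp (a\<^sup>2) * r powr (- a) * J)) = C * (r powr real DIM('a) * r powr (- a))"
      using r by (simp add: R_def C_def power_divide powr_realpow)
    also have "r powr real DIM('a) * r powr (- a) = r powr \<sigma>"
      unfolding powr_add[symmetric] by (simp add: a_def)
    finally show "(\<integral>\<^sup>+x. emeasure \<kappa> (cball x r) \<partial>\<kappa>) \<le> ennreal (C * r powr \<sigma>)" .
  qed
qed

lemma emeasure_cball_measurable [measurable]: "(\<lambda>x. emeasure \<kappa> (cball x r)) \<in> borel_measurable borel"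
proof -
  have "(\<lambda>x. \<integral>\<^sup>+y. indicator {p. dist (fst p) (snd p) \<le> r} (x, y) \<partial>\<kappa>) \<in> borel_measurable borel" by measurable
  moreover have "(\<integral>\<^sup>+y. indicator {p. dist (fst p) (snd p) \<le> r} (x, y) \<partial>\<kappa>) = emeasure \<kappa> (cball x r)" for x
  proof -
    have "(\<integral>\<^sup>+y. indicator {p. dist (fst p) (snd p) \<le> r} (x, y) \<partial>\<kappa>) = (\<integral>\<^sup>+y. indicator (cball x r) y \<partial>\<kappa>)"
      by (intro nn_integral_cong) (auto simp: indicator_def)
    then show ?thesis by (simp add: \<kappa>_sets)
  qed
  ultimately show ?thesis by simp
qed

text \<open>The correlation bound at dyadic radii, weighted by 2^(v k), is summable because
  \<open>v < \<sigma>\<close>. So \<open>\<theta>\<close> is finite almost everywhere, and on some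
  set \<open>G N\<close> of positive mass all balls satisfy a bound of order r^v. The mass
  distribution principle for this set concludes.\<close>

theorem hausdorff_measure_neq_0:
  assumes v: "0 < v" "v < \<sigma>" and K: "K \<in> sets borel" "emeasure \<kappa> K = 1" "K \<subseteq> A"
  shows "hausdorff_measure v A \<noteq> 0"
proof
  assume H0: "hausdorff_measure v A = 0"
  obtain C where C: "0 \<le> C" "\<And>r. 0 < r \<Longrightarrow> r \<le> 1 \<Longrightarrow> (\<integral>\<^sup>+x. emeasure \<kappa> (cball x r) \<partial>\<kappa>) \<le> ennreal (C * r powr \<sigma>)"
    by (rule correlation_bound) blast
  define \<theta> where "\<theta> = (\<lambda>x. \<Sum>k. ennreal (2 powr (v * real k)) * emeasure \<kappa> (cball x ((1/2) ^ k)))"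
  have m\<theta> [measurable]: "\<theta> \<in> borel_measurable borel" unfolding \<theta>_def by measurable
  have "(\<integral>\<^sup>+x. \<theta> x \<partial>\<kappa>) = (\<Sum>k. ennreal (2 powr (v * real k)) * (\<integral>\<^sup>+x. emeasure \<kappa> (cball x ((1/2) ^ k)) \<partial>\<kappa>))"
    unfolding \<theta>_def by (subst nn_integral_suminf, measurable) (subst nn_integral_cmult, measurable)
  also have "\<dots> \<le> (\<Sum>k. ennreal (C * (2 powr (v - \<sigma>)) ^ k))"
  proof (intro suminf_le)
    fix k :: nat
    have "ennreal (2 powr (v * real k)) * (\<integral>\<^sup>+x. emeasure \<kappa> (cball x ((1/2) ^ k)) \<partial>\<kappa>)
        \<le> ennreal (2 powr (v * real k)) * ennreal (C * ((1/2) ^ k) powr \<sigma>)"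
      by (intro mult_left_mono C(2)) (auto simp: power_le_one)
    also have "\<dots> = ennreal (C * (2 powr (v * real k) * ((1/2) ^ k) powr \<sigma>))"
      using C(1) by (simp add: mult_ac flip: ennreal_mult)
    also have "2 powr (v * real k) * ((1/2) ^ k) powr \<sigma> = (2 powr (v - \<sigma>)) ^ k"
    proof -
      have "((1/2::real) ^ k) powr \<sigma> = 2 powr (- \<sigma> * real k)"
      proof -
        have "(1/2::real) ^ k = 2 powr (- real k)" by (simp add: powr_minus powr_realpow power_divide inverse_eq_divide)
        then show ?thesis by (simp add: powr_powr mult.commute)
      qed
      then have "2 powr (v * real k) * ((1/2) ^ k) powr \<sigma> = 2 powr ((v - \<sigma>) * real k)"
        by (simp add: powr_add[symmetric] left_diff_distrib)
      also have "\<dots> = (2 powr (v - \<sigma>)) ^ k" by (simp add: powr_powr[symmetric] powr_realpow)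
      finally show ?thesis .
    qed
    finally show "ennreal (2 powr (v * real k)) * (\<integral>\<^sup>+x. emeasure \<kappa> (cball x ((1/2) ^ k)) \<partial>\<kappa>) \<le> ennreal (C * (2 powr (v - \<sigma>)) ^ k)" .
  qed auto
  also have "\<dots> = ennreal (\<Sum>k. C * (2 powr (v - \<sigma>)) ^ k)"
  proof (rule suminf_ennreal2)
    have "2 powr (v - \<sigma>) < 2 powr 0" using v by (intro powr_less_mono) auto
    then show "summable (\<lambda>k. C * (2 powr (v - \<sigma>)) ^ k)" by (intro summable_mult summable_geometric) simp
  qed (use C in auto)
  also have "\<dots> < \<infinity>" by simp
  finally have "(\<integral>\<^sup>+x. \<theta> x \<partial>\<kappa>) \<noteq> \<infinity>" by simp
  then have fin: "AE x in \<kappa>. \<theta> x \<noteq> \<infinity>" by (intro nn_integral_PInf_AE) auto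
  define G where "G = (\<lambda>N::nat. {x \<in> K. \<theta> x \<le> of_nat N})"
  have "\<exists>N. emeasure \<kappa> (G N) \<noteq> 0"
  proof (rule ccontr)
    assume "\<not> ?thesis"
    then have nz: "\<And>N. emeasure \<kappa> (G N) = 0" by blast
    have mG: "G N \<in> sets \<kappa>" for N unfolding G_def \<kappa>_sets using K(1) by measurable
    have "(\<Union>N. G N) \<in> null_sets \<kappa>" by (intro null_sets_UN null_setsI nz mG)
    then have "AE x in \<kappa>. x \<notin> (\<Union>N. G N)" by (rule AE_not_in)
    moreover have "AE x in \<kappa>. x \<in> K" using K(1,2) by (intro AE_prob_1) (simp add: measure_def)
    ultimately have "AE x in \<kappa>. False"
      using fin
    proof eventually_elim
      fix x assume x: "x \<notin> (\<Union>N. G N)" "x \<in> K" "\<theta> x \<noteq> \<infinity>"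
      obtain y where y: "\<theta> x = ennreal y" using x(3) by (cases "\<theta> x") auto
      obtain N where "y \<le> real N" using real_arch_simple by blast
      then have "\<theta> x \<le> of_nat N" unfolding y ennreal_of_nat_eq_real_of_nat by (rule ennreal_leI)
      then have "x \<in> G N" using x by (simp add: G_def)
      then show False using x by blast
    qed
    then show False by simp
  qed
  then obtain N where N: "emeasure \<kappa> (G N) \<noteq> 0" by blast
  define p where "p = measure \<kappa> (G N)"
  have p: "0 < p" using N unfolding p_def emeasure_eq_measure by (simp add: zero_less_measure_iff)
  have ball_k: "emeasure \<kappa> (cball x ((1/2) ^ k)) \<le> ennreal (real N * 2 powr (- (v * real k)))" if x: "x \<in> G N" for x k
  proof -
    have "ennreal (2 powr (v * real k)) * emeasure \<kappa> (cball x ((1/2) ^ k))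
        = (\<Sum>k\<in>{k}. ennreal (2 powr (v * real k)) * emeasure \<kappa> (cball x ((1/2) ^ k)))" by simp
    also have "\<dots> \<le> \<theta> x" unfolding \<theta>_def by (rule sum_le_suminf) auto
    also have "\<dots> \<le> ennreal (real N)" using x by (simp add: G_def ennreal_of_nat_eq_real_of_nat)
    finally have "ennreal (2 powr (v * real k) * measure \<kappa> (cball x ((1/2) ^ k))) \<le> ennreal (real N)"
      by (simp add: emeasure_eq_measure ennreal_mult)
    then have "2 powr (v * real k) * measure \<kappa> (cball x ((1/2) ^ k)) \<le> real N" by (simp add: ennreal_le_iff)
    then have "measure \<kappa> (cball x ((1/2) ^ k)) \<le> real N * 2 powr (- (v * real k))"
      by (simp add: powr_minus_divide pos_le_divide_eq mult.commute)
    then show ?thesis unfolding emeasure_eq_measure by (rule ennreal_leI)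
  qed
  have ball: "emeasure \<kappa> (cball x r) \<le> ennreal (real N * 2 powr v * r powr v)" if x: "x \<in> G N" and r: "0 \<le> r" "r < 1" for x r
  proof (cases "r = 0")
    \<comment> \<open>Radius 0 occurs for covering sets with a single point, which contribute 0 to
      the covering sum; their mass must be shown to vanish, by letting the dyadic radius tend to
      0.\<close>
    case True
    have "(\<lambda>k. real N * (2 powr (- v)) ^ k) \<longlonglongrightarrow> real N * 0"
    proof (intro tendsto_mult_left LIMSEQ_realpow_zero)
      have "2 powr (- v) < 2 powr 0" using v by (intro powr_less_mono) auto
      then show "2 powr (- v) < 1" by simp
    qed simp
    moreover have "measure \<kappa> (cball x r) \<le> real N * (2 powr (- v)) ^ k" for k
    proof -
      have "emeasure \<kappa> (cball x r) \<le> emeasure \<kappa> (cball x ((1/2) ^ k))"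
        using True by (intro emeasure_mono) (auto simp: \<kappa>_sets)
      also note ball_k[OF x, of k]
      also have "2 powr (- (v * real k)) = (2 powr (- v)) ^ k" 
        by (subst powr_realpow[symmetric]) (simp_all add: powr_powr)
      finally show ?thesis unfolding emeasure_eq_measure by (subst (asm) ennreal_le_iff) auto
    qed
    ultimately have "measure \<kappa> (cball x r) \<le> real N * 0" by (intro LIMSEQ_le_const) auto
    then show ?thesis by (simp add: emeasure_eq_measure ennreal_neg)
  next
    case False
    then have r: "0 < r" "r < 1" using r by auto
    obtain n where "(1/2) ^ n < r" using real_arch_pow_inv[OF r(1), of "1/2"] by auto
    then obtain k where k: "\<not> (1/2) ^ k < r" "(1/2) ^ Suc k < r"
      using ex_least_nat_less[of "\<lambda>k. (1/2) ^ k < r" n] r by auto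
    have "emeasure \<kappa> (cball x r) \<le> emeasure \<kappa> (cball x ((1/2) ^ k))"
      using k by (intro emeasure_mono) (auto simp: \<kappa>_sets)
    also note ball_k[OF x, of k]
    also have "ennreal (real N * 2 powr (- (v * real k))) \<le> ennreal (real N * 2 powr v * r powr v)"
    proof (intro ennreal_leI)
      have "2 powr (- real k) = (1/2) ^ k" by (simp add: powr_minus powr_realpow power_divide inverse_eq_divide)
      then have "2 powr (- real k) \<le> 2 * r" using k by simp
      then have "(2 powr (- real k)) powr v \<le> (2 * r) powr v" using v by (intro powr_mono2) auto
      then have "2 powr (- (v * real k)) \<le> 2 powr v * r powr v" using r by (simp add: powr_powr powr_mult mult.commute)
      then show "real N * 2 powr (- (v * real k)) \<le> real N * 2 powr v * r powr v"
        by (simp add: mult.assoc mult_left_mono)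
    qed
    finally show ?thesis .
  qed
  define Q where "Q = real N * 2 powr v"
  have Q: "0 \<le> Q" by (simp add: Q_def)
  \<comment> \<open>Any cover of total below \<open>\<epsilon>\<close> would give \<open>G N\<close>
    mass at most p / 2.\<close>
  define \<epsilon> where "\<epsilon> = p / (2 * (Q + 1))"
  have \<epsilon>: "0 < \<epsilon>" using p Q by (simp add: \<epsilon>_def)
  \<comment> \<open>Scale 1/2 keeps every covering diameter below 1, the range in which
    \<open>ball\<close> applies.\<close>
  have "hausdorff_premeasure v (1/2) A \<le> hausdorff_measure v A"
    unfolding hausdorff_measure_def by (rule SUP_upper) simp
  then have "hausdorff_premeasure v (1/2) A < ennreal \<epsilon>" using H0 \<epsilon> by simp
  then obtain U where U: "A \<subseteq> (\<Union>i. U i)" "\<And>i. bounded (U i)" "\<And>i. diameter (U i) \<le> 1/2"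
    "(\<Sum>i. diam_pow v (U i)) < ennreal \<epsilon>"
    unfolding hausdorff_premeasure_def INF_less_iff by auto
  \<comment> \<open>The covering sets are arbitrary, possibly non-measurable, and the ball bound
    holds only at centres in \<open>G N\<close>; each set meeting \<open>G N\<close> is replaced by
    a closed ball around one of its points there.\<close>
  define B where "B = (\<lambda>i. if U i \<inter> G N = {} then {} else cball (SOME x. x \<in> U i \<inter> G N) (diameter (U i)))"
  have B: "U i \<inter> G N \<subseteq> B i \<and> emeasure \<kappa> (B i) \<le> ennreal Q * diam_pow v (U i)" for i
  proof (cases "U i \<inter> G N = {}")
    case False
    define x where "x = (SOME x. x \<in> U i \<inter> G N)"
    have "\<exists>x. x \<in> U i \<inter> G N" using False by blast
    then have x: "x \<in> U i \<inter> G N" unfolding x_def by (rule someI_ex)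
    have Bx: "B i = cball x (diameter (U i))" using False by (simp add: B_def x_def)
    have "U i \<subseteq> cball x (diameter (U i))" using x diameter_bounded_bound[OF U(2)[of i]] by auto
    moreover have "emeasure \<kappa> (B i) \<le> ennreal (Q * diameter (U i) powr v)"
      unfolding Bx Q_def using x U(3)[of i] diameter_ge_0[OF U(2)[of i]] by (intro ball) auto
    ultimately show ?thesis using x v Q unfolding Bx by (auto simp: diam_pow_def ennreal_mult)
  qed (simp add: B_def)
  have mB: "B i \<in> sets \<kappa>" for i by (simp add: B_def \<kappa>_sets)
  have "G N \<subseteq> (\<Union>i. B i)"
  proof
    fix x assume x: "x \<in> G N"
    then have "x \<in> A" using K(3) by (auto simp: G_def)
    then obtain i where "x \<in> U i" using U(1) by blast
    then show "x \<in> (\<Union>i. B i)" using B[of i] x by blast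
  qed
  then have "emeasure \<kappa> (G N) \<le> emeasure \<kappa> (\<Union>i. B i)" using mB by (intro emeasure_mono) auto
  also have "\<dots> \<le> (\<Sum>i. emeasure \<kappa> (B i))" using mB by (intro emeasure_subadditive_countably) auto
  also have "\<dots> \<le> (\<Sum>i. ennreal Q * diam_pow v (U i))" using B by (intro suminf_le) auto
  also have "\<dots> = ennreal Q * (\<Sum>i. diam_pow v (U i))" by (rule ennreal_suminf_cmult)
  also have "\<dots> \<le> ennreal Q * ennreal \<epsilon>" using U(4) by (intro mult_left_mono) auto
  also have "\<dots> = ennreal (Q * \<epsilon>)" using Q by (simp add: ennreal_mult')
  finally have "p \<le> Q * \<epsilon>"
    unfolding emeasure_eq_measure p_def using Q \<epsilon> by (subst (asm) ennreal_le_iff) auto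
  also have "\<dots> \<le> (Q + 1) * \<epsilon>" using \<epsilon> by simp
  also have "\<dots> = p / 2"
  proof -
    have "Q + 1 \<noteq> 0" using Q by simp
    then show ?thesis by (simp add: \<epsilon>_def field_simps)
  qed
  finally show False using p by simp
qed

end

context sobolev_measure
begin

text \<open>At the exponent d the averages of \<open>\<kappa>\<close> over balls of radius
  \<open>r\<close> are bounded in L2 uniformly in \<open>r\<close>. Cauchy-Schwarz on the
  neighbourhood \<open>T r\<close> of \<open>K\<close> then bounds its volume from below
  independently of \<open>r\<close>, and these neighbourhoods shrink to \<open>K\<close>. No density
  of \<open>\<kappa>\<close> has to be constructed.\<close>

theorem emeasure_lborel_compact_pos:
  assumes \<sigma>d: "\<sigma> = real DIM('a)" and K: "compact K" "emeasure \<kappa> K = 1"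
  shows "0 < emeasure lborel K"
proof -
  obtain C where C: "0 \<le> C" "\<And>r. 0 < r \<Longrightarrow> r \<le> 1 \<Longrightarrow> (\<integral>\<^sup>+x. emeasure \<kappa> (cball x r) \<partial>\<kappa>) \<le> ennreal (C * r powr \<sigma>)"
    by (rule correlation_bound) blast
  have Kne: "K \<noteq> {}" using K by auto
  have Kcl: "closed K" using K(1) by (rule compact_imp_closed)
  then have [measurable]: "K \<in> sets borel" by simp
  define n where "n = DIM('a)"
  define u where "u = unit_ball_vol (real n)"
  have u: "0 < u" by (simp add: u_def)
  interpret P: pair_sigma_finite \<kappa> "lborel :: 'a measure" ..
  interpret KK: finite_measure "\<kappa> \<Otimes>\<^sub>M \<kappa>" by (intro finite_measure_pair_measure finite_measure_axioms)
  interpret PP: pair_sigma_finite "\<kappa> \<Otimes>\<^sub>M \<kappa>" "lborel :: 'a measure" ..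
  define D where "D = (\<lambda>r. {p :: 'a \<times> 'a. dist (fst p) (snd p) \<le> r})"
  have D: "indicator (D r) (x, y) = (indicator (cball x r) y :: ennreal)" "indicator (D r) (x, y) = (indicator (cball y r) x :: ennreal)" for r x y
    by (auto simp: D_def indicator_def dist_commute)
  have [measurable]: "D r \<in> sets (borel \<Otimes>\<^sub>M borel)" for r
    unfolding borel_prod D_def by (intro borel_closed closed_Collect_le continuous_intros)
  have vol: "emeasure lborel (cball (x::'a) r) = ennreal (u * r ^ n)" if "0 \<le> r" for x r
    using that by (simp add: emeasure_cball u_def n_def)
  define T where "T = (\<lambda>r. {y. infdist y K \<le> r})"
  have Tcl: "closed (T r)" for r
    unfolding T_def by (intro closed_Collect_le continuous_intros)
  then have [measurable]: "T r \<in> sets borel" for r by simp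
  have main: "ennreal u \<le> emeasure lborel (T r) * ennreal (C * 2 ^ n)" if r: "0 < r" "2 * r \<le> 1" for r
  proof -
    define V where "V = ennreal (u * r ^ n)"
    have rn: "0 < r ^ n" using r by simp
    then have "0 < u * r ^ n" using u by simp
    then have V: "V \<noteq> 0" "V \<noteq> \<top>" by (auto simp: V_def ennreal_eq_0_iff)
    have "V = (\<integral>\<^sup>+x. indicator K x * V \<partial>\<kappa>)"
      using K by (subst nn_integral_multc) auto
    also have "\<dots> = (\<integral>\<^sup>+x. (\<integral>\<^sup>+y. indicator K x * indicator (D r) (x, y) \<partial>lborel) \<partial>\<kappa>)"
    proof (intro nn_integral_cong)
      fix x :: 'a
      have "(\<integral>\<^sup>+y. indicator (cball x r) y \<partial>lborel) = V"
        using r by (simp add: vol V_def)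
      then show "indicator K x * V = (\<integral>\<^sup>+y. indicator K x * indicator (D r) (x, y) \<partial>lborel)"
        unfolding D(1) by (subst nn_integral_cmult) (auto intro!: borel_measurable_indicator)
    qed
    also have "\<dots> = (\<integral>\<^sup>+y. (\<integral>\<^sup>+x. indicator K x * indicator (D r) (x, y) \<partial>\<kappa>) \<partial>lborel)"
      by (rule P.Fubini'[symmetric]) measurable
    \<comment> \<open>A ball of radius \<open>r\<close> centred in \<open>K\<close> stays inside
      \<open>T r\<close>, so all the averaged mass of \<open>K\<close> is seen there.\<close>
    also have "\<dots> \<le> (\<integral>\<^sup>+y. indicator (T r) y * emeasure \<kappa> (cball y r) \<partial>lborel)"
    proof (rule nn_integral_mono)
      fix y :: 'a
      have "(\<integral>\<^sup>+x. indicator K x * indicator (D r) (x, y) \<partial>\<kappa>) \<le> (\<integral>\<^sup>+x. indicator (T r) y * indicator (cball y r) x \<partial>\<kappa>)"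
      proof (rule nn_integral_mono)
        fix x
        show "indicator K x * indicator (D r) (x, y) \<le> (indicator (T r) y * indicator (cball y r) x :: ennreal)"
        proof (cases "x \<in> K \<and> x \<in> cball y r")
          case True
          then have "infdist y K \<le> r" using infdist_le[of x K y] by simp
          then show ?thesis using True unfolding D(2) by (simp add: T_def)
        next
          case False
          then show ?thesis unfolding D(2) by (auto simp: indicator_def)
        qed
      qed
      also have "\<dots> = indicator (T r) y * emeasure \<kappa> (cball y r)"
        by (rule nn_integral_cmult_indicator) (simp add: \<kappa>_sets)
      finally show "(\<integral>\<^sup>+x. indicator K x * indicator (D r) (x, y) \<partial>\<kappa>) \<le> indicator (T r) y * emeasure \<kappa> (cball y r)" .
    qed
    finally have "V\<^sup>2 \<le> (\<integral>\<^sup>+y. indicator (T r) y * emeasure \<kappa> (cball y r) \<partial>lborel)\<^sup>2" by (rule power_mono) simp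
    also have "\<dots> \<le> (\<integral>\<^sup>+y. (indicator (T r) y)\<^sup>2 \<partial>lborel) * (\<integral>\<^sup>+y. (emeasure \<kappa> (cball y r))\<^sup>2 \<partial>lborel)"
      by (rule Cauchy_Schwarz_nn_integral) measurable
    also have "(\<integral>\<^sup>+y. (indicator (T r) y)\<^sup>2 \<partial>lborel) = (\<integral>\<^sup>+y. indicator (T r) y \<partial>lborel)"
      by (intro nn_integral_cong) (auto simp: indicator_def)
    also have "\<dots> = emeasure lborel (T r)" by simp
    \<comment> \<open>The square becomes an integral over pairs of points. A pair within
      \<open>r\<close> of a common \<open>y\<close> is at distance at most 2 r, and such
      \<open>y\<close> fill volume at most \<open>V\<close>, so the correlation bound applies to
      what is left.\<close>
    also have "(\<integral>\<^sup>+y. (emeasure \<kappa> (cball y r))\<^sup>2 \<partial>lborel)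
        = (\<integral>\<^sup>+y. (\<integral>\<^sup>+q. indicator (D r) (fst q, y) * indicator (D r) (snd q, y) \<partial>(\<kappa> \<Otimes>\<^sub>M \<kappa>)) \<partial>lborel)"
    proof (intro nn_integral_cong)
      fix y :: 'a
      have e: "(\<integral>\<^sup>+x. indicator (D r) (x, y) \<partial>\<kappa>) = emeasure \<kappa> (cball y r)"
        unfolding D(2) by (simp add: \<kappa>_sets)
      have "(\<lambda>q. indicator (D r) (fst q, y) * indicator (D r) (snd q, y) :: ennreal) \<in> borel_measurable (\<kappa> \<Otimes>\<^sub>M \<kappa>)" by measurable
      from nn_integral_fst[OF this]
      have "(\<integral>\<^sup>+q. indicator (D r) (fst q, y) * indicator (D r) (snd q, y) \<partial>(\<kappa> \<Otimes>\<^sub>M \<kappa>))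
          = (\<integral>\<^sup>+x. (\<integral>\<^sup>+x'. indicator (D r) (x, y) * indicator (D r) (x', y) \<partial>\<kappa>) \<partial>\<kappa>)" by simp
      also have "\<dots> = (\<integral>\<^sup>+x. indicator (D r) (x, y) * emeasure \<kappa> (cball y r) \<partial>\<kappa>)"
        unfolding e[symmetric] by (intro nn_integral_cong nn_integral_cmult) measurable
      also have "\<dots> = (emeasure \<kappa> (cball y r))\<^sup>2"
        unfolding power2_eq_square by (subst nn_integral_multc) (measurable, simp add: e)
      finally show "(emeasure \<kappa> (cball y r))\<^sup>2 = (\<integral>\<^sup>+q. indicator (D r) (fst q, y) * indicator (D r) (snd q, y) \<partial>(\<kappa> \<Otimes>\<^sub>M \<kappa>))" ..
    qed
    also have "\<dots> = (\<integral>\<^sup>+q. (\<integral>\<^sup>+y. indicator (D r) (fst q, y) * indicator (D r) (snd q, y) \<partial>lborel) \<partial>(\<kappa> \<Otimes>\<^sub>M \<kappa>))"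
      by (rule PP.Fubini') measurable
    also have "\<dots> \<le> (\<integral>\<^sup>+q. indicator (D (2 * r)) q * V \<partial>(\<kappa> \<Otimes>\<^sub>M \<kappa>))"
    proof (rule nn_integral_mono)
      fix q :: "'a \<times> 'a"
      have "(\<integral>\<^sup>+y. indicator (D r) (fst q, y) * indicator (D r) (snd q, y) \<partial>lborel) \<le> (\<integral>\<^sup>+y. indicator (D (2 * r)) q * indicator (cball (fst q) r) y \<partial>lborel)"
      proof (rule nn_integral_mono)
        fix y :: 'a
        have "q \<in> D (2 * r)" if "dist (fst q) y \<le> r" "dist (snd q) y \<le> r"
          using dist_triangle2[of "fst q" "snd q" y] that by (simp add: D_def)
        then show "indicator (D r) (fst q, y) * indicator (D r) (snd q, y) \<le> (indicator (D (2 * r)) q * indicator (cball (fst q) r) y :: ennreal)"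
          unfolding D(1) by (auto simp: indicator_def)
      qed
      also have "\<dots> = indicator (D (2 * r)) q * V"
        using r by (subst nn_integral_cmult_indicator) (auto simp: vol V_def)
      finally show "(\<integral>\<^sup>+y. indicator (D r) (fst q, y) * indicator (D r) (snd q, y) \<partial>lborel) \<le> indicator (D (2 * r)) q * V" .
    qed
    also have "\<dots> = (\<integral>\<^sup>+q. indicator (D (2 * r)) q \<partial>(\<kappa> \<Otimes>\<^sub>M \<kappa>)) * V"
      by (rule nn_integral_multc) measurable
    also have "(\<integral>\<^sup>+q. indicator (D (2 * r)) q \<partial>(\<kappa> \<Otimes>\<^sub>M \<kappa>)) = (\<integral>\<^sup>+x. emeasure \<kappa> (cball x (2 * r)) \<partial>\<kappa>)"
    proof -
      have "(\<lambda>q. indicator (D (2 * r)) q :: ennreal) \<in> borel_measurable (\<kappa> \<Otimes>\<^sub>M \<kappa>)" by measurable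
      from nn_integral_fst[OF this] show ?thesis unfolding D(1) by (simp add: \<kappa>_sets)
    qed
    also have "\<dots> \<le> ennreal (C * (2 * r) powr \<sigma>)" by (rule C(2)) (use r in auto)
    also have "C * (2 * r) powr \<sigma> = C * 2 ^ n * r ^ n"
      using r by (simp add: \<sigma>d n_def powr_realpow power_mult_distrib)
    finally have "V * V \<le> (emeasure lborel (T r) * ennreal (C * 2 ^ n * r ^ n)) * V"
      by (simp add: power2_eq_square mult_left_mono mult_right_mono mult.assoc)
    then have "V \<le> emeasure lborel (T r) * ennreal (C * 2 ^ n * r ^ n)"
      using V by (metis ennreal_mult_le_mult_iff mult.commute)
    also have "\<dots> = (emeasure lborel (T r) * ennreal (C * 2 ^ n)) * ennreal (r ^ n)"
      using r C(1) by (simp add: ennreal_mult mult.assoc)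
    finally have "ennreal (r ^ n) * ennreal u \<le> ennreal (r ^ n) * (emeasure lborel (T r) * ennreal (C * 2 ^ n))"
      using r u by (simp add: V_def ennreal_mult mult.commute)
    moreover have "ennreal (r ^ n) \<noteq> 0" using rn by (simp add: ennreal_eq_0_iff)
    ultimately show ?thesis by (subst (asm) ennreal_mult_le_mult_iff) auto
  qed
  define \<rho> where "\<rho> = (\<lambda>i::nat. 1 / (real i + 2))"
  have \<rho>: "0 < \<rho> i" "2 * \<rho> i \<le> 1" for i by (auto simp: \<rho>_def field_simps)
  have dec: "decseq (\<lambda>i. T (\<rho> i))"
  proof (rule decseq_SucI)
    fix i
    have "\<rho> (Suc i) \<le> \<rho> i" unfolding \<rho>_def by (intro frac_le) auto
    then show "T (\<rho> (Suc i)) \<subseteq> T (\<rho> i)" by (auto simp: T_def)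
  qed
  have int: "(\<Inter>i. T (\<rho> i)) = K"
  proof
    show "K \<subseteq> (\<Inter>i. T (\<rho> i))" using \<rho>(1)[THEN less_imp_le] by (auto simp: T_def)
    show "(\<Inter>i. T (\<rho> i)) \<subseteq> K"
    proof
      fix x assume x: "x \<in> (\<Inter>i. T (\<rho> i))"
      have "\<rho> \<longlonglongrightarrow> 0"
        unfolding \<rho>_def using LIMSEQ_ignore_initial_segment[OF lim_1_over_n[where 'a = real], of 2] by (simp add: add.commute)
      moreover have "infdist x K \<le> \<rho> i" for i using x by (auto simp: T_def)
      ultimately have "infdist x K \<le> 0" by (intro LIMSEQ_le_const) auto
      then have "infdist x K = 0" using infdist_nonneg[of x K] by simp
      then show "x \<in> K" using in_closed_iff_infdist_zero[OF Kcl Kne] by simp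
    qed
  qed
  obtain b where b: "\<And>x. x \<in> K \<Longrightarrow> norm x \<le> b" using compact_imp_bounded[OF K(1)] by (auto simp: bounded_iff)
  have "T (\<rho> i) \<subseteq> cball 0 (b + 2)" for i
  proof
    fix y assume y: "y \<in> T (\<rho> i)"
    obtain x where x: "x \<in> K" "infdist y K = dist y x" using infdist_attains_inf[OF Kcl Kne] by metis
    have "norm y \<le> norm x + dist y x" using norm_triangle_sub[of y x] by (simp add: dist_norm)
    then show "y \<in> cball 0 (b + 2)" using x y b[OF x(1)] \<rho>(2)[of i] by (auto simp: T_def)
  qed
  then have "emeasure lborel (T (\<rho> i)) \<le> emeasure lborel (cball (0::'a) (b + 2))" for i
    by (intro emeasure_mono) auto
  then have finT: "emeasure lborel (T (\<rho> i)) \<noteq> \<infinity>" for i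
    using emeasure_compact_finite[OF compact_cball[of "0::'a" "b + 2"]] by (metis infinity_ennreal_def less_top order_le_less_trans)
  have "(INF i. emeasure lborel (T (\<rho> i))) = emeasure lborel K"
    unfolding int[symmetric] by (intro INF_emeasure_decseq dec finT) auto
  show ?thesis
  proof (rule ccontr)
    assume "\<not> ?thesis"
    then have K0: "(INF i. emeasure lborel (T (\<rho> i))) = 0" using \<open>(INF i. emeasure lborel (T (\<rho> i))) = emeasure lborel K\<close> by simp
    define \<epsilon> where "\<epsilon> = u / (2 * (C * 2 ^ n + 1))"
    have pos: "0 < C * 2 ^ n + 1" using C(1) by (simp add: add_nonneg_pos)
    have \<epsilon>: "0 < \<epsilon>" using u pos by (simp add: \<epsilon>_def)
    have "(INF i. emeasure lborel (T (\<rho> i))) < ennreal \<epsilon>" using K0 \<epsilon> by simp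
    then obtain i where i: "emeasure lborel (T (\<rho> i)) < ennreal \<epsilon>" unfolding INF_less_iff by blast
    have "ennreal u \<le> ennreal \<epsilon> * ennreal (C * 2 ^ n)"
      using main[OF \<rho>] i by (meson less_imp_le mult_right_mono order_trans zero_le)
    also have "\<dots> = ennreal (\<epsilon> * (C * 2 ^ n))" using \<epsilon> by (simp add: ennreal_mult')
    finally have "u \<le> \<epsilon> * (C * 2 ^ n)" using \<epsilon> C(1) by (subst (asm) ennreal_le_iff) auto
    also have "\<dots> \<le> \<epsilon> * (C * 2 ^ n + 1)" using \<epsilon> by simp
    also have "\<dots> = u / 2"
    proof -
      have "C * 2 ^ n + 1 \<noteq> 0" using pos by simp
      then show ?thesis by (simp add: \<epsilon>_def field_simps)
    qed
    finally show False using u by simp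
  qed
qed

end

subsection \<open>Unions of similar copies\<close>

lemma image_decseq_compact:
  fixes F :: "'a::heine_borel \<Rightarrow> 'b::t1_space"
  assumes F: "continuous_on UNIV F" and S: "decseq S" "\<And>k :: nat. compact (S k)"
  shows "(\<Inter>k. F ` S k) = F ` (\<Inter>k. S k)"
proof
  show "(\<Inter>k. F ` S k) \<subseteq> F ` (\<Inter>k. S k)"
  proof
    fix y assume y: "y \<in> (\<Inter>k. F ` S k)"
    have "closed (F -` {y})" by (intro closed_vimage F) simp
    then have "compact (S k \<inter> F -` {y})" for k using S(2) by (intro compact_Int_closed)
    moreover have "S k \<inter> F -` {y} \<noteq> {}" for k using y by blast
    moreover have "S n \<inter> F -` {y} \<subseteq> S m \<inter> F -` {y}" if "m \<le> n" for m n
      using decseqD[OF S(1) that] by blast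
    ultimately have "(\<Inter>k. S k \<inter> F -` {y}) \<noteq> {}" by (rule compact_nest)
    then show "y \<in> F ` (\<Inter>k. S k)" by blast
  qed
qed blast

text \<open>The image need not be Borel. The outer measure of the image, as a function of the subset
  of \<open>A\<close>, is continuous along increasing unions, so the selection lemma finds compact
  sets inside \<open>A\<close> with images of nearly full outer measure. The image is thus squeezed
  between a countable union of compact sets and a measurable hull of the same finite
  measure.\<close>

lemma bounded_image_lebesgue_measurable:
  fixes F :: "'a::euclidean_space \<Rightarrow> 'b::euclidean_space"
  assumes A: "A \<in> sets borel" "bounded A" and F: "continuous_on UNIV F"
  shows "F ` A \<in> sets lebesgue"
proof -
  define cap where "cap = (\<lambda>S. outer_measure_of lborel (F ` S))"
  have cF: "continuous_on S F" for S using F continuous_on_subset by blast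
  have "compact (F ` closure A)" using A(2) by (intro compact_continuous_image cF) simp
  then have fin: "emeasure lborel (F ` closure A) < \<infinity>" by (rule emeasure_compact_finite)
  have "cap A \<le> outer_measure_of lborel (F ` closure A)"
    unfolding cap_def by (intro outer_measure_of_mono image_mono closure_subset)
  also have "\<dots> = emeasure lborel (F ` closure A)"
    using \<open>compact (F ` closure A)\<close> by (intro outer_measure_of_eq) (simp add: borel_compact)
  finally have capfin: "cap A < \<infinity>" using fin by simp
  have cont: "cap (\<Union>n. B n) = (SUP n. cap (B n))" if B: "incseq B" for B
  proof -
    have "F ` (\<Union>n. B n) = (\<Union>n. F ` B n)" by blast
    moreover have "incseq (\<lambda>n. F ` B n)" using B by (auto simp: incseq_def)
    ultimately show ?thesis
      unfolding cap_def using SUP_outer_measure_of_incseq[of "\<lambda>n. F ` B n" lborel] by simp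
  qed
  have inner: "\<exists>K. compact K \<and> K \<subseteq> F ` A \<and> c \<le> emeasure lborel K" if c: "c < cap A" for c
  proof -
    obtain S where S: "decseq S" "\<And>k. S k \<subseteq> A" "\<And>k. c < cap (S k)" "(\<Inter>k. closure (S k)) \<subseteq> A"
      using suslin_capacity_selection[where cap = cap, OF suslin_borel[OF A(1)] cont c] by metis
    have cS: "compact (closure (S k))" for k
      using bounded_subset[OF A(2) S(2)[of k]] by simp
    have cFS: "compact (F ` closure (S k))" for k by (intro compact_continuous_image cF cS)
    have dS: "decseq (\<lambda>k. closure (S k))" using S(1) by (simp add: decseq_def closure_mono)
    have clK: "compact (\<Inter>k. closure (S k))"
      by (rule compact_Inter) (use cS in auto)
    have le: "c \<le> emeasure lborel (F ` closure (S k))" for k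
    proof -
      have "c \<le> cap (S k)" using S(3) by (rule less_imp_le)
      also have "\<dots> \<le> outer_measure_of lborel (F ` closure (S k))"
        unfolding cap_def by (intro outer_measure_of_mono image_mono closure_subset)
      also have "\<dots> = emeasure lborel (F ` closure (S k))"
        using cFS by (intro outer_measure_of_eq) (simp add: borel_compact)
      finally show ?thesis .
    qed
    \<comment> \<open>For decreasing compact sets image and intersection commute, so continuity of
      the measure from above carries the bound \<open>c\<close> to the limit set.\<close>
    have "emeasure lborel (F ` (\<Inter>k. closure (S k))) = (INF k. emeasure lborel (F ` closure (S k)))"
      unfolding image_decseq_compact[OF F dS cS, symmetric]
    proof (rule INF_emeasure_decseq[symmetric])
      show "range (\<lambda>k. F ` closure (S k)) \<subseteq> sets lborel" using cFS by (auto simp: borel_compact)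
      show "decseq (\<lambda>k. F ` closure (S k))" using dS by (auto simp: decseq_def intro!: image_mono)
      show "emeasure lborel (F ` closure (S k)) \<noteq> \<infinity>" for k
        using emeasure_compact_finite[OF cFS[of k]] by simp
    qed
    then have "c \<le> emeasure lborel (F ` (\<Inter>k. closure (S k)))" using le by (auto intro: INF_greatest)
    moreover have "compact (F ` (\<Inter>k. closure (S k)))" by (intro compact_continuous_image cF clK)
    moreover have "F ` (\<Inter>k. closure (S k)) \<subseteq> F ` A" using S(4) by (rule image_mono)
    ultimately show ?thesis by blast
  qed
  obtain G where G: "G \<in> sets lborel" "F ` A \<subseteq> G" "cap A = emeasure lborel G"
    using outer_measure_of_attain[of "F ` A" lborel] unfolding cap_def by auto
  show ?thesis
  proof (cases "cap A = 0")
    case True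
    then have "G \<in> null_sets lborel" using G by (intro null_setsI) auto
    then show ?thesis using G(2) by (rule sets_completionI_sub)
  next
    case False
    then have "0 < cap A" by (simp add: zero_less_iff_neq_zero)
    then obtain c :: "nat \<Rightarrow> ennreal" where c: "\<And>n. c n < cap A" "c \<longlonglongrightarrow> cap A"
      using approx_from_below_dense_linorder[of 0 "cap A"] by blast
    then have "\<forall>n. \<exists>K. compact K \<and> K \<subseteq> F ` A \<and> c n \<le> emeasure lborel K" using inner by blast
    then obtain K where K: "\<And>n. compact (K n)" "\<And>n. K n \<subseteq> F ` A" "\<And>n. c n \<le> emeasure lborel (K n)"
      by metis
    define U where "U = (\<Union>n. K n)"
    have U: "U \<in> sets lborel" using K(1) by (auto simp: U_def borel_compact)
    have UA: "U \<subseteq> F ` A" using K(2) by (auto simp: U_def)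
    have "c n \<le> emeasure lborel U" for n
      using K(3)[of n] emeasure_mono[of "K n" U lborel] U by (auto simp: U_def intro: order_trans)
    then have "cap A \<le> emeasure lborel U" using c(2) by (intro LIMSEQ_le_const2[of c]) auto
    then have "emeasure lborel (G - U) = 0"
      using U UA G capfin emeasure_mono[of U G lborel]
      by (subst emeasure_Diff) (auto simp: less_top[symmetric] dest: order_trans)
    then have null: "G - U \<in> null_sets lborel" using U G by (intro null_setsI) auto
    have "F ` A = U \<union> (F ` A - U)" "F ` A - U \<subseteq> G - U" using UA G(2) by blast+
    then show ?thesis by (rule sets_completionI[OF _ _ null U])
  qed
qed

lemma image_lebesgue_measurable:
  fixes F :: "'a::euclidean_space \<Rightarrow> 'b::euclidean_space"
  assumes A: "A \<in> sets borel" and F: "continuous_on UNIV F"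
  shows "F ` A \<in> sets lebesgue"
proof -
  have "A = (\<Union>n::nat. A \<inter> cball 0 (real n))"
  proof -
    have "\<exists>n. x \<in> cball 0 (real n)" for x :: 'a using real_arch_simple[of "norm x"] by auto
    then show ?thesis by blast
  qed
  then have "F ` A = (\<Union>n::nat. F ` (A \<inter> cball 0 (real n)))" by blast
  moreover have "F ` (A \<inter> cball 0 (real n)) \<in> sets lebesgue" for n :: nat
    using A by (intro bounded_image_lebesgue_measurable F) auto
  ultimately show ?thesis by (simp only:) (intro sets.countable_UN, auto)
qed

section \<open>Exponents below the dimensions\<close>

lemma hausdorff_measure_0_neq_0:
  assumes "A \<noteq> {}"
  shows "hausdorff_measure 0 A \<noteq> 0"
proof -
  have "1 \<le> hausdorff_premeasure 0 1 A"
    unfolding hausdorff_premeasure_def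
  proof (rule INF_greatest)
    fix U :: "nat \<Rightarrow> 'a set"
    assume "U \<in> {U. A \<subseteq> (\<Union>i. U i) \<and> (\<forall>i. bounded (U i) \<and> diameter (U i) \<le> 1)}"
    then obtain i where i: "U i \<noteq> {}" using assms by blast
    have "1 = (\<Sum>i\<in>{i}. diam_pow 0 (U i))" using i by (simp add: diam_pow_def)
    also have "\<dots> \<le> (\<Sum>i. diam_pow 0 (U i))" by (rule sum_le_suminf) auto
    finally show "1 \<le> (\<Sum>i. diam_pow 0 (U i))" .
  qed
  also have "\<dots> \<le> hausdorff_measure 0 A"
    unfolding hausdorff_measure_def by (rule SUP_upper) simp
  finally show ?thesis by auto
qed

lemma hausdorff_dim_nonneg: "0 \<le> hausdorff_dim A"
  unfolding hausdorff_dim_def by (rule Inf_greatest) auto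

text \<open>A value \<open>x\<close> that is not positive is raised to the exponent 0, for which
  Frostman's lemma asks only that the set be non-empty; hence the disjunction.\<close>

lemma hausdorff_measure_neq_0_below_dim:
  assumes "ereal x < hausdorff_dim A"
  obtains s where "x \<le> s" "s = 0 \<or> (0 < s \<and> hausdorff_measure s A \<noteq> 0)"
proof (cases "x \<le> 0")
  case True
  then show thesis using that by blast
next
  case False
  have "hausdorff_measure x A \<noteq> 0"
  proof
    assume "hausdorff_measure x A = 0"
    then have "hausdorff_dim A \<le> ereal x"
      unfolding hausdorff_dim_def using False by (intro Inf_lower) auto
    then show False using assms by simp
  qed
  then show thesis using that[of x] False by simp
qed

text \<open>Dimensions are extended reals here. An infinite summand exceeds \<open>x\<close> without
  help from the other, which is the source of the last two outcomes; they are completed later with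
  exponent 0.\<close>

lemma ereal_less_add_split:
  assumes "ereal x < a + b" "0 \<le> a" "0 \<le> b"
  obtains y z where "ereal y < a" "ereal z < b" "x < y + z"
    | y where "ereal y < a" "x < y"
    | z where "ereal z < b" "x < z"
proof (cases a)
  case (real a')
  show thesis
  proof (cases b)
    case (real b')
    define e where "e = (a' + b' - x) / 3"
    have "x < a' + b'" using assms(1) \<open>a = ereal a'\<close> real by simp
    then have e: "0 < e" "x < (a' - e) + (b' - e)" by (auto simp: e_def field_simps)
    then show thesis using that(1)[of "a' - e" "b' - e"] \<open>a = ereal a'\<close> real by simp
  next
    case PInf
    then show thesis using that(3)[of "x + 1"] by simp
  qed (use assms in auto)
next
  case PInf
  then show thesis using that(2)[of "x + 1"] by simp
qed (use assms in auto)

lemma hausdorff_dims_split: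
  assumes "ereal x < hausdorff_dim A + hausdorff_dim B"
  obtains s t where "x < s + t" "s = 0 \<or> (0 < s \<and> hausdorff_measure s A \<noteq> 0)"
    "t = 0 \<or> (0 < t \<and> hausdorff_measure t B \<noteq> 0)"
  using assms hausdorff_dim_nonneg[of A] hausdorff_dim_nonneg[of B]
proof (cases rule: ereal_less_add_split)
  case (1 y z)
  obtain s t where "y \<le> s" "s = 0 \<or> (0 < s \<and> hausdorff_measure s A \<noteq> 0)"
    "z \<le> t" "t = 0 \<or> (0 < t \<and> hausdorff_measure t B \<noteq> 0)"
    using hausdorff_measure_neq_0_below_dim[OF 1(1)] hausdorff_measure_neq_0_below_dim[OF 1(2)] by metis
  then show thesis using that[of s t] 1(3) by auto
next
  case (2 y)
  obtain s where "y \<le> s" "s = 0 \<or> (0 < s \<and> hausdorff_measure s A \<noteq> 0)"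
    using hausdorff_measure_neq_0_below_dim[OF 2(1)] by metis
  then show thesis using that[of s 0] 2(2) by auto
next
  case (3 z)
  obtain t where "z \<le> t" "t = 0 \<or> (0 < t \<and> hausdorff_measure t B \<noteq> 0)"
    using hausdorff_measure_neq_0_below_dim[OF 3(1)] by metis
  then show thesis using that[of 0 t] 3(2) by auto
qed

text \<open>Finite Borel measures on Euclidean space are regular. The support is closed, being the
  complement of a union of open null sets, and it lies in \<open>K\<close> because the complement of
  \<open>K\<close> is such a set.\<close>

lemma radon_measures_on_compact:
  fixes \<kappa> :: "'a::euclidean_space measure"
  assumes \<kappa>: "prob_space \<kappa>" "sets \<kappa> = sets borel" and K: "compact K" "emeasure \<kappa> K = 1" "K \<subseteq> A"
  shows "\<kappa> \<in> radon_measures_on A"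
proof -
  interpret prob_space \<kappa> by fact
  have Kb: "K \<in> sets \<kappa>" using K(1) \<kappa>(2) by (simp add: borel_compact)
  have sp: "space \<kappa> = UNIV" using sets_eq_imp_space_eq[OF \<kappa>(2)] by simp
  have finite: "emeasure \<kappa> (space \<kappa>) \<noteq> \<infinity>" by (simp add: emeasure_space_1)
  have "radon_measure \<kappa>"
    unfolding radon_measure_def
  proof (intro conjI allI impI ballI)
    show "emeasure \<kappa> L < \<infinity>" for L by (simp add: emeasure_eq_measure)
    show "emeasure \<kappa> U = (SUP K\<in>{K. compact K \<and> K \<subseteq> U}. emeasure \<kappa> K)" if "open U" for U
      using inner_regular[OF \<kappa>(2) finite, of U] that by (simp add: conj_commute)
    show "emeasure \<kappa> B = (INF U\<in>{U. open U \<and> B \<subseteq> U}. emeasure \<kappa> U)" if "B \<in> sets borel" for B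
      using outer_regular[OF \<kappa>(2) finite that] by (simp add: conj_commute)
  qed fact
  have "emeasure \<kappa> (- K) = 0"
    using emeasure_compl[OF Kb] K(2) emeasure_space_1 by (simp add: sp Compl_eq_Diff_UNIV)
  then have supp: "measure_support \<kappa> \<subseteq> K"
    unfolding measure_support_def using compact_imp_closed[OF K(1)] by (force simp: closed_def)
  have "- measure_support \<kappa> = \<Union>{U. open U \<and> emeasure \<kappa> U = 0}"
    unfolding measure_support_def by (auto simp: zero_less_iff_neq_zero)
  then have "open (- measure_support \<kappa>)" by auto
  then have "closed (measure_support \<kappa>)" by (simp add: closed_def)
  then have "compact (measure_support \<kappa>)"
    using supp K(1) by (metis compact_Int_closed inf.absorb2)
  then show ?thesis
    unfolding radon_measures_on_def using \<open>radon_measure \<kappa>\<close> supp K(3) by (auto simp: emeasure_space_1)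
qed

text \<open>Both Frostman measures live on compact sets, so \<open>\<kappa>\<close> lives on the
  continuous image of their product, a compact part of the union of copies. The measure is fixed
  before \<open>\<sigma>\<close>, so all admissible exponents share it.\<close>

theorem similar_copies_union_measure:
  fixes E :: "'a::euclidean_space set"
  assumes E: "E \<in> sets borel" "E \<noteq> {}" and \<Gamma>: "\<Gamma> \<in> sets borel" "\<Gamma> \<noteq> {}"
    and s: "s = 0 \<or> (0 < s \<and> hausdorff_measure s E \<noteq> 0)"
    and t: "t = 0 \<or> (0 < t \<and> hausdorff_measure t \<Gamma> \<noteq> 0)"
  obtains \<kappa> K where "prob_space \<kappa>" "sets \<kappa> = sets borel" "compact K" "K \<subseteq> similar_copies_union \<Gamma> E" "emeasure \<kappa> K = 1"
    "\<And>\<sigma>. \<sigma> < s + t - real DIM('a) \<Longrightarrow>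
      (\<integral>\<^sup>+\<xi>. ennreal ((cmod (fourier_transform \<kappa> \<xi>))\<^sup>2 * (1 + norm \<xi>) powr (\<sigma> - real DIM('a))) \<partial>lborel) < \<infinity>"
proof -
  obtain \<mu> K1 C1 where \<mu>: "prob_space \<mu>" "sets \<mu> = sets borel" "compact K1" "K1 \<subseteq> E" "emeasure \<mu> K1 = 1"
    "\<And>x r. 0 < r \<Longrightarrow> measure \<mu> (cball x r) \<le> C1 * r powr s"
    by (rule frostman[OF E s]) blast
  obtain \<nu> K2 C2 where \<nu>: "prob_space \<nu>" "sets \<nu> = sets borel" "compact K2" "K2 \<subseteq> \<Gamma>" "emeasure \<nu> K2 = 1"
    "\<And>p r. 0 < r \<Longrightarrow> measure \<nu> (cball p r) \<le> C2 * r powr t"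
    by (rule frostman[OF \<Gamma> t]) blast
  obtain M1 where M1: "\<And>x. x \<in> K1 \<Longrightarrow> norm x \<le> M1"
    using compact_imp_bounded[OF \<mu>(3)] by (auto simp: bounded_iff)
  obtain M2 where M2: "\<And>p. p \<in> K2 \<Longrightarrow> norm p \<le> M2"
    using compact_imp_bounded[OF \<nu>(3)] by (auto simp: bounded_iff)
  define M where "M = max 1 (max M1 M2)"
  define C where "C = max 0 (max C1 C2)"
  interpret \<mu>: prob_space \<mu> by fact
  interpret \<nu>: prob_space \<nu> by fact
  have K1b: "K1 \<in> sets \<mu>" using \<mu>(2,3) by (simp add: borel_compact)
  have K2b: "K2 \<in> sets \<nu>" using \<nu>(2,3) by (simp add: borel_compact)
  have AE1: "AE x in \<mu>. x \<in> K1" using K1b \<mu>(5) by (intro \<mu>.AE_prob_1) (simp add: measure_def)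
  have AE2: "AE p in \<nu>. p \<in> K2" using K2b \<nu>(5) by (intro \<nu>.AE_prob_1) (simp add: measure_def)
  interpret F: frostman_pair \<mu> \<nu> s t C M
  proof
    show "measure \<mu> (cball x r) \<le> C * r powr s" if "0 < r" for x r
      by (rule order_trans[OF \<mu>(6)[OF that]], rule mult_right_mono) (auto simp: C_def)
    show "measure \<nu> (cball p r) \<le> C * r powr t" if "0 < r" for p r
      by (rule order_trans[OF \<nu>(6)[OF that]], rule mult_right_mono) (auto simp: C_def)
    show "AE x in \<mu>. norm x \<le> M" using AE1 by eventually_elim (use M1 in \<open>force simp: M_def\<close>)
    show "AE p in \<nu>. \<bar>snd p\<bar> \<le> M"
      using AE2
    proof eventually_elim
      fix p assume "p \<in> K2"
      then have "norm (snd p) \<le> M2" using M2[of p] norm_snd_le[of "snd p" "fst p"] by simp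
      then show "\<bar>snd p\<bar> \<le> M" by (simp add: M_def)
    qed
    show "1 \<le> M" "0 \<le> C" "0 \<le> t" using t by (auto simp: M_def C_def)
  qed (use \<mu>(1,2) \<nu>(1,2) in auto)
  define f where "f = (\<lambda>(p :: 'a \<times> real, x :: 'a). snd p *\<^sub>R x + fst p)"
  define K where "K = f ` (K2 \<times> K1)"
  have "continuous_on UNIV f" unfolding f_def split_beta' by (intro continuous_intros)
  then have Kc: "compact K"
    unfolding K_def using \<mu>(3) \<nu>(3) by (intro compact_continuous_image compact_Times) (auto intro: continuous_on_subset)
  show thesis
  proof
    show "prob_space F.\<kappa>" by (rule F.\<kappa>_prob)
    show "sets F.\<kappa> = sets borel" by (rule F.\<kappa>_sets)
    show "compact K" by (rule Kc)
    show "K \<subseteq> similar_copies_union \<Gamma> E"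
      using \<mu>(4) \<nu>(4) by (force simp: K_def f_def similar_copies_union_def)
    show "emeasure F.\<kappa> K = 1"
    proof -
      interpret \<kappa>: prob_space F.\<kappa> by (rule F.\<kappa>_prob)
      have Kb: "K \<in> sets borel" using Kc by (rule borel_compact)
      have mf: "f \<in> measurable (\<nu> \<Otimes>\<^sub>M \<mu>) borel" unfolding f_def split_beta' by measurable
      have "AE p in \<nu>. AE x in \<mu>. f (p, x) \<in> K"
        using AE2
      proof eventually_elim
        fix p assume p: "p \<in> K2"
        show "AE x in \<mu>. f (p, x) \<in> K" using AE1 by eventually_elim (use p in \<open>auto simp: K_def\<close>)
      qed
      moreover have "{q \<in> space (\<nu> \<Otimes>\<^sub>M \<mu>). f q \<in> K} \<in> sets (\<nu> \<Otimes>\<^sub>M \<mu>)"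
        using measurable_sets[OF mf Kb] by (simp add: vimage_def Int_def conj_commute)
      ultimately have "AE q in \<nu> \<Otimes>\<^sub>M \<mu>. f q \<in> K" by (intro F.\<nu>\<mu>.AE_pair_measure)
      then have "AE y in F.\<kappa>. y \<in> K"
        unfolding F.\<kappa>_def f_def[symmetric] using Kb by (subst AE_distr_iff[OF mf]) auto
      then have "\<kappa>.prob K = 1" using Kb F.\<kappa>_sets by (subst \<kappa>.prob_eq_1) auto
      then show ?thesis by (simp add: \<kappa>.emeasure_eq_measure)
    qed
    show "(\<integral>\<^sup>+\<xi>. ennreal ((cmod (fourier_transform F.\<kappa> \<xi>))\<^sup>2 * (1 + norm \<xi>) powr (\<sigma> - real DIM('a))) \<partial>lborel) < \<infinity>"
      if "\<sigma> < s + t - real DIM('a)" for \<sigma>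
      by (rule F.sobolev_integral_finite[OF that])
  qed
qed

section \<open>Sobolev dimension, volume and Hausdorff dimension of the union of copies\<close>

lemma sobolev_dim_similar_copies_union:
  fixes E :: "'a::euclidean_space set"
  assumes E: "E \<in> sets borel" "E \<noteq> {}" and \<Gamma>: "\<Gamma> \<in> sets borel" "\<Gamma> \<noteq> {}"
  shows "hausdorff_dim E + hausdorff_dim \<Gamma> - ereal (real DIM('a)) \<le> sobolev_dim (similar_copies_union \<Gamma> E)"
proof (rule dense_le)
  fix y assume y: "y < hausdorff_dim E + hausdorff_dim \<Gamma> - ereal (real DIM('a))"
  show "y \<le> sobolev_dim (similar_copies_union \<Gamma> E)"
  proof (cases y)
    case (real \<sigma>)
    have "ereal (\<sigma> + real DIM('a)) < hausdorff_dim E + hausdorff_dim \<Gamma>"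
      using y unfolding real by (subst (asm) ereal_less_minus_iff) auto
    then obtain s t where st: "\<sigma> + real DIM('a) < s + t" "s = 0 \<or> (0 < s \<and> hausdorff_measure s E \<noteq> 0)"
      "t = 0 \<or> (0 < t \<and> hausdorff_measure t \<Gamma> \<noteq> 0)"
      by (rule hausdorff_dims_split)
    obtain \<kappa> K where \<kappa>: "prob_space \<kappa>" "sets \<kappa> = sets borel" "compact K" "K \<subseteq> similar_copies_union \<Gamma> E" "emeasure \<kappa> K = 1"
      "\<And>\<sigma>. \<sigma> < s + t - real DIM('a) \<Longrightarrow>
        (\<integral>\<^sup>+\<xi>. ennreal ((cmod (fourier_transform \<kappa> \<xi>))\<^sup>2 * (1 + norm \<xi>) powr (\<sigma> - real DIM('a))) \<partial>lborel) < \<infinity>"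
      by (rule similar_copies_union_measure[OF E \<Gamma> st(2,3)]) blast
    have "\<sigma> < s + t - real DIM('a)" using st(1) by simp
    from \<kappa>(6)[OF this] have "ereal \<sigma> \<le> sobolev_dim_measure \<kappa>"
      unfolding sobolev_dim_measure_def by (intro Sup_upper) auto
    also have "\<dots> \<le> sobolev_dim (similar_copies_union \<Gamma> E)"
      unfolding sobolev_dim_def using radon_measures_on_compact[OF \<kappa>(1,2,3,5,4)] \<kappa>(1) by (intro Sup_upper) auto
    finally show ?thesis unfolding real .
  qed (use y in auto)
qed

lemma emeasure_similar_copies_union_pos:
  fixes E :: "'a::euclidean_space set"
  assumes E: "E \<in> sets borel" "E \<noteq> {}" and \<Gamma>: "\<Gamma> \<in> sets borel" "\<Gamma> \<noteq> {}"
    and dims: "ereal (2 * real DIM('a)) < hausdorff_dim E + hausdorff_dim \<Gamma>"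
  shows "0 < emeasure lebesgue (similar_copies_union \<Gamma> E)"
proof -
  obtain s t where st: "2 * real DIM('a) < s + t" "s = 0 \<or> (0 < s \<and> hausdorff_measure s E \<noteq> 0)"
    "t = 0 \<or> (0 < t \<and> hausdorff_measure t \<Gamma> \<noteq> 0)"
    using dims by (rule hausdorff_dims_split)
  obtain \<kappa> K where \<kappa>: "prob_space \<kappa>" "sets \<kappa> = sets borel" "compact K" "K \<subseteq> similar_copies_union \<Gamma> E" "emeasure \<kappa> K = 1"
    "\<And>\<sigma>. \<sigma> < s + t - real DIM('a) \<Longrightarrow>
      (\<integral>\<^sup>+\<xi>. ennreal ((cmod (fourier_transform \<kappa> \<xi>))\<^sup>2 * (1 + norm \<xi>) powr (\<sigma> - real DIM('a))) \<partial>lborel) < \<infinity>"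
    by (rule similar_copies_union_measure[OF E \<Gamma> st(2,3)]) blast
  interpret prob_space \<kappa> by fact
  \<comment> \<open>As s + t exceeds 2 d strictly, the critical exponent d itself lies below s + t -
    d.\<close>
  interpret sobolev_measure \<kappa> "real DIM('a)"
    using \<kappa>(2) \<kappa>(6)[of "real DIM('a)"] st(1) by unfold_locales auto
  have "0 < emeasure lborel K" by (rule emeasure_lborel_compact_pos[OF refl \<kappa>(3,5)])
  also have "emeasure lborel K = emeasure lebesgue K" using \<kappa>(3) by (simp add: borel_compact)
  also have "\<dots> \<le> emeasure lebesgue (similar_copies_union \<Gamma> E)"
  \<comment> \<open>A non-measurable set has \<open>emeasure\<close> 0 by convention, so
    monotonicity can be used only after the union of copies is known to be Lebesgue
    measurable.\<close>
  proof (rule emeasure_mono[OF \<kappa>(4)])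
    define f where "f = (\<lambda>q :: 'a \<times> ('a \<times> real). snd (snd q) *\<^sub>R fst q + fst (snd q))"
    have "similar_copies_union \<Gamma> E = f ` (E \<times> \<Gamma>)"
      unfolding similar_copies_union_def f_def by force
    moreover have "continuous_on UNIV f" unfolding f_def by (intro continuous_intros)
    moreover have "E \<times> \<Gamma> \<in> sets borel" using E(1) \<Gamma>(1) by (rule borel_Times)
    ultimately show "similar_copies_union \<Gamma> E \<in> sets lebesgue" by (simp only: image_lebesgue_measurable)
  qed
  finally show ?thesis .
qed

lemma hausdorff_dim_similar_copies_union:
  fixes E :: "'a::euclidean_space set"
  assumes E: "E \<in> sets borel" "E \<noteq> {}" and \<Gamma>: "\<Gamma> \<in> sets borel" "\<Gamma> \<noteq> {}"
    and u: "u < real DIM('a)" and dims: "ereal (real DIM('a) + u) < hausdorff_dim E + hausdorff_dim \<Gamma>"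
  shows "ereal u \<le> hausdorff_dim (similar_copies_union \<Gamma> E)"
proof -
  obtain s t where st: "real DIM('a) + u < s + t" "s = 0 \<or> (0 < s \<and> hausdorff_measure s E \<noteq> 0)"
    "t = 0 \<or> (0 < t \<and> hausdorff_measure t \<Gamma> \<noteq> 0)"
    using dims by (rule hausdorff_dims_split)
  obtain \<kappa> K where \<kappa>: "prob_space \<kappa>" "sets \<kappa> = sets borel" "compact K" "K \<subseteq> similar_copies_union \<Gamma> E" "emeasure \<kappa> K = 1"
    "\<And>\<sigma>. \<sigma> < s + t - real DIM('a) \<Longrightarrow>
      (\<integral>\<^sup>+\<xi>. ennreal ((cmod (fourier_transform \<kappa> \<xi>))\<^sup>2 * (1 + norm \<xi>) powr (\<sigma> - real DIM('a))) \<partial>lborel) < \<infinity>"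
    by (rule similar_copies_union_measure[OF E \<Gamma> st(2,3)]) blast
  \<comment> \<open>The energy exponent must stay at most d and below s + t - d, and it must exceed
    \<open>u\<close> strictly, so that every v < u is strictly below it.\<close>
  obtain \<sigma> where sig: "u < \<sigma>" "\<sigma> < real DIM('a)" "\<sigma> < s + t - real DIM('a)"
    using dense[of u "min (real DIM('a)) (s + t - real DIM('a))"] u st(1) by auto
  interpret prob_space \<kappa> by fact
  interpret sobolev_measure \<kappa> \<sigma>
    using \<kappa>(2) \<kappa>(6)[OF sig(3)] sig(2) by unfold_locales auto
  have Kb: "K \<in> sets borel" using \<kappa>(3) by (rule borel_compact)
  have ne: "similar_copies_union \<Gamma> E \<noteq> {}" using \<kappa>(4,5) by auto
  show ?thesis
    unfolding hausdorff_dim_def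
  proof (rule Inf_greatest)
    fix y assume "y \<in> {ereal s | s. 0 \<le> s \<and> hausdorff_measure s (similar_copies_union \<Gamma> E) = 0}"
    then obtain v where v: "y = ereal v" "0 \<le> v" "hausdorff_measure v (similar_copies_union \<Gamma> E) = 0" by blast
    have "u \<le> v"
    proof (rule ccontr)
      assume "\<not> u \<le> v"
      then have "v < \<sigma>" using sig(1) by simp
      \<comment> \<open>The energy argument needs a positive exponent; for \<open>v = 0\<close>
        non-emptiness alone gives a non-zero measure.\<close>
      then show False
        using v hausdorff_measure_0_neq_0[OF ne] hausdorff_measure_neq_0[OF _ _ Kb \<kappa>(5,4), of v]
        by (cases "v = 0") auto
    qed
    then show "ereal u \<le> y" by (simp add: v)
  qed
qed

theorem theorem1p2:
  fixes E :: "(real ^ 'd) set"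
    and \<Gamma> :: "((real ^ 'd) \<times> real) set"
  assumes "E \<in> sets borel" and "E \<noteq> {}"
    and "\<Gamma> \<in> sets borel" and "\<Gamma> \<noteq> {}" and "\<Gamma> \<subseteq> UNIV \<times> {0<..}"
  shows "sobolev_dim (similar_copies_union \<Gamma> E)
           \<ge> hausdorff_dim E + hausdorff_dim \<Gamma> - ereal (real CARD('d))
       \<and> (hausdorff_dim E + hausdorff_dim \<Gamma> > ereal (2 * real CARD('d)) \<longrightarrow>
           emeasure lebesgue (similar_copies_union \<Gamma> E) > 0)
       \<and> (\<forall>u::real. 0 < u \<and> u < real CARD('d) \<and>
             hausdorff_dim E + hausdorff_dim \<Gamma> > ereal (real CARD('d) + u) \<longrightarrow>
           hausdorff_dim (similar_copies_union \<Gamma> E) \<ge> ereal u)"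
  using sobolev_dim_similar_copies_union[OF assms(1-4)] emeasure_similar_copies_union_pos[OF assms(1-4)]
    hausdorff_dim_similar_copies_union[OF assms(1-4)]
  by simp

end
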